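(* Let $\gamma\neq 0$, $\mu>0$ and $\nu\in(0,1]$. The solution to the fractional partial differential equation $$\frac{\partial^\nu \tilde u^{\gamma,\mu}_\nu}{\partial t^\nu}(x,t)=\mathcal{G}^{*}\,\tilde u^{\gamma,\mu}_\nu(x,t),\qquad x\in\Omega_\infty=(0,+\infty),\ t>0,$$ subject to the initial condition $\tilde u^{\gamma,\mu}_\nu(x,0)=\delta(x)$, is given by $$\tilde u^{\gamma,\mu}_\nu(x,t)=\int_0^\infty \tilde g^{\gamma}_\mu(x,s)\,l_\nu(s,t)\,ds .$$
   Context: The operator $\mathcal{G}^*$ acts in the variable $x>0$ by $$\mathcal{G}^* f=\frac{1}{\gamma^2}\frac{\partial}{\partial x}\left(x^{\gamma\mu-\gamma+1}\frac{\partial}{\partial x}\left(\frac{1}{\mathfrak w(x)}f\right)\right),\qquad \mathfrak w(x)=x^{\gamma\mu-1}.$$ For $\nu\in(0,1)$, $\frac{\partial^\nu}{\partial t^\nu}$ is the Riemann–Liouville derivative $$\frac{\partial^\nu f}{\partial t^\nu}(t)=\frac{1}{\Gamma(1-\nu)}\frac{d}{dt}\int_0^t (t-s)^{-\nu}f(s)\,ds;$$ for $\nu=1$ it is the ordinary derivative $\partial/\partial t$. For $x,t>0$, $$g^\gamma_\mu(x,t)=\mathrm{sign}(\gamma)\,\frac1t\,Q^\gamma_\mu\!\left(\frac xt\right),\qquad Q^\gamma_\mu(z)=\gamma\,\frac{z^{\gamma\mu-1}}{\Gamma(\mu)}e^{-z^\gamma},\qquad \tilde g^\gamma_\mu(x,t)=g^\gamma_\mu(x,t^{1/\gamma}),$$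 so that $\tilde g^\gamma_\mu(x,t)=\frac{|\gamma|\,x^{\gamma\mu-1}}{t^{\mu}\,\Gamma(\mu)}e^{-x^\gamma/t}$. For $\nu\in(0,1)$, $l_\nu(x,t)$ ($x,t>0$) is the density of $\mathfrak L^\nu_t$, the inverse of the stable subordinator $\mathfrak H^\nu$: $\Pr\{\mathfrak L^\nu_t<x\}=\Pr\{\mathfrak H^\nu_x>t\}$, where $\mathfrak H^\nu$ is the non-negative stable process with $E\exp(-\lambda\mathfrak H^\nu_t)=\exp(-t\lambda^\nu)$. Equivalently $\int_0^\infty e^{-\lambda t}l_\nu(x,t)\,dt=\lambda^{\nu-1}\exp(-x\lambda^\nu)$. For $\nu=1$, $l_1(s,t)=\delta(s-t)$, so that $\tilde u^{\gamma,\mu}_1=\tilde g^\gamma_\mu$.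
   Formalization: For γ<0 the initial condition δ(x) at x=0 is false (the mass escapes to +∞ as t→0+); there the theorem proves weak convergence to 0 on (0,∞) and to a unit mass at +∞ instead. "The solution" is read as "a solution": uniqueness, false without boundary conditions, is not claimed. *)

theory Defs
  imports "HOL-Probability.Probability"
begin

definition weight :: "real \<Rightarrow> real \<Rightarrow> real \<Rightarrow> real" where
  "weight \<gamma> \<mu> x = x powr (\<gamma> * \<mu> - 1)"

definition Gstar :: "real \<Rightarrow> real \<Rightarrow> (real \<Rightarrow> real) \<Rightarrow> real \<Rightarrow> real" where
  "Gstar \<gamma> \<mu> f x =
     1 / \<gamma>^2 * deriv (\<lambda>y. y powr (\<gamma> * \<mu> - \<gamma> + 1) * deriv (\<lambda>z. 1 / weight \<gamma> \<mu> z * f z) y) x"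

text \<open>The constant \<open>deriv\<close> is total, so the existence of the derivatives that occur in
  \<open>Gstar\<close> (and in \<open>RL_deriv\<close> below) is a separate predicate.\<close>

definition Gstar_exists :: "real \<Rightarrow> real \<Rightarrow> (real \<Rightarrow> real) \<Rightarrow> real \<Rightarrow> bool" where
  "Gstar_exists \<gamma> \<mu> f x \<longleftrightarrow>
     (\<forall>\<^sub>F y in nhds x. (\<lambda>z. 1 / weight \<gamma> \<mu> z * f z) field_differentiable at y) \<and>
     (\<lambda>y. y powr (\<gamma> * \<mu> - \<gamma> + 1) * deriv (\<lambda>z. 1 / weight \<gamma> \<mu> z * f z) y)
       field_differentiable at x"

definition RL_deriv :: "real \<Rightarrow> (real \<Rightarrow> real) \<Rightarrow> real \<Rightarrow> real" where
  "RL_deriv \<nu> f t =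
     (if \<nu> = 1 then deriv f t
      else 1 / Gamma (1 - \<nu>) *
        deriv (\<lambda>\<tau>. set_lebesgue_integral lborel {0<..<\<tau>} (\<lambda>s. (\<tau> - s) powr (-\<nu>) * f s)) t)"

definition RL_deriv_exists :: "real \<Rightarrow> (real \<Rightarrow> real) \<Rightarrow> real \<Rightarrow> bool" where
  "RL_deriv_exists \<nu> f t \<longleftrightarrow>
     (if \<nu> = 1 then f field_differentiable at t
      else (\<forall>\<^sub>F \<tau> in nhds t. set_integrable lborel {0<..<\<tau>} (\<lambda>s. (\<tau> - s) powr (-\<nu>) * f s)) \<and>
        (\<lambda>\<tau>. set_lebesgue_integral lborel {0<..<\<tau>} (\<lambda>s. (\<tau> - s) powr (-\<nu>) * f s))
          field_differentiable at t)"

definition Q :: "real \<Rightarrow> real \<Rightarrow> real \<Rightarrow> real" where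
  "Q \<gamma> \<mu> z = \<gamma> * (z powr (\<gamma> * \<mu> - 1) / Gamma \<mu>) * exp (- (z powr \<gamma>))"

definition g :: "real \<Rightarrow> real \<Rightarrow> real \<Rightarrow> real \<Rightarrow> real" where
  "g \<gamma> \<mu> x t = sgn \<gamma> * (1 / t) * Q \<gamma> \<mu> (x / t)"

definition gtilde :: "real \<Rightarrow> real \<Rightarrow> real \<Rightarrow> real \<Rightarrow> real" where
  "gtilde \<gamma> \<mu> x t = g \<gamma> \<mu> x (t powr (1 / \<gamma>))"

definition stable_subordinator :: "'a measure \<Rightarrow> real \<Rightarrow> (real \<Rightarrow> 'a \<Rightarrow> real) \<Rightarrow> bool" where
  "stable_subordinator M \<nu> H \<longleftrightarrow>
     prob_space M \<and>
     (\<forall>t\<ge>0. H t \<in> borel_measurable M) \<and>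
     (AE \<omega> in M. H 0 \<omega> = 0) \<and>
     (\<forall>t\<ge>0. AE \<omega> in M. 0 \<le> H t \<omega>) \<and>
     (\<forall>s\<ge>0. \<forall>t\<ge>0. distr M borel (\<lambda>\<omega>. H (s + t) \<omega> - H s \<omega>) = distr M borel (H t)) \<and>
     (\<forall>(\<tau> :: nat \<Rightarrow> real) n. 0 \<le> \<tau> 0 \<and> mono \<tau> \<longrightarrow>
        prob_space.indep_vars M (\<lambda>_. borel) (\<lambda>k \<omega>. H (\<tau> (Suc k)) \<omega> - H (\<tau> k) \<omega>) {..<n}) \<and>
     (\<forall>t\<ge>0. \<forall>\<theta>>0. prob_space.expectation M (\<lambda>\<omega>. exp (- \<theta> * H t \<omega>)) = exp (- t * \<theta> powr \<nu>))"

definition inverse_process ::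
    "'a measure \<Rightarrow> (real \<Rightarrow> 'a \<Rightarrow> real) \<Rightarrow> (real \<Rightarrow> 'a \<Rightarrow> real) \<Rightarrow> bool" where
  "inverse_process M H L \<longleftrightarrow>
     (\<forall>t>0. L t \<in> borel_measurable M) \<and>
     (\<forall>x>0. \<forall>t>0. measure M {\<omega> \<in> space M. L t \<omega> < x} = measure M {\<omega> \<in> space M. H x \<omega> > t})"

text \<open>Nonnegativity is explicit because \<open>ennreal\<close> truncates negative values.\<close>

definition density_on_half_line ::
    "'a measure \<Rightarrow> (real \<Rightarrow> 'a \<Rightarrow> real) \<Rightarrow> (real \<Rightarrow> real \<Rightarrow> real) \<Rightarrow> bool" where
  "density_on_half_line M L l \<longleftrightarrow>
     (\<forall>x>0. \<forall>t>0. 0 \<le> l x t) \<and>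
     (\<forall>t>0. distributed M lborel (L t) (\<lambda>x. ennreal (indicator {0<..} x * l x t)))"

text \<open>For \<open>\<nu> = 1\<close> the kernel \<open>l s t\<close> is the Dirac mass \<open>\<delta>(s - t)\<close>, which has no density.\<close>

definition utilde ::
    "(real \<Rightarrow> real \<Rightarrow> real) \<Rightarrow> real \<Rightarrow> real \<Rightarrow> real \<Rightarrow> real \<Rightarrow> real \<Rightarrow> real" where
  "utilde l \<gamma> \<mu> \<nu> x t =
     (if \<nu> = 1 then gtilde \<gamma> \<mu> x t
      else set_lebesgue_integral lborel {0<..} (\<lambda>s. gtilde \<gamma> \<mu> x s * l s t))"

text \<open>The initial value \<open>\<delta>(x)\<close> is attained in the weak sense, as \<open>t\<close> tends to \<open>0\<close> from the
  right, against a class \<open>T\<close> of test functions.\<close>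

definition initial_delta :: "(real \<Rightarrow> real) set \<Rightarrow> (real \<Rightarrow> real \<Rightarrow> real) \<Rightarrow> bool" where
  "initial_delta T u \<longleftrightarrow>
     (\<forall>\<phi>\<in>T. (\<forall>t>0. set_integrable lborel {0<..} (\<lambda>x. \<phi> x * u x t)) \<and>
       ((\<lambda>t. set_lebesgue_integral lborel {0<..} (\<lambda>x. \<phi> x * u x t)) \<longlongrightarrow> \<phi> 0) (at_right 0))"

definition bounded_continuous_tests :: "(real \<Rightarrow> real) set" where
  "bounded_continuous_tests = {\<phi>. continuous_on {0..} \<phi> \<and> bounded (\<phi> ` {0..})}"

text \<open>Test functions on the open half-line, where \<open>\<delta>(x)\<close> is the zero distribution:
  these \<open>\<phi>\<close> all satisfy \<open>\<phi> 0 = 0\<close>.\<close>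

definition interior_tests :: "(real \<Rightarrow> real) set" where
  "interior_tests = {\<phi>. continuous_on UNIV \<phi> \<and>
     compact (closure {x. \<phi> x \<noteq> 0}) \<and> closure {x. \<phi> x \<noteq> 0} \<subseteq> {0<..}}"

text \<open>The kernel \<open>gtilde\<close> is the density of \<open>(t G) powr (1 / \<gamma>)\<close> with \<open>G\<close> Gamma distributed.
  As \<open>t\<close> tends to \<open>0\<close> this variable tends to \<open>0\<close> if \<open>\<gamma> > 0\<close>, but to infinity if \<open>\<gamma> < 0\<close>.
  In the latter case the initial unit mass therefore sits at the endpoint \<open>+\<infinity>\<close> of the
  half-line.\<close>

definition initial_delta_at_infinity :: "(real \<Rightarrow> real \<Rightarrow> real) \<Rightarrow> bool" where
  "initial_delta_at_infinity u \<longleftrightarrow>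
     (\<forall>\<phi> c. continuous_on {0<..} \<phi> \<and> bounded (\<phi> ` {0<..}) \<and> (\<phi> \<longlongrightarrow> c) at_top \<longrightarrow>
       (\<forall>t>0. set_integrable lborel {0<..} (\<lambda>x. \<phi> x * u x t)) \<and>
       ((\<lambda>t. set_lebesgue_integral lborel {0<..} (\<lambda>x. \<phi> x * u x t)) \<longlongrightarrow> c) (at_right 0))"

end

theory Submission
  imports Defs
begin

text \<open>
  For \<nu> < 1 the time variable of the kernel is randomised by the inverse \<open>L\<close> of a stable
  subordinator.  Two facts reduce everything to one positive random variable \<open>S = H 1\<close> with
  \<open>E exp (- \<theta> S) = exp (- \<theta> powr \<nu>)\<close>.  Laplace transforms determine laws on the half-line
  (\<open>distr_eq_of_Laplace_eq\<close>), so \<open>H z\<close> is distributed as \<open>z powr (1 / \<nu>) * S\<close>, and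
  inverting this scaling shows that \<open>L t\<close> is distributed as \<open>(t / S) powr \<nu>\<close>
  (\<open>distr_inverse_process\<close>).  Since \<open>gtilde \<gamma> \<mu> x s\<close> depends on \<open>s\<close> through
  \<open>(1 / s) powr \<mu> * exp (- a / s)\<close> with \<open>a = x powr \<gamma>\<close>, the solution is, up to the explicit factor
  \<open>\<bar>\<gamma>\<bar> / Gamma \<mu> * x powr (\<gamma> * \<mu> - 1)\<close>, the tilted moment
  \<open>m\<^sub>\<mu> (a, t) = E (Z powr \<mu> * exp (- a * Z))\<close> with \<open>Z = (S / t) powr \<nu>\<close>.

  Tilted moments are smooth in \<open>a\<close>, with \<open>\<partial> m\<^sub>p / \<partial> a = - m\<^sub>p\<^sub>+\<^sub>1\<close>.  Hence applying the
  spatial operator gives, up to the same factor, \<open>a * m\<^sub>\<mu>\<^sub>+\<^sub>2 - \<mu> * m\<^sub>\<mu>\<^sub>+\<^sub>1\<close>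
  (\<open>Gstar_of_profile\<close>).  What remains is that this is the Riemann-Liouville derivative of
  \<open>m\<^sub>\<mu>\<close> at every \<open>t > 0\<close>, and not just almost everywhere or after a Laplace transform.  It is
  enough to prove the integrated identity
    \<open>(t powr (- \<nu>) / Gamma (1 - \<nu>)) * m\<^sub>\<mu> = 1 * (a m\<^sub>\<mu>\<^sub>+\<^sub>2 - \<mu> m\<^sub>\<mu>\<^sub>+\<^sub>1)\<close>,
  where \<open>*\<close> between functions of time is convolution on the half-line, because the right-hand
  side is the integral of a continuous function.  Both sides are continuous, so equality of the
  Laplace transforms suffices
  (\<open>continuous_eq_0_of_Laplace_eq_0\<close>).  The Laplace transform of \<open>m\<^sub>p\<close> at \<open>l\<close> is
  \<open>l powr (\<nu> - 1) * K\<^sub>p (l powr \<nu>)\<close>, where \<open>K\<^sub>p\<close> is the Laplace transform of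
  \<open>r powr (- p) * exp (- a / r)\<close>, and the identity becomes the recurrence
  \<open>q * K\<^sub>\<mu> + \<mu> * K\<^sub>\<mu>\<^sub>+\<^sub>1 = a * K\<^sub>\<mu>\<^sub>+\<^sub>2\<close>, which is an integration by parts.

  For the initial condition, \<open>u (\<cdot>, t)\<close> is the density of \<open>((t / S) powr \<nu> * G) powr (1 / \<gamma>)\<close> with
  \<open>G\<close> an independent Gamma variable.  As \<open>t\<close> decreases to 0 this variable tends almost surely to 0 when
  \<open>\<gamma> > 0\<close> and to infinity when \<open>\<gamma> < 0\<close>, and dominated convergence concludes.

  The case \<open>\<nu> = 1\<close> has the same structure with \<open>S = 1\<close>; only the time derivative is then an
  ordinary one and is computed directly.
\<close>

section \<open>Uniqueness of Laplace transforms\<close>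

lemma integrable_mult_bounded_comp:
  fixes v V :: "'a \<Rightarrow> real" and k :: "real \<Rightarrow> real"
  assumes v: "integrable M v" and kV: "(\<lambda>x. k (V x)) \<in> borel_measurable M"
    and V: "AE x in M. V x \<in> A" and k: "\<And>y. y \<in> A \<Longrightarrow> \<bar>k y\<bar> \<le> C"
  shows "integrable M (\<lambda>x. v x * k (V x))"
proof (rule Bochner_Integration.integrable_bound[where f = "\<lambda>x. C * v x"])
  show "AE x in M. norm (v x * k (V x)) \<le> norm (C * v x)"
    using V
  proof eventually_elim
    case (elim x)
    from k[OF elim] have "\<bar>k (V x)\<bar> \<le> \<bar>C\<bar>" by linarith
    then have "\<bar>k (V x)\<bar> * \<bar>v x\<bar> \<le> \<bar>C\<bar> * \<bar>v x\<bar>" by (rule mult_right_mono) simp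
    then show ?case by (simp add: abs_mult mult.commute)
  qed
qed (use v kV in \<open>auto intro!: borel_measurable_times\<close>)

text \<open>
  By the Weierstrass theorem polynomials are uniformly dense in the continuous functions on
  \<open>{0..1}\<close>, and against an integrable weight a uniform error of the integrand is an error of the same
  order of the integral.  The signed weights allow both the comparison of two laws (weights 1) and
  the proof that a function vanishes (one weight is the function, the other is 0).
\<close>

lemma integral_cong_of_moments:
  fixes Y :: "'a \<Rightarrow> real" and Y' :: "'b \<Rightarrow> real" and w :: "'a \<Rightarrow> real" and w' :: "'b \<Rightarrow> real"
  assumes w: "integrable M w" and w': "integrable N w'"
    and Y[measurable]: "Y \<in> borel_measurable M" and Y'[measurable]: "Y' \<in> borel_measurable N"
    and Y01: "AE x in M. Y x \<in> {0..1}" and Y01': "AE x in N. Y' x \<in> {0..1}"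
    and mom: "\<And>n::nat. (\<integral>x. w x * Y x ^ n \<partial>M) = (\<integral>x. w' x * Y' x ^ n \<partial>N)"
    and h: "continuous_on {0..1} h"
    and hY[measurable]: "(\<lambda>x. h (Y x)) \<in> borel_measurable M" and hY'[measurable]: "(\<lambda>x. h (Y' x)) \<in> borel_measurable N"
  shows "(\<integral>x. w x * h (Y x) \<partial>M) = (\<integral>x. w' x * h (Y' x) \<partial>N)"
proof -
  have [measurable]: "w \<in> borel_measurable M" "w' \<in> borel_measurable N" using w w' by auto
  have bounded: "bounded (h ` {0..1})"
    using h by (intro compact_imp_bounded compact_continuous_image) auto
  then obtain B where B: "\<And>y. y \<in> {0..1} \<Longrightarrow> \<bar>h y\<bar> \<le> B"
    unfolding bounded_iff by (metis imageI real_norm_def)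
  have ineq: "\<bar>(\<integral>x. w x * h (Y x) \<partial>M) - (\<integral>x. w' x * h (Y' x) \<partial>N)\<bar>
       \<le> e * ((\<integral>x. \<bar>w x\<bar> \<partial>M) + (\<integral>x. \<bar>w' x\<bar> \<partial>N))" if e: "e > 0" for e
  proof -
    obtain g where g: "real_polynomial_function g" and ge: "\<And>x. x \<in> {0..1} \<Longrightarrow> \<bar>h x - g x\<bar> < e"
      using Stone_Weierstrass_real_polynomial_function[OF _ h e] by auto
    obtain a n where gs: "g = (\<lambda>x. \<Sum>i\<le>n::nat. a i * x^i)"
      using g real_polynomial_function_iff_sum by blast
    have [measurable]: "g \<in> borel_measurable borel" unfolding gs by measurable
    have pw: "integrable M (\<lambda>x. w x * Y x ^ i)" for i
      by (rule integrable_mult_bounded_comp[where k="\<lambda>y. y^i" and C=1 and A="{0..1}"]) (use w Y01 in \<open>auto simp: power_le_one abs_if\<close>)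
    have pw': "integrable N (\<lambda>x. w' x * Y' x ^ i)" for i
      by (rule integrable_mult_bounded_comp[where k="\<lambda>y. y^i" and C=1 and A="{0..1}"]) (use w' Y01' in \<open>auto simp: power_le_one abs_if\<close>)
    have eqg: "(\<integral>x. w x * g (Y x) \<partial>M) = (\<integral>x. w' x * g (Y' x) \<partial>N)"
    proof -
      have "(\<integral>x. w x * g (Y x) \<partial>M) = (\<integral>x. (\<Sum>i\<le>n. a i * (w x * Y x ^ i)) \<partial>M)"
        by (simp add: gs sum_distrib_left mult_ac)
      also have "\<dots> = (\<Sum>i\<le>n. a i * (\<integral>x. (w x * Y x ^ i) \<partial>M))"
        by (subst Bochner_Integration.integral_sum) (use pw in auto)
      also have "\<dots> = (\<Sum>i\<le>n. a i * (\<integral>x. (w' x * Y' x ^ i) \<partial>N))"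
        by (simp add: mom)
      also have "\<dots> = (\<integral>x. (\<Sum>i\<le>n. a i * (w' x * Y' x ^ i)) \<partial>N)"
        by (subst Bochner_Integration.integral_sum) (use pw' in auto)
      also have "\<dots> = (\<integral>x. w' x * g (Y' x) \<partial>N)"
        by (simp add: gs sum_distrib_left mult_ac)
      finally show ?thesis .
    qed
    have near: "\<bar>(\<integral>x. v x * h (V x) \<partial>M') - (\<integral>x. v x * g (V x) \<partial>M')\<bar> \<le> e * (\<integral>x. \<bar>v x\<bar> \<partial>M')"
      if v: "integrable M' v" and hV[measurable]: "(\<lambda>x. h (V x)) \<in> borel_measurable M'" "V \<in> borel_measurable M'"
        and V01: "AE x in M'. V x \<in> {0..1}" for M' :: "'c measure" and v V :: "'c \<Rightarrow> real"
    proof -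
      have ih: "integrable M' (\<lambda>x. v x * h (V x))" by (rule integrable_mult_bounded_comp[OF v hV(1) V01 B])
      have "(\<lambda>x. h (V x) - g (V x)) \<in> borel_measurable M'" by measurable
      then have id: "integrable M' (\<lambda>x. v x * (h (V x) - g (V x)))"
        by (rule integrable_mult_bounded_comp[where k="\<lambda>y. h y - g y", OF v _ V01 less_imp_le[OF ge]])
      have ig: "integrable M' (\<lambda>x. v x * g (V x))"
        using Bochner_Integration.integrable_diff[OF ih id] by (simp add: algebra_simps)
      have "\<bar>(\<integral>x. v x * h (V x) \<partial>M') - (\<integral>x. v x * g (V x) \<partial>M')\<bar> = \<bar>\<integral>x. v x * (h (V x) - g (V x)) \<partial>M'\<bar>"
        using ih ig by (subst Bochner_Integration.integral_diff[symmetric]) (auto simp: algebra_simps)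
      also have "\<dots> \<le> (\<integral>x. \<bar>v x * (h (V x) - g (V x))\<bar> \<partial>M')"
        by (rule integral_abs_bound)
      also have "\<dots> \<le> (\<integral>x. e * \<bar>v x\<bar> \<partial>M')"
      proof (rule integral_mono_AE)
        show "AE x in M'. \<bar>v x * (h (V x) - g (V x))\<bar> \<le> e * \<bar>v x\<bar>"
          using V01
        proof eventually_elim
          case (elim x)
          show ?case
            using mult_right_mono[OF less_imp_le[OF ge[OF elim]], of "\<bar>v x\<bar>"]
            by (simp add: abs_mult mult.commute)
        qed
      qed (use id v in auto)
      finally show ?thesis by simp
    qed
    show ?thesis
      using near[OF w hY Y Y01] near[OF w' hY' Y' Y01'] eqg by (simp add: algebra_simps)
  qed
  have nn: "(\<integral>x. \<bar>w x\<bar> \<partial>M) + (\<integral>x. \<bar>w' x\<bar> \<partial>N) \<ge> 0" by simp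
  have "\<bar>(\<integral>x. w x * h (Y x) \<partial>M) - (\<integral>x. w' x * h (Y' x) \<partial>N)\<bar> \<le> 0"
  proof (rule field_le_epsilon)
    fix e :: real assume e: "e > 0"
    define W where "W = (\<integral>x. \<bar>w x\<bar> \<partial>M) + (\<integral>x. \<bar>w' x\<bar> \<partial>N)"
    have W: "W \<ge> 0" using nn by (simp add: W_def)
    have "e / (W+1) * W \<le> e" using e W by (simp add: field_simps)
    moreover have "e / (W+1) > 0" using e W by simp
    ultimately show "\<bar>(\<integral>x. w x * h (Y x) \<partial>M) - (\<integral>x. w' x * h (Y' x) \<partial>N)\<bar> \<le> 0 + e"
      using ineq[of "e/(W+1)"] unfolding W_def[symmetric] by linarith
  qed
  then show ?thesis by simp
qed

text \<open>
  The transform at integer points gives the moments of \<open>exp (- X)\<close>, which takes values in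
  \<open>{0..1}\<close>.  Moments determine the integrals of cosines and sines, hence the characteristic function
  of \<open>exp (- X)\<close>, hence its law; the logarithm then recovers the law of \<open>X\<close>.
\<close>

lemma distr_eq_of_Laplace_eq:
  fixes X X' :: "'a \<Rightarrow> real"
  assumes "prob_space M"
    and X[measurable]: "X \<in> borel_measurable M" and X'[measurable]: "X' \<in> borel_measurable M"
    and pos: "AE x in M. 0 \<le> X x" and pos': "AE x in M. 0 \<le> X' x"
    and L: "\<And>\<theta>. \<theta> > 0 \<Longrightarrow> (\<integral>x. exp (- \<theta> * X x) \<partial>M) = (\<integral>x. exp (- \<theta> * X' x) \<partial>M)"
  shows "distr M borel X = distr M borel X'"
proof -
  interpret prob_space M by fact
  define Y where "Y x = exp (- X x)" for x
  define Y' where "Y' x = exp (- X' x)" for x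
  have [measurable]: "Y \<in> borel_measurable M" "Y' \<in> borel_measurable M"
    unfolding Y_def Y'_def by measurable
  have mom: "(\<integral>x. 1 * Y x ^ n \<partial>M) = (\<integral>x. 1 * Y' x ^ n \<partial>M)" for n :: nat
    using L[of "real n"] by (cases "n = 0") (simp_all add: Y_def Y'_def exp_of_nat_mult[symmetric])
  have Y01: "AE x in M. Y x \<in> {0..1}" "AE x in M. Y' x \<in> {0..1}"
    using pos pos' by (auto simp: Y_def Y'_def)
  have h: "(\<integral>x. h (Y x) \<partial>M) = (\<integral>x. h (Y' x) \<partial>M)" if "continuous_on UNIV h" for h :: "real \<Rightarrow> real"
  proof -
    have [measurable]: "h \<in> borel_measurable borel" using that by (rule borel_measurable_continuous_onI)
    show ?thesis
      using integral_cong_of_moments[OF _ _ _ _ Y01 mom, of h] continuous_on_subset[OF that, of "{0..1}"]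
      by auto
  qed
  have "distr M borel Y = distr M borel Y'"
  proof (rule Levy_uniqueness)
    show "char (distr M borel Y) = char (distr M borel Y')"
    proof
      fix t :: real
      have c: "char (distr M borel V) t = Complex (\<integral>x. cos (t * V x) \<partial>M) (\<integral>x. sin (t * V x) \<partial>M)"
        if [measurable]: "V \<in> borel_measurable M" for V
      proof -
        have i: "integrable M (\<lambda>x. iexp (t * V x))"
          by (rule integrable_const_bound[where B=1]) auto
        have "char (distr M borel V) t = (\<integral>x. iexp (t * V x) \<partial>M)"
          unfolding char_def by (subst integral_distr) auto
        then show ?thesis
          using integral_Re[OF i] integral_Im[OF i] by (simp add: complex_eq_iff Re_exp Im_exp)
      qed
      show "char (distr M borel Y) t = char (distr M borel Y') t"
        using h[of "\<lambda>y. cos (t * y)"] h[of "\<lambda>y. sin (t * y)"] by (simp add: c continuous_intros)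
    qed
  qed auto
  then have "distr (distr M borel Y) borel (\<lambda>y. - ln y) = distr (distr M borel Y') borel (\<lambda>y. - ln y)" by simp
  then show ?thesis by (simp add: distr_distr comp_def Y_def Y'_def)
qed

text \<open>
  After the change of variable \<open>y = exp (- t)\<close> the hypothesis says that all moments of the weight
  \<open>exp (- t) * D t\<close> vanish.  The decay at infinity makes \<open>exp (- t) * D t\<close>, as a function of
  \<open>y\<close>, continuous on all of \<open>{0..1}\<close>, so that it can serve as its own test function: the integral
  of its square is 0.
\<close>

lemma continuous_eq_0_of_Laplace_eq_0:
  fixes D :: "real \<Rightarrow> real"
  assumes D: "continuous_on {0..} D"
    and lim: "((\<lambda>t. exp (- t) * D t) \<longlongrightarrow> 0) at_top"
    and int: "set_integrable lborel {0<..} (\<lambda>t. exp (- t) * D t)"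
    and L: "\<And>\<theta>. \<theta> > 0 \<Longrightarrow> (LINT t:{0<..}|lborel. exp (- \<theta> * t) * D t) = 0"
    and t: "t > 0"
  shows "D t = 0"
proof -
  define w where "w = (\<lambda>t::real. indicator {0<..} t * (exp (- t) * D t))"
  define Y where "Y t = (if t > 0 then exp (- t) else 0)" for t :: real
  \<comment> \<open>the weight \<open>w\<close> itself as a function of \<open>y = exp (- t)\<close>; \<open>y = 0\<close> stands for \<open>t = \<infinity>\<close>\<close>
  define h where "h y = (if y = 0 then 0 else y * D (- ln y))" for y
  have w: "integrable lborel w" using int by (simp add: set_integrable_def w_def)
  have [measurable]: "w \<in> borel_measurable borel" using w by auto
  have [measurable]: "Y \<in> borel_measurable borel" unfolding Y_def by measurable
  have hY: "h (Y t) = w t" for t by (simp add: h_def Y_def w_def)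
  have hc: "continuous_on {0..1} h"
    unfolding continuous_on_eq_continuous_within
  proof
    fix y :: real assume y: "y \<in> {0..1}"
    show "continuous (at y within {0..1}) h"
    proof (cases "y = 0")
      case True
      have "((\<lambda>y::real. exp (- (- ln y)) * D (- ln y)) \<longlongrightarrow> 0) (at_right 0)"
        by (rule filterlim_compose[OF lim])
          (simp add: filterlim_uminus_at_bot[symmetric] filterlim_uminus_at_top ln_at_0)
      then have "(h \<longlongrightarrow> 0) (at_right 0)"
        by (rule Lim_transform_eventually) (auto simp: eventually_at_filter h_def)
      moreover have "at 0 within {0..1::real} = at_right 0"
        by (rule at_within_Icc_at_right) simp
      ultimately show ?thesis using True by (simp add: continuous_within h_def)
    next
      case False
      have "continuous (at y within {0<..1}) (\<lambda>y. y * D (- ln y))"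
      proof -
        have "continuous_on {0<..1} (\<lambda>y. y * D (- ln y))"
          by (intro continuous_intros continuous_on_compose2[OF D]) auto
        then show ?thesis using y False by (auto simp: continuous_on_eq_continuous_within)
      qed
      then have "continuous (at y within {0<..1}) h"
        by (rule continuous_transform_within[where \<delta>=1]) (use y False in \<open>auto simp: h_def\<close>)
      moreover have "at y within {0<..1} = at y within {0..1}"
        by (rule at_within_nhd[where S="{0<..}"]) (use y False in auto)
      ultimately show ?thesis by (simp add: continuous_within)
    qed
  qed
  have mom: "(\<integral>t. w t * Y t ^ n \<partial>lborel) = (\<integral>t. 0 * Y t ^ n \<partial>lborel)" for n
  proof -
    have "(\<integral>t. w t * Y t ^ n \<partial>lborel) = (LINT t:{0<..}|lborel. exp (- (real n + 1) * t) * D t)"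
      unfolding set_lebesgue_integral_def
      by (intro Bochner_Integration.integral_cong)
        (auto simp: w_def Y_def indicator_def exp_of_nat_mult[symmetric] exp_add[symmetric] algebra_simps)
    also have "\<dots> = 0" by (rule L) simp
    finally show ?thesis by simp
  qed
  have [measurable]: "(\<lambda>t. h (Y t)) \<in> borel_measurable lborel" by (simp add: hY)
  have "(\<integral>t. w t * h (Y t) \<partial>lborel) = (\<integral>t. 0 * h (Y t) \<partial>lborel)"
    by (rule integral_cong_of_moments[OF w _ _ _ _ _ mom hc]) (auto simp: hY, auto simp: Y_def)
  then have z: "(\<integral>t. (w t)\<^sup>2 \<partial>lborel) = 0" by (simp add: hY power2_eq_square)
  have "bounded (h ` {0..1})"
    using hc by (intro compact_imp_bounded compact_continuous_image) auto
  then obtain B where B: "\<And>y. y \<in> {0..1} \<Longrightarrow> \<bar>h y\<bar> \<le> B"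
    unfolding bounded_iff by (metis imageI real_norm_def)
  have wB: "\<bar>w t\<bar> \<le> B" for t
    using B[of "Y t", unfolded hY] by (auto simp: Y_def split: if_splits)
  have "integrable lborel (\<lambda>t. (w t)\<^sup>2)"
  proof (rule Bochner_Integration.integrable_bound[where f="\<lambda>t. B * w t"])
    show "AE t in lborel. norm ((w t)\<^sup>2) \<le> norm (B * w t)"
    proof (rule AE_I2)
      fix t
      have "\<bar>w t\<bar> * \<bar>w t\<bar> \<le> \<bar>B\<bar> * \<bar>w t\<bar>"
        by (intro mult_right_mono order_trans[OF wB abs_ge_self]) simp
      then show "norm ((w t)\<^sup>2) \<le> norm (B * w t)"
        by (simp add: power2_eq_square abs_mult)
    qed
  qed (use w in auto)
  with z have ae: "AE t in lborel. w t = 0"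
    by (simp add: integral_nonneg_eq_0_iff_AE)
  have "AE t in lborel. t \<in> {0<..} \<longrightarrow> D t = 0"
    using ae by eventually_elim (auto simp: w_def)
  then obtain N where N: "{t. \<not> (t \<in> {0<..} \<longrightarrow> D t = 0)} \<subseteq> N" "N \<in> sets borel" "emeasure lborel N = 0"
    by (auto elim!: AE_E)
  show "D t = 0"
  proof (rule ccontr)
    assume "D t \<noteq> 0"
    moreover have "isCont D t"
      using continuous_on_interior[OF D, of t] t by (simp add: interior_real_atLeast)
    ultimately have "\<forall>\<^sub>F x in at t. D x \<noteq> 0"
      unfolding isCont_def by (rule tendsto_imp_eventually_ne[rotated])
    then have "\<forall>\<^sub>F x in nhds t. D x \<noteq> 0"
      using \<open>D t \<noteq> 0\<close> by (simp add: eventually_nhds_conv_at)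
    moreover have "\<forall>\<^sub>F x in nhds t. x > 0" using eventually_nhds_in_open[of "{0<..}" t] t by simp
    ultimately have "\<forall>\<^sub>F x in nhds t. x > 0 \<and> D x \<noteq> 0" by (rule eventually_conj[rotated])
    then obtain d where d: "d > 0" "\<And>x. dist x t < d \<Longrightarrow> x > 0 \<and> D x \<noteq> 0"
      unfolding eventually_nhds_metric by auto
    have "{t - d<..<t + d} \<subseteq> N"
    proof
      fix x assume "x \<in> {t - d<..<t + d}"
      then have "dist x t < d" by (auto simp: dist_real_def)
      from d(2)[OF this] show "x \<in> N" using N(1) by auto
    qed
    then have "emeasure lborel {t - d<..<t + d} \<le> 0"
      using emeasure_mono[of _ N lborel] N by auto
    then show False using d(1) by simp
  qed
qed

section \<open>Substitutions in integrals over the half-line\<close>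

lemma SUP_mult_indicator:
  fixes c :: ennreal
  shows "(SUP n. c * indicator (A n) x) = c * indicator (\<Union>n. A n) x"
proof (cases "\<exists>n. x \<in> A n")
  case True
  then obtain n where n: "x \<in> A n" by blast
  have "(SUP n. c * indicator (A n) x) = c"
  proof (rule antisym)
    show "(SUP n. c * indicator (A n) x) \<le> c" by (rule SUP_least) (simp add: indicator_def)
    show "c \<le> (SUP n. c * indicator (A n) x)" using n by (intro SUP_upper2[of n]) auto
  qed
  then show ?thesis using True by auto
qed auto

text \<open>
  Passing to the logarithm turns dilations and powers of the half-line into affine maps of the real
  line, for which the change of variables is available with either sign of the slope.  The
  substitution itself is applied on \<open>{- n..n}\<close> and extended by monotone convergence.
\<close>

lemma nn_integral_exp_substitution:
  fixes f :: "real \<Rightarrow> ennreal"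
  assumes [measurable]: "f \<in> borel_measurable borel"
  shows "(\<integral>\<^sup>+x. indicator {0<..} x * f x \<partial>lborel) = (\<integral>\<^sup>+u. ennreal (exp u) * f (exp u) \<partial>lborel)"
proof -
  define I where "I n = {exp (- real n)..exp (real n)}" for n
  define J where "J n = {- real n..real n}" for n
  have J: "incseq J" unfolding J_def by (intro monoI) auto
  have UJ: "(\<Union>n. J n) = UNIV"
    unfolding J_def
    by (auto, metis abs_le_D1 abs_le_D2 minus_le_iff real_arch_simple)
  have I: "incseq I" unfolding I_def by (intro monoI) auto
  have memI: "exp u \<in> I n \<longleftrightarrow> u \<in> J n" for u n by (simp add: I_def J_def)
  have UI: "(\<Union>n. I n) = {0<..}"
  proof (intro set_eqI iffI)
    fix x :: real assume "x \<in> {0<..}"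
    then have "x = exp (ln x)" by simp
    moreover obtain n where "ln x \<in> J n" using UJ by blast
    ultimately show "x \<in> (\<Union>n. I n)" using memI by (metis UN_I UNIV_I)
  next
    fix x assume "x \<in> (\<Union>n. I n)"
    then show "x \<in> {0<..}" by (auto simp: I_def intro: less_le_trans[OF exp_gt_zero])
  qed
  have eq: "(\<integral>\<^sup>+x. f x * indicator (I n) x \<partial>lborel) = (\<integral>\<^sup>+u. f (exp u) * ennreal (exp u) * indicator (J n) u \<partial>lborel)" for n
    unfolding I_def J_def
  proof (cases "n = 0")
    case True
    have "(\<integral>\<^sup>+x. f x * indicator {c} x \<partial>lborel) = 0" for f :: "real \<Rightarrow> ennreal" and c
      by (simp add: nn_integral_null_set)
    then show "(\<integral>\<^sup>+x. f x * indicator {exp (- real n)..exp (real n)} x \<partial>lborel) =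
      (\<integral>\<^sup>+x. f (exp x) * ennreal (exp x) * indicator {- real n..real n} x \<partial>lborel)"
      using True by simp
  next
    case False
    then show "(\<integral>\<^sup>+x. f x * indicator {exp (- real n)..exp (real n)} x \<partial>lborel) =
      (\<integral>\<^sup>+x. f (exp x) * ennreal (exp x) * indicator {- real n..real n} x \<partial>lborel)"
      by (intro nn_integral_substitution_aux) (auto intro!: derivative_eq_intros continuous_intros)
  qed
  have "(\<integral>\<^sup>+x. indicator {0<..} x * f x \<partial>lborel) = (\<integral>\<^sup>+x. (SUP n. f x * indicator (I n) x) \<partial>lborel)"
    by (simp only: SUP_mult_indicator UI) (simp add: mult.commute)
  also have "\<dots> = (SUP n. \<integral>\<^sup>+x. f x * indicator (I n) x \<partial>lborel)"
    by (intro nn_integral_monotone_convergence_SUP)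
      (use I in \<open>force simp: incseq_def le_fun_def indicator_def\<close>, simp add: I_def)
  also have "\<dots> = (SUP n. \<integral>\<^sup>+u. f (exp u) * ennreal (exp u) * indicator (J n) u \<partial>lborel)"
    by (simp add: eq)
  also have "\<dots> = (\<integral>\<^sup>+u. (SUP n. f (exp u) * ennreal (exp u) * indicator (J n) u) \<partial>lborel)"
    by (intro nn_integral_monotone_convergence_SUP[symmetric])
      (use J in \<open>force simp: incseq_def le_fun_def indicator_def\<close>, simp add: J_def)
  also have "\<dots> = (\<integral>\<^sup>+u. ennreal (exp u) * f (exp u) \<partial>lborel)"
    by (simp only: SUP_mult_indicator UJ) (simp add: mult.commute)
  finally show ?thesis .
qed

text \<open>
  In logarithmic coordinates \<open>x \<mapsto> x powr c\<close> is multiplication by \<open>c\<close>, so that increasing and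
  decreasing powers are covered by one computation.
\<close>

lemma nn_integral_powr_substitution:
  fixes f :: "real \<Rightarrow> ennreal"
  assumes [measurable]: "f \<in> borel_measurable borel" and c: "c \<noteq> 0"
  shows "(\<integral>\<^sup>+x. indicator {0<..} x * (ennreal (\<bar>c\<bar> * x powr (c - 1)) * f (x powr c)) \<partial>lborel) =
    (\<integral>\<^sup>+v. indicator {0<..} v * f v \<partial>lborel)"
proof -
  have "(\<integral>\<^sup>+x. indicator {0<..} x * (ennreal (\<bar>c\<bar> * x powr (c - 1)) * f (x powr c)) \<partial>lborel) =
    (\<integral>\<^sup>+u. ennreal (exp u) * (ennreal (\<bar>c\<bar> * exp u powr (c - 1)) * f (exp u powr c)) \<partial>lborel)"
    by (rule nn_integral_exp_substitution) measurable
  also have "\<dots> = (\<integral>\<^sup>+u. ennreal \<bar>c\<bar> * (ennreal (exp (0 + c * u)) * f (exp (0 + c * u))) \<partial>lborel)"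
  proof (rule nn_integral_cong)
    fix u :: real
    have "exp u * (\<bar>c\<bar> * exp u powr (c - 1)) = \<bar>c\<bar> * exp (0 + c * u)"
      by (simp add: powr_def exp_add[symmetric] algebra_simps)
    moreover have "exp u powr c = exp (0 + c * u)" by (simp add: powr_def)
    ultimately show "ennreal (exp u) * (ennreal (\<bar>c\<bar> * exp u powr (c - 1)) * f (exp u powr c)) =
        ennreal \<bar>c\<bar> * (ennreal (exp (0 + c * u)) * f (exp (0 + c * u)))"
      by (simp only: mult.assoc[symmetric] ennreal_mult[symmetric] exp_ge_zero abs_ge_zero mult_nonneg_nonneg powr_ge_zero)
  qed
  also have "\<dots> = ennreal \<bar>c\<bar> * (\<integral>\<^sup>+u. ennreal (exp (0 + c * u)) * f (exp (0 + c * u)) \<partial>lborel)"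
    by (rule nn_integral_cmult) measurable
  also have "\<dots> = (\<integral>\<^sup>+w. ennreal (exp w) * f (exp w) \<partial>lborel)"
    by (rule nn_integral_real_affine[OF _ c, symmetric]) measurable
  also have "\<dots> = (\<integral>\<^sup>+v. indicator {0<..} v * f v \<partial>lborel)"
    by (rule nn_integral_exp_substitution[symmetric]) measurable
  finally show ?thesis .
qed

lemma nn_integral_scale:
  fixes f :: "real \<Rightarrow> ennreal"
  assumes [measurable]: "f \<in> borel_measurable borel" and c: "c > 0"
  shows "(\<integral>\<^sup>+x. indicator {0<..} x * f x \<partial>lborel) = ennreal c * (\<integral>\<^sup>+x. indicator {0<..} x * f (c * x) \<partial>lborel)"
proof -
  have "(\<integral>\<^sup>+x. indicator {0<..} x * f x \<partial>lborel) = ennreal \<bar>c\<bar> * (\<integral>\<^sup>+x. indicator {0<..} (0 + c * x) * f (0 + c * x) \<partial>lborel)"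
    by (rule nn_integral_real_affine) (use c in auto)
  also have "\<dots> = ennreal c * (\<integral>\<^sup>+x. indicator {0<..} x * f (c * x) \<partial>lborel)"
    using c by (simp add: indicator_def zero_less_mult_iff)
  finally show ?thesis .
qed

lemma nn_integral_Gamma_scaled:
  assumes s: "s > 0" and l: "l > 0"
  shows "(\<integral>\<^sup>+x. indicator {0<..} x * ennreal (x powr (s - 1) * exp (- l * x)) \<partial>lborel) = ennreal (Gamma s / l powr s)"
proof -
  have "ennreal (Gamma s) = (\<integral>\<^sup>+t. indicator {0<..} t * ennreal (t powr (s - 1) * exp (- t)) \<partial>lborel)"
    unfolding Gamma_conv_nn_integral_real[OF s]
  proof (rule nn_integral_cong)
    fix t :: real
    show "ennreal (indicator {0..} t * t powr (s - 1) / exp t) = indicator {0<..} t * ennreal (t powr (s - 1) * exp (- t))"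
      by (cases "t = 0") (auto simp: indicator_def exp_minus field_simps)
  qed
  also have "\<dots> = ennreal l * (\<integral>\<^sup>+x. indicator {0<..} x * ennreal ((l * x) powr (s - 1) * exp (- (l * x))) \<partial>lborel)"
    by (rule nn_integral_scale) (use l in auto)
  also have "(\<integral>\<^sup>+x. indicator {0<..} x * ennreal ((l * x) powr (s - 1) * exp (- (l * x))) \<partial>lborel) =
     (\<integral>\<^sup>+x. ennreal (l powr (s - 1)) * (indicator {0<..} x * ennreal (x powr (s - 1) * exp (- l * x))) \<partial>lborel)"
    using l by (intro nn_integral_cong) (auto simp: indicator_def powr_mult ennreal_mult[symmetric] mult_ac)
  also have "\<dots> = ennreal (l powr (s - 1)) * (\<integral>\<^sup>+x. (indicator {0<..} x * ennreal (x powr (s - 1) * exp (- l * x))) \<partial>lborel)"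
    by (rule nn_integral_cmult) measurable
  finally have *: "ennreal (Gamma s) = ennreal (l powr s) * (\<integral>\<^sup>+x. (indicator {0<..} x * ennreal (x powr (s - 1) * exp (- l * x))) \<partial>lborel)"
    using l by (simp only: mult.assoc[symmetric]) (simp add: ennreal_mult[symmetric] powr_diff)
  define X where "X = (\<integral>\<^sup>+x. indicator {0<..} x * ennreal (x powr (s - 1) * exp (- l * x)) \<partial>lborel)"
  have "ennreal (Gamma s / l powr s) = ennreal (1 / l powr s) * ennreal (Gamma s)"
    using l s Gamma_real_pos[OF s] by (simp add: ennreal_mult[symmetric])
  also have "\<dots> = ennreal (1 / l powr s) * ennreal (l powr s) * X"
    unfolding X_def by (simp only: * mult.assoc)
  also have "\<dots> = X"
    using l by (subst ennreal_mult[symmetric]) auto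
  finally show ?thesis by (simp add: X_def)
qed

section \<open>Tilted moments of a subordinated variable\<close>

text \<open>
  Dominated convergence along a real parameter.  The bound is only required near the limit point,
  as is needed for difference quotients and for limits at the end of an interval.
\<close>

lemma tendsto_integral_at_within:
  fixes f :: "real \<Rightarrow> 'a \<Rightarrow> real"
  assumes meas: "\<And>y. f y \<in> borel_measurable M" and h: "h \<in> borel_measurable M"
    and w: "integrable M w"
    and bound: "\<forall>\<^sub>F y in at x within S. AE \<omega> in M. \<bar>f y \<omega>\<bar> \<le> w \<omega>"
    and lim: "AE \<omega> in M. ((\<lambda>y. f y \<omega>) \<longlongrightarrow> h \<omega>) (at x within S)"
  shows "((\<lambda>y. \<integral>\<omega>. f y \<omega> \<partial>M) \<longlongrightarrow> (\<integral>\<omega>. h \<omega> \<partial>M)) (at x within S)"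
  unfolding tendsto_at_iff_sequentially comp_def
proof (intro allI impI)
  fix X :: "nat \<Rightarrow> real" assume X: "\<forall>i. X i \<in> S - {x}" "X \<longlonglongrightarrow> x"
  have X': "filterlim X (at x within S) sequentially"
    using X by (auto simp: filterlim_at)
  obtain N where N: "\<And>n. n \<ge> N \<Longrightarrow> AE \<omega> in M. \<bar>f (X n) \<omega>\<bar> \<le> w \<omega>"
    using eventually_compose_filterlim[OF bound X'] unfolding eventually_sequentially by blast
  have "(\<lambda>n. \<integral>\<omega>. f (X (n + N)) \<omega> \<partial>M) \<longlonglongrightarrow> (\<integral>\<omega>. h \<omega> \<partial>M)"
  proof (rule integral_dominated_convergence[OF h meas w])
    show "AE \<omega> in M. (\<lambda>n. f (X (n + N)) \<omega>) \<longlonglongrightarrow> h \<omega>"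
      using lim
    proof eventually_elim
      case (elim \<omega>)
      show ?case by (rule LIMSEQ_ignore_initial_segment) (rule filterlim_compose[OF elim X'])
    qed
    show "AE \<omega> in M. norm (f (X (n + N)) \<omega>) \<le> w \<omega>" for n
      using N[of "n + N"] by simp
  qed
  then show "(\<lambda>n. \<integral>\<omega>. f (X n) \<omega> \<partial>M) \<longlonglongrightarrow> (\<integral>\<omega>. h \<omega> \<partial>M)"
    by (rule LIMSEQ_offset)
qed

text \<open>
  The maximum of \<open>z powr p * exp (- a * z)\<close> is at \<open>z = p / a\<close>; the estimate is
  \<open>ln w \<le> w - 1\<close> at \<open>w = a * z / p\<close>.  The summand 1 takes care of \<open>p = 0\<close>, where
  \<open>(p / a) powr p\<close> is 0.
\<close>

lemma powr_mult_exp_le: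
  fixes z p a :: real
  assumes "z \<ge> 0" "p \<ge> 0" "a > 0"
  shows "z powr p * exp (- a * z) \<le> 1 + (p / a) powr p"
proof (cases "z = 0 \<or> p = 0")
  case True
  then show ?thesis
  proof
    assume "p = 0"
    moreover have "exp (- a * z) \<le> 1" using assms by simp
    ultimately show ?thesis by (cases "z = 0") (auto intro: add_increasing2)
  qed simp
next
  case False
  then have z: "z > 0" and p: "p > 0" using assms by auto
  have "ln (a * z / p) \<le> a * z / p - 1"
    by (rule ln_le_minus_one) (use z p assms in simp)
  then have "ln z \<le> ln (p / a) + a * z / p"
    using z p assms by (simp add: ln_mult ln_div)
  then have "p * ln z \<le> p * (ln (p / a) + a * z / p)"
    using p by (intro mult_left_mono) auto
  then have "p * ln z - a * z \<le> p * ln (p / a)"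
    using p by (simp add: algebra_simps)
  then have "exp (p * ln z - a * z) \<le> exp (p * ln (p / a))" by simp
  then have "z powr p * exp (- a * z) \<le> (p / a) powr p"
    using z p assms by (simp add: powr_def exp_add[symmetric])
  then show ?thesis by linarith
qed

lemma integrable_powr_mult_exp:
  fixes Y :: "'a \<Rightarrow> real"
  assumes "finite_measure M" and [measurable]: "Y \<in> borel_measurable M" and Y: "AE x in M. 0 \<le> Y x"
    and "p \<ge> 0" "a > 0"
  shows "integrable M (\<lambda>x. Y x powr p * exp (- a * Y x))"
proof -
  interpret finite_measure M by fact
  show ?thesis
  proof (rule integrable_const_bound)
    show "AE x in M. norm (Y x powr p * exp (- a * Y x)) \<le> 1 + (p / a) powr p"
      using Y by eventually_elim (use powr_mult_exp_le assms in auto)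
  qed measurable
qed

text \<open>
  By the mean value theorem the difference quotients near \<open>a\<close> are values of the derivative at
  parameters above \<open>a / 2\<close>, and these are bounded uniformly in \<open>Y\<close>; so dominated convergence applies
  on a finite measure space with a constant bound.
\<close>

lemma has_real_derivative_integral_powr_mult_exp:
  fixes Y :: "'a \<Rightarrow> real"
  assumes fin: "finite_measure M" and [measurable]: "Y \<in> borel_measurable M" and Y: "AE x in M. 0 \<le> Y x"
    and p: "p \<ge> 0" and a: "a > 0"
  shows "((\<lambda>a. \<integral>x. Y x powr p * exp (- a * Y x) \<partial>M) has_real_derivative
     - (\<integral>x. Y x powr (p + 1) * exp (- a * Y x) \<partial>M)) (at a)"
proof -
  interpret finite_measure M by fact
  define f where "f b x = Y x powr p * exp (- b * Y x)" for b x
  define f' where "f' b x = - (Y x powr (p + 1) * exp (- b * Y x))" for b x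
  have [measurable]: "f b \<in> borel_measurable M" "f' b \<in> borel_measurable M" for b
    unfolding f_def f'_def by measurable
  have int: "integrable M (f b)" if "b > 0" for b
    unfolding f_def using that p by (intro integrable_powr_mult_exp assms)
  have d: "((\<lambda>b. f b x) has_real_derivative f' b x) (at b)" if "0 \<le> Y x" for b x
    using that by (cases "Y x = 0")
      (auto simp: f_def f'_def powr_add intro!: derivative_eq_intros)
  have "((\<lambda>b. \<integral>x. (f b x - f a x) / (b - a) \<partial>M) \<longlongrightarrow> (\<integral>x. f' a x \<partial>M)) (at a)"
  proof (rule tendsto_integral_at_within[where w = "\<lambda>_. 1 + ((p + 1) / (a / 2)) powr (p + 1)"])
    show "AE x in M. ((\<lambda>b. (f b x - f a x) / (b - a)) \<longlongrightarrow> f' a x) (at a)"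
      using Y by eventually_elim (use d[of _ a] in \<open>simp add: has_field_derivative_iff\<close>)
    have "\<forall>\<^sub>F b in nhds a. b > a / 2"
      using eventually_nhds_in_open[of "{a/2<..}" a] a by simp
    then have "\<forall>\<^sub>F b in at a. b > a / 2 \<and> b \<noteq> a"
      by (simp add: eventually_at_filter eventually_mono)
    then show "\<forall>\<^sub>F b in at a. AE x in M. \<bar>(f b x - f a x) / (b - a)\<bar> \<le> 1 + ((p + 1) / (a / 2)) powr (p + 1)"
    proof eventually_elim
      case (elim b)
      show ?case
        using Y
      proof eventually_elim
        case Yx: (elim x)
        have bd: "\<bar>f' c x\<bar> \<le> 1 + ((p + 1) / (a / 2)) powr (p + 1)" if "c > a / 2" for c
        proof -
          have "\<bar>f' c x\<bar> = Y x powr (p + 1) * exp (- c * Y x)" by (simp add: f'_def)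
          also have "\<dots> \<le> Y x powr (p + 1) * exp (- (a / 2) * Y x)"
            using mult_right_mono[of "a / 2" c "Y x"] that Yx by (intro mult_left_mono) auto
          also have "\<dots> \<le> 1 + ((p + 1) / (a / 2)) powr (p + 1)"
            using Yx p a by (intro powr_mult_exp_le) auto
          finally show ?thesis .
        qed
        have mvt: "\<exists>c. min a b < c \<and> c < max a b \<and> f (max a b) x - f (min a b) x = (max a b - min a b) * f' c x"
          using elim d[OF Yx] by (intro MVT2) auto
        then obtain c where c: "min a b < c" "f (max a b) x - f (min a b) x = (max a b - min a b) * f' c x" by blast
        have "(f b x - f a x) / (b - a) = f' c x"
          using c(2) elim by (auto simp: max_def min_def field_simps split: if_splits)
        moreover have "c > a / 2" using c(1) elim a by auto
        ultimately show ?case using bd by simp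
      qed
    qed
  qed auto
  moreover have "\<forall>\<^sub>F b in at a. (\<integral>x. (f b x - f a x) / (b - a) \<partial>M) = ((\<integral>x. f b x \<partial>M) - (\<integral>x. f a x \<partial>M)) / (b - a)"
  proof -
    have "\<forall>\<^sub>F b in nhds a. b > 0"
      using eventually_nhds_in_open[of "{0<..}" a] a by simp
    then have "\<forall>\<^sub>F b in at a. b > 0"
      by (simp add: eventually_at_filter eventually_mono)
    then show ?thesis
      by eventually_elim (simp add: int a)
  qed
  ultimately have "((\<lambda>b. ((\<integral>x. f b x \<partial>M) - (\<integral>x. f a x \<partial>M)) / (b - a)) \<longlongrightarrow> (\<integral>x. f' a x \<partial>M)) (at a)"
    by (rule Lim_transform_eventually)
  then show ?thesis
    by (simp add: has_field_derivative_iff f_def f'_def)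
qed

text \<open>
  With \<open>Z = (y / t) powr \<nu>\<close> this is the moment of order \<open>p\<close> of \<open>Z\<close> under the exponential tilt
  \<open>exp (- a * Z)\<close>.  When \<open>P\<close> is the law of a stable subordinator at time 1, \<open>1 / Z\<close> has the law of the
  inverse process at time \<open>t\<close>.
\<close>

definition tilted_moment :: "real measure \<Rightarrow> real \<Rightarrow> real \<Rightarrow> real \<Rightarrow> real \<Rightarrow> real" where
  "tilted_moment P \<nu> p a t = (\<integral>y. ((y / t) powr \<nu>) powr p * exp (- a * (y / t) powr \<nu>) \<partial>P)"

lemma tilted_moment_measurable [measurable]:
  assumes "sets P = sets borel" "prob_space P"
  shows "(\<lambda>t. tilted_moment P \<nu> p a t) \<in> borel_measurable borel"
proof -
  interpret prob_space P by fact
  note [measurable_cong] = assms(1)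
  show ?thesis unfolding tilted_moment_def by measurable
qed

lemma tilted_moment_nonneg: "tilted_moment P \<nu> p a t \<ge> 0"
  unfolding tilted_moment_def by (rule integral_nonneg_AE) simp

lemma tilted_moment_le:
  assumes "sets P = sets borel" "prob_space P" "p \<ge> 0" "a > 0"
  shows "tilted_moment P \<nu> p a t \<le> 1 + (p / a) powr p"
proof -
  interpret prob_space P by fact
  note [measurable_cong] = assms(1)
  have "tilted_moment P \<nu> p a t \<le> (\<integral>y. 1 + (p / a) powr p \<partial>P)"
    unfolding tilted_moment_def
  proof (rule integral_mono)
    show "integrable P (\<lambda>y. ((y / t) powr \<nu>) powr p * exp (- a * (y / t) powr \<nu>))"
      using assms by (intro integrable_powr_mult_exp) (auto intro: finite_measure_axioms)
    show "((y / t) powr \<nu>) powr p * exp (- a * (y / t) powr \<nu>) \<le> 1 + (p / a) powr p" for y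
      using assms by (intro powr_mult_exp_le) auto
  qed simp
  then show ?thesis by (simp add: prob_space)
qed

text \<open>
  As \<open>t\<close> decreases to 0 the variable \<open>Z\<close> tends to infinity and the integrand to 0, so the
  extension by 0 to \<open>t \<le> 0\<close> is continuous.  This extension makes convolutions continuous
  up to and including the origin.
\<close>

lemma continuous_tilted_moment:
  assumes P: "sets P = sets borel" "prob_space P" and pos: "AE y in P. 0 < y"
    and a: "a > 0" and p: "p \<ge> 0" and \<nu>: "\<nu> > 0"
  shows "continuous_on UNIV (\<lambda>t. if t > 0 then tilted_moment P \<nu> p a t else 0)"
  unfolding continuous_on_def
proof
  interpret prob_space P by fact
  note [measurable_cong] = P(1)
  fix t0 :: real
  define F where "F t y = (if t > 0 then ((y / t) powr \<nu>) powr p * exp (- a * (y / t) powr \<nu>) else 0)" for t y :: real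
  have eq: "(\<lambda>t. if t > 0 then tilted_moment P \<nu> p a t else 0) = (\<lambda>t. \<integral>y. F t y \<partial>P)"
    by (auto simp: tilted_moment_def F_def)
  have "((\<lambda>t. F t y) \<longlongrightarrow> F t0 y) (at t0)" if y: "y > 0" for y
  proof (cases "t0 > 0")
    case True
    have "((\<lambda>t. ((y / t) powr \<nu>) powr p * exp (- a * (y / t) powr \<nu>)) \<longlongrightarrow> F t0 y) (at t0)"
      unfolding F_def using True y by (auto intro!: tendsto_eq_intros)
    moreover have "\<forall>\<^sub>F t in at t0. t > 0"
      using eventually_nhds_in_open[of "{0<..}" t0] True by (simp add: eventually_at_filter eventually_mono)
    then have "\<forall>\<^sub>F t in at t0. ((y / t) powr \<nu>) powr p * exp (- a * (y / t) powr \<nu>) = F t y"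
      by eventually_elim (simp add: F_def)
    ultimately show ?thesis by (rule Lim_transform_eventually)
  next
    case False
    have lim: "((\<lambda>z. z powr p * exp (- a * z)) \<longlongrightarrow> 0) at_top"
    proof (rule tendsto_sandwich[of "\<lambda>_. 0" _ _ "\<lambda>z. (1 + ((p + 1) / a) powr (p + 1)) / z"])
      show "\<forall>\<^sub>F z in at_top. z powr p * exp (- a * z) \<le> (1 + ((p + 1) / a) powr (p + 1)) / z"
        using eventually_gt_at_top[of 0]
      proof eventually_elim
        case (elim z)
        have "z powr (p + 1) * exp (- a * z) \<le> 1 + ((p + 1) / a) powr (p + 1)"
          using elim p a by (intro powr_mult_exp_le) auto
        then show ?case using elim by (simp add: field_simps powr_add)
      qed
      show "((\<lambda>z. (1 + ((p + 1) / a) powr (p + 1)) / z) \<longlongrightarrow> 0) at_top"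
        by (intro tendsto_divide_0[OF tendsto_const] filterlim_at_top_imp_at_infinity filterlim_ident)
    qed (auto intro: always_eventually)
    have powr_at_top: "filterlim (\<lambda>x. x powr \<nu>) at_top (at_top :: real filter)"
    proof -
      have "filterlim (\<lambda>x. exp (\<nu> * ln x)) at_top (at_top :: real filter)"
        by (intro filterlim_compose[OF exp_at_top] filterlim_tendsto_pos_mult_at_top[OF tendsto_const \<nu>] ln_at_top)
      moreover have "\<forall>\<^sub>F x in at_top. exp (\<nu> * ln x) = x powr \<nu>"
        using eventually_gt_at_top[of 0] by eventually_elim (simp add: powr_def)
      ultimately show ?thesis using filterlim_cong[OF refl refl] by fast
    qed
    have Z: "filterlim (\<lambda>t. (y / t) powr \<nu>) at_top (at_right 0)"
    proof -
      have "filterlim (\<lambda>t. y * inverse t) at_top (at_right 0)"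
        by (rule filterlim_tendsto_pos_mult_at_top[OF tendsto_const y filterlim_inverse_at_top_right])
      then have "filterlim (\<lambda>t. (y * inverse t) powr \<nu>) at_top (at_right 0)"
        using powr_at_top by (rule filterlim_compose[rotated])
      then show ?thesis by (simp add: divide_inverse)
    qed
    have r: "((\<lambda>t. F t y) \<longlongrightarrow> 0) (at_right 0)"
    proof (rule Lim_transform_eventually)
      show "((\<lambda>t. ((y / t) powr \<nu>) powr p * exp (- a * (y / t) powr \<nu>)) \<longlongrightarrow> 0) (at_right 0)"
        by (rule filterlim_compose[OF lim Z])
    qed (simp add: eventually_at_filter F_def)
    have l: "((\<lambda>t. F t y) \<longlongrightarrow> 0) (at_left 0)"
      by (rule Lim_transform_eventually[OF tendsto_const]) (simp add: eventually_at_filter F_def)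
    show ?thesis
    proof (cases "t0 = 0")
      case True
      then show ?thesis using r l by (simp add: F_def filterlim_at_split)
    next
      case neg: False
      have "\<forall>\<^sub>F t in at t0. t < 0"
        using eventually_nhds_in_open[of "{..<0}" t0] neg False by (simp add: eventually_at_filter eventually_mono)
      then have "\<forall>\<^sub>F t in at t0. 0 = F t y" by eventually_elim (simp add: F_def)
      then show ?thesis using False by (intro Lim_transform_eventually[OF tendsto_const]) (simp_all add: F_def)
    qed
  qed
  then have lim: "AE y in P. ((\<lambda>t. F t y) \<longlongrightarrow> F t0 y) (at t0)"
    using pos by (auto elim: eventually_mono)
  have "F t y \<le> 1 + (p / a) powr p" for t y
    unfolding F_def using powr_mult_exp_le[of "(y / t) powr \<nu>" p a] p a by (auto intro: add_nonneg_nonneg)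
  then have b: "\<bar>F t y\<bar> \<le> 1 + (p / a) powr p" for t y
    by (simp add: F_def)
  have [measurable]: "F t \<in> borel_measurable P" for t
    unfolding F_def by measurable
  show "((\<lambda>t. if t > 0 then tilted_moment P \<nu> p a t else 0) \<longlongrightarrow> (if t0 > 0 then tilted_moment P \<nu> p a t0 else 0)) (at t0)"
    unfolding fun_cong[OF eq] eq
    by (rule tendsto_integral_at_within[where w="\<lambda>_. 1 + (p / a) powr p"]) (use lim b in auto)
qed

lemma has_real_derivative_tilted_moment:
  assumes P: "sets P = sets borel" "prob_space P" and a: "a > 0" and p: "p \<ge> 0"
  shows "((\<lambda>a. tilted_moment P \<nu> p a t) has_real_derivative - tilted_moment P \<nu> (p + 1) a t) (at a)"
proof -
  interpret prob_space P by fact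
  note [measurable_cong] = P(1)
  show ?thesis unfolding tilted_moment_def
    by (rule has_real_derivative_integral_powr_mult_exp) (use a p finite_measure_axioms in auto)
qed

section \<open>Convolution on the half-line\<close>

text \<open>
  The values are in \<open>ennreal\<close> so that Tonelli applies before anything is known to be finite.
\<close>

definition Laplace_nn :: "(real \<Rightarrow> real) \<Rightarrow> real \<Rightarrow> ennreal" where
  "Laplace_nn f l = (\<integral>\<^sup>+t. indicator {0<..} t * ennreal (exp (- l * t) * f t) \<partial>lborel)"

definition causal_convolution :: "(real \<Rightarrow> real) \<Rightarrow> (real \<Rightarrow> real) \<Rightarrow> real \<Rightarrow> real" where
  "causal_convolution u f t = (LINT s:{0<..<t}|lborel. u (t - s) * f s)"

text \<open>
  The way back from the transform of a nonnegative function to a signed integral, which is linear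
  and in which differences of transforms make sense.
\<close>

lemma set_integral_of_Laplace_nn:
  assumes [measurable]: "f \<in> borel_measurable borel" and f: "\<And>t. t > 0 \<Longrightarrow> f t \<ge> 0"
    and L: "Laplace_nn f l = ennreal c" and c: "c \<ge> 0"
  shows "set_integrable lborel {0<..} (\<lambda>t. exp (- l * t) * f t)"
    and "(LINT t:{0<..}|lborel. exp (- l * t) * f t) = c"
proof -
  have "has_bochner_integral lborel (\<lambda>t. indicator {0<..} t * (exp (- l * t) * f t)) c"
  proof (rule has_bochner_integral_nn_integral)
    have "(\<integral>\<^sup>+t. ennreal (indicator {0<..} t * (exp (- l * t) * f t)) \<partial>lborel) = Laplace_nn f l"
      unfolding Laplace_nn_def by (intro nn_integral_cong) (auto simp: indicator_def)
    then show "(\<integral>\<^sup>+t. ennreal (indicator {0<..} t * (exp (- l * t) * f t)) \<partial>lborel) = ennreal c"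
      using L by simp
  qed (use f c in \<open>auto simp: indicator_def\<close>)
  then show "set_integrable lborel {0<..} (\<lambda>t. exp (- l * t) * f t)"
    and "(LINT t:{0<..}|lborel. exp (- l * t) * f t) = c"
    by (auto simp: set_integrable_def set_lebesgue_integral_def has_bochner_integral_iff)
qed

context
  fixes u f :: "real \<Rightarrow> real" and C l :: real
  assumes u[measurable]: "u \<in> borel_measurable borel" and f[measurable]: "f \<in> borel_measurable borel"
    and u0: "\<And>t. t > 0 \<Longrightarrow> u t \<ge> 0" and f0: "\<And>t. t > 0 \<Longrightarrow> f t \<ge> 0" and fC: "\<And>t. t > 0 \<Longrightarrow> f t \<le> C"
    and LTu: "Laplace_nn u l < \<infinity>" and l: "l > 0"
begin

text \<open>
  For \<open>0 < r < t\<close> the factor \<open>exp (l * (t - r))\<close> is at least 1; inserting it replaces the integral of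
  the kernel up to time \<open>t\<close> by its Laplace transform.  This gives integrability and at most exponential
  growth with rate \<open>l\<close>.
\<close>

lemma nn_causal_convolution_le:
  "(\<integral>\<^sup>+s. indicator {0<..<t} s * ennreal (u (t - s) * f s) \<partial>lborel) \<le> ennreal (C * exp (l * t)) * Laplace_nn u l"
proof -
  have C: "C \<ge> 0" using f0[of 1] fC[of 1] by simp
  have "(\<integral>\<^sup>+s. indicator {0<..<t} s * ennreal (u (t - s) * f s) \<partial>lborel) =
     (\<integral>\<^sup>+s. indicator {0<..<t} (t + (-1) * s) * ennreal (u (t - (t + (-1) * s)) * f (t + (-1) * s)) \<partial>lborel)"
    by (subst nn_integral_real_affine[where c = "-1" and t = t]) auto
  also have "\<dots> \<le> (\<integral>\<^sup>+s. ennreal (C * exp (l * t)) * (indicator {0<..} s * ennreal (exp (- l * s) * u s)) \<partial>lborel)"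
  proof (rule nn_integral_mono)
    fix s :: real
    show "indicator {0<..<t} (t + (-1) * s) * ennreal (u (t - (t + (-1) * s)) * f (t + (-1) * s)) \<le>
      ennreal (C * exp (l * t)) * (indicator {0<..} s * ennreal (exp (- l * s) * u s))"
    proof (cases "s \<in> {0<..<t}")
      case True
      have "u s * f (t - s) \<le> u s * C"
        using True by (intro mult_left_mono fC u0) auto
      also have "\<dots> \<le> u s * C * exp (l * (t - s))"
        using mult_left_mono[of 1 "exp (l * (t - s))" "u s * C"] True l C u0[of s] by simp
      also have "\<dots> = C * exp (l * t) * (exp (- l * s) * u s)"
        by (simp add: exp_diff exp_minus field_simps)
      finally show ?thesis using True C u0[of s] by (simp add: ennreal_mult'[symmetric] ennreal_leI)
    qed (auto simp: indicator_def)
  qed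
  also have "\<dots> = ennreal (C * exp (l * t)) * Laplace_nn u l"
    unfolding Laplace_nn_def by (rule nn_integral_cmult) measurable
  finally show ?thesis .
qed

lemma set_integrable_causal_convolution: "set_integrable lborel {0<..<t} (\<lambda>s. u (t - s) * f s)"
  unfolding set_integrable_def
proof (rule integrableI_bounded)
  have "(\<integral>\<^sup>+s. ennreal (norm (indicator {0<..<t} s *\<^sub>R (u (t - s) * f s))) \<partial>lborel) =
    (\<integral>\<^sup>+s. indicator {0<..<t} s * ennreal (u (t - s) * f s) \<partial>lborel)"
    by (intro nn_integral_cong) (auto simp: indicator_def u0 f0)
  also have "\<dots> \<le> ennreal (C * exp (l * t)) * Laplace_nn u l" by (rule nn_causal_convolution_le)
  also have "\<dots> < \<infinity>" using LTu by (simp add: ennreal_mult_less_top)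
  finally show "(\<integral>\<^sup>+s. ennreal (norm (indicator {0<..<t} s *\<^sub>R (u (t - s) * f s))) \<partial>lborel) < \<infinity>" .
qed measurable

lemma ennreal_causal_convolution: "ennreal (causal_convolution u f t) = (\<integral>\<^sup>+s. indicator {0<..<t} s * ennreal (u (t - s) * f s) \<partial>lborel)"
proof -
  have "(\<integral>\<^sup>+s. ennreal (indicator {0<..<t} s * (u (t - s) * f s)) \<partial>lborel) = ennreal (causal_convolution u f t)"
    unfolding causal_convolution_def set_lebesgue_integral_def real_scaleR_def
    by (rule nn_integral_eq_integral)
      (use set_integrable_causal_convolution in \<open>auto simp: set_integrable_def indicator_def u0 f0\<close>)
  then show ?thesis by (simp add: indicator_mult_ennreal mult.commute)
qed

lemma causal_convolution_nonneg: "causal_convolution u f t \<ge> 0"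
  unfolding causal_convolution_def set_lebesgue_integral_def
  by (rule integral_nonneg_AE) (auto simp: indicator_def u0 f0)

lemma causal_convolution_le: "causal_convolution u f t \<le> C * exp (l * t) * enn2real (Laplace_nn u l)"
proof -
  have C: "C \<ge> 0" using f0[of 1] fC[of 1] by simp
  have "ennreal (causal_convolution u f t) \<le> ennreal (C * exp (l * t)) * Laplace_nn u l"
    unfolding ennreal_causal_convolution by (rule nn_causal_convolution_le)
  also have "\<dots> = ennreal (C * exp (l * t) * enn2real (Laplace_nn u l))"
    using LTu C by (simp add: ennreal_mult' less_top)
  finally show ?thesis using C by (subst (asm) ennreal_le_iff) auto
qed

lemma Laplace_nn_causal_convolution: "Laplace_nn (causal_convolution u f) \<theta> = Laplace_nn u \<theta> * Laplace_nn f \<theta>"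
proof -
  \<comment> \<open>the exponential weight factors as \<open>exp (- \<theta> * (t - s)) * exp (- \<theta> * s)\<close>, so both transforms separate\<close>
  define U where "U r = indicator {0<..} r * ennreal (exp (- \<theta> * r) * u r)" for r :: real
  define F where "F r = indicator {0<..} r * ennreal (exp (- \<theta> * r) * f r)" for r :: real
  have [measurable]: "U \<in> borel_measurable borel" "F \<in> borel_measurable borel"
    unfolding U_def F_def by measurable
  have "Laplace_nn (causal_convolution u f) \<theta> = (\<integral>\<^sup>+t. \<integral>\<^sup>+s. U (t - s) * F s \<partial>lborel \<partial>lborel)"
    unfolding Laplace_nn_def
  proof (rule nn_integral_cong)
    fix t :: real
    have "indicator {0<..} t * ennreal (exp (- \<theta> * t) * causal_convolution u f t) =
      indicator {0<..} t * ennreal (exp (- \<theta> * t)) * (\<integral>\<^sup>+s. indicator {0<..<t} s * ennreal (u (t - s) * f s) \<partial>lborel)"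
      by (simp add: ennreal_mult' ennreal_causal_convolution mult.assoc)
    also have "\<dots> = (\<integral>\<^sup>+s. indicator {0<..} t * ennreal (exp (- \<theta> * t)) * (indicator {0<..<t} s * ennreal (u (t - s) * f s)) \<partial>lborel)"
      by (rule nn_integral_cmult[symmetric]) measurable
    also have "\<dots> = (\<integral>\<^sup>+s. U (t - s) * F s \<partial>lborel)"
    proof (rule nn_integral_cong)
      fix s :: real
      have "exp (- (\<theta> * t)) * (u (t - s) * f s) = exp (- (\<theta> * (t - s))) * u (t - s) * (exp (- (\<theta> * s)) * f s)"
      proof -
        have "exp (- (\<theta> * t)) = exp (- (\<theta> * (t - s))) * exp (- (\<theta> * s))"
          unfolding exp_add[symmetric] by (simp add: algebra_simps)
        then show ?thesis by (simp only: mult_ac)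
      qed
      then show "indicator {0<..} t * ennreal (exp (- \<theta> * t)) * (indicator {0<..<t} s * ennreal (u (t - s) * f s)) = U (t - s) * F s"
        using u0[of "t - s"] f0[of s] by (auto simp: U_def F_def indicator_def ennreal_mult'[symmetric])
    qed
    finally show "indicator {0<..} t * ennreal (exp (- \<theta> * t) * causal_convolution u f t) = (\<integral>\<^sup>+s. U (t - s) * F s \<partial>lborel)" .
  qed
  also have "\<dots> = (\<integral>\<^sup>+s. \<integral>\<^sup>+t. U (t - s) * F s \<partial>lborel \<partial>lborel)"
    by (rule lborel_pair.Fubini') measurable
  also have "\<dots> = (\<integral>\<^sup>+s. Laplace_nn u \<theta> * F s \<partial>lborel)"
  proof (rule nn_integral_cong)
    fix s :: real
    have "(\<integral>\<^sup>+t. U (t - s) * F s \<partial>lborel) = (\<integral>\<^sup>+t. U (t - s) \<partial>lborel) * F s"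
      by (rule nn_integral_multc) measurable
    also have "(\<integral>\<^sup>+t. U (t - s) \<partial>lborel) = (\<integral>\<^sup>+t. U t \<partial>lborel)"
      using nn_integral_real_affine[of U 1 "- s"] by simp
    finally show "(\<integral>\<^sup>+t. U (t - s) * F s \<partial>lborel) = Laplace_nn u \<theta> * F s" by (simp add: Laplace_nn_def U_def)
  qed
  also have "\<dots> = Laplace_nn u \<theta> * (\<integral>\<^sup>+s. F s \<partial>lborel)"
    by (rule nn_integral_cmult) measurable
  also have "\<dots> = Laplace_nn u \<theta> * Laplace_nn f \<theta>" by (simp add: Laplace_nn_def F_def)
  finally show ?thesis .
qed

text \<open>
  After reflection the moving argument is in the bounded continuous factor, and the singular kernel
  \<open>u\<close> stays fixed.  For \<open>t\<close> below \<open>t0 + 1\<close> it can be bounded by a multiple of \<open>exp (- l * r) * u r\<close>,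
  which is integrable over the whole half-line.
\<close>

lemma continuous_causal_convolution:
  assumes cont: "continuous_on UNIV (\<lambda>t. if t > 0 then f t else 0)"
  shows "continuous_on UNIV (causal_convolution u f)"
  unfolding continuous_on_def
proof
  fix t0 :: real
  define g where "g t = (if t > 0 then f t else 0)" for t
  have gm[measurable]: "g \<in> borel_measurable borel" unfolding g_def by measurable
  have C: "C \<ge> 0" using f0[of 1] fC[of 1] by simp
  have g: "0 \<le> g t" "g t \<le> C" for t using f0 fC C by (auto simp: g_def)
  have causal_convolution: "causal_convolution u f t = (\<integral>r. indicator {0<..} r * u r * g (t - r) \<partial>lborel)" for t
  proof -
    have "causal_convolution u f t = (\<integral>s. indicator {0<..} (t - s) * u (t - s) * g s \<partial>lborel)"
      unfolding causal_convolution_def set_lebesgue_integral_def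
      by (intro Bochner_Integration.integral_cong) (auto simp: indicator_def g_def)
    also have "\<dots> = (\<integral>r. indicator {0<..} r * u r * g (t - r) \<partial>lborel)"
      by (subst lborel_integral_real_affine[where c="-1" and t=t]) auto
    finally show ?thesis .
  qed
  define w where "w r = C * exp (l * (t0 + 1)) * (indicator {0<..} r * (exp (- l * r) * u r))" for r
  have w: "integrable lborel w"
  proof -
    have "Laplace_nn u l = ennreal (enn2real (Laplace_nn u l))" using LTu by (simp add: less_top)
    from set_integral_of_Laplace_nn(1)[OF u u0 this] show ?thesis
      unfolding w_def set_integrable_def by (intro Bochner_Integration.integrable_mult_right) auto
  qed
  show "(causal_convolution u f \<longlongrightarrow> causal_convolution u f t0) (at t0)"
    unfolding causal_convolution
  proof (rule tendsto_integral_at_within[OF _ _ w])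
    have "\<forall>\<^sub>F t in at t0. t < t0 + 1"
      using eventually_nhds_in_open[of "{..<t0 + 1}" t0] by (simp add: eventually_at_filter eventually_mono)
    then show "\<forall>\<^sub>F t in at t0. AE r in lborel. \<bar>indicator {0<..} r * u r * g (t - r)\<bar> \<le> w r"
    proof eventually_elim
      case (elim t)
      show ?case
      proof (rule AE_I2)
        fix r :: real
        show "\<bar>indicator {0<..} r * u r * g (t - r)\<bar> \<le> w r"
        proof (cases "r > 0 \<and> t - r > 0")
          case True
          then have ur: "u r \<ge> 0" by (simp add: u0)
          have "u r * g (t - r) \<le> u r * C" using g ur by (intro mult_left_mono)
          also have "\<dots> \<le> u r * C * exp (l * (t0 + 1 - r))"
            using mult_left_mono[of 1 "exp (l * (t0 + 1 - r))" "u r * C"] True l C ur elim by simp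
          also have "\<dots> = C * exp (l * (t0 + 1)) * (exp (- l * r) * u r)"
            by (simp add: exp_diff exp_minus field_simps)
          finally show ?thesis using True ur g by (simp add: w_def)
        next
          case False
          then have "indicator {0<..} r * u r * g (t - r) = 0" by (auto simp: g_def)
          moreover have "w r \<ge> 0" using C u0 by (auto simp: w_def indicator_def)
          ultimately show ?thesis by (simp only: abs_zero)
        qed
      qed
    qed
    have ic: "isCont g x" for x
      using cont by (simp add: g_def[abs_def] continuous_on_eq_continuous_at)
    have "((\<lambda>t. g (t - r)) \<longlongrightarrow> g (t0 - r)) (at t0)" for r
      by (rule isCont_tendsto_compose[OF ic]) (auto intro!: tendsto_eq_intros)
    then show "AE r in lborel. ((\<lambda>t. indicator {0<..} r * u r * g (t - r)) \<longlongrightarrow> indicator {0<..} r * u r * g (t0 - r)) (at t0)"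
      by (intro AE_I2 tendsto_intros)
  qed measurable
qed
end

section \<open>Laplace transforms of tilted moments\<close>

text \<open>
  For \<open>p > 1\<close>, up to normalisation, the density of \<open>a / G\<close> with \<open>G\<close> a Gamma variable of shape \<open>p - 1\<close>.  For fixed
  \<open>x\<close> and \<open>a = x powr \<gamma>\<close> it is, up to a constant
  factor, the kernel \<open>gtilde \<gamma> p x\<close> as a function of time.
\<close>

definition inverse_gamma_kernel :: "real \<Rightarrow> real \<Rightarrow> real \<Rightarrow> real" where
  "inverse_gamma_kernel a p r = r powr (- p) * exp (- a / r)"

lemma inverse_gamma_kernel_eq: "r > 0 \<Longrightarrow> inverse_gamma_kernel a p r = (1 / r) powr p * exp (- a * (1 / r))"
  by (simp add: inverse_gamma_kernel_def powr_divide powr_minus field_simps)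

lemma inverse_gamma_kernel_measurable [measurable]: "inverse_gamma_kernel a p \<in> borel_measurable borel"
  unfolding inverse_gamma_kernel_def by measurable

lemma inverse_gamma_kernel_nonneg: "inverse_gamma_kernel a p r \<ge> 0" by (simp add: inverse_gamma_kernel_def)

lemma inverse_gamma_kernel_le: "a > 0 \<Longrightarrow> p \<ge> 0 \<Longrightarrow> r > 0 \<Longrightarrow> inverse_gamma_kernel a p r \<le> 1 + (p / a) powr p"
  unfolding inverse_gamma_kernel_eq by (rule powr_mult_exp_le) auto

lemma Laplace_nn_powr: "s > -1 \<Longrightarrow> l > 0 \<Longrightarrow> Laplace_nn (\<lambda>t. t powr s) l = ennreal (Gamma (s + 1) / l powr (s + 1))"
  using nn_integral_Gamma_scaled[of "s + 1" l] by (simp add: Laplace_nn_def mult.commute)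

lemma Laplace_nn_cong: "(\<And>t. t > 0 \<Longrightarrow> f t = h t) \<Longrightarrow> Laplace_nn f l = Laplace_nn h l"
  unfolding Laplace_nn_def by (intro nn_integral_cong) (auto simp: indicator_def)

lemma Laplace_nn_one: "l > 0 \<Longrightarrow> Laplace_nn (\<lambda>t. 1) l = ennreal (1 / l)"
  using Laplace_nn_powr[of 0 l] Laplace_nn_cong[of "\<lambda>t. 1" "\<lambda>t. t powr 0" l] by simp

lemma Laplace_nn_le:
  assumes f: "\<And>t. t > 0 \<Longrightarrow> f t \<le> C" and C: "C \<ge> 0" and l: "l > 0"
  shows "Laplace_nn f l \<le> ennreal (C / l)"
proof -
  have "Laplace_nn f l \<le> (\<integral>\<^sup>+t. ennreal C * (indicator {0<..} t * ennreal (exp (- l * t) * 1)) \<partial>lborel)"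
    unfolding Laplace_nn_def
  proof (rule nn_integral_mono)
    fix t :: real
    show "indicator {0<..} t * ennreal (exp (- l * t) * f t) \<le> ennreal C * (indicator {0<..} t * ennreal (exp (- l * t) * 1))"
      using f[of t] C by (auto simp: indicator_def ennreal_mult'[symmetric] mult.commute intro!: ennreal_leI mult_left_mono)
  qed
  also have "\<dots> = ennreal C * Laplace_nn (\<lambda>_. 1) l"
    unfolding Laplace_nn_def by (rule nn_integral_cmult) measurable
  finally show ?thesis using Laplace_nn_one[OF l] C by (simp add: ennreal_mult'[symmetric])
qed

text \<open>
  The product \<open>F r = exp (- q * r) * r powr (- p) * exp (- a / r)\<close> vanishes at both ends of the
  half-line, so its derivative has integral 0.  The three terms of the derivative are the three
  kernels of the recurrence.
\<close>

lemma Laplace_nn_inverse_gamma_kernel_recurrence: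
  assumes a: "a > 0" and p: "p > 0" and q: "q > 0"
  obtains K where "\<And>p'. p' \<ge> 0 \<Longrightarrow> Laplace_nn (inverse_gamma_kernel a p') q = ennreal (K p')" "\<And>p'. K p' \<ge> 0"
    "q * K p + p * K (p + 1) = a * K (p + 2)"
proof -
  define K where "K p = enn2real (Laplace_nn (inverse_gamma_kernel a p) q)" for p
  have K0: "K p' \<ge> 0" for p' by (simp add: K_def)
  have K: "Laplace_nn (inverse_gamma_kernel a p') q = ennreal (K p')" if "p' \<ge> 0" for p'
  proof -
    have "Laplace_nn (inverse_gamma_kernel a p') q \<le> ennreal ((1 + (p' / a) powr p') / q)"
      by (rule Laplace_nn_le) (use inverse_gamma_kernel_le[OF a that] q in auto)
    then have "Laplace_nn (inverse_gamma_kernel a p') q < \<infinity>" by (rule le_less_trans) simp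
    then show ?thesis by (simp add: K_def less_top)
  qed
  have I: "set_integrable lborel {0<..} (\<lambda>t. exp (- q * t) * inverse_gamma_kernel a p' t)"
    "(LINT t:{0<..}|lborel. exp (- q * t) * inverse_gamma_kernel a p' t) = K p'" if "p' \<ge> 0" for p'
    using set_integral_of_Laplace_nn[OF inverse_gamma_kernel_measurable inverse_gamma_kernel_nonneg K[OF that] K0] by auto
  define F where "F r = exp (- q * r) * inverse_gamma_kernel a p r" for r
  define f where "f r = - q * (exp (- q * r) * inverse_gamma_kernel a p r) - p * (exp (- q * r) * inverse_gamma_kernel a (p + 1) r) + a * (exp (- q * r) * inverse_gamma_kernel a (p + 2) r)" for r
  have df: "(F has_real_derivative f r) (at r)" if "r > 0" for r
  proof -
    have "(F has_real_derivative (- q * exp (- q * r)) * inverse_gamma_kernel a p r + exp (- q * r) * (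
       (- p * r powr (- p - 1)) * exp (- a / r) + r powr (- p) * ((a / (r * r)) * exp (- a / r)))) (at r)"
      unfolding F_def inverse_gamma_kernel_def using that
      by (auto intro!: derivative_eq_intros simp: field_simps)
    also have "(- q * exp (- q * r)) * inverse_gamma_kernel a p r + exp (- q * r) * (
       (- p * r powr (- p - 1)) * exp (- a / r) + r powr (- p) * ((a / (r * r)) * exp (- a / r))) = f r"
    proof -
      have "r powr (- (p + 1)) = r powr (- p - 1)" "r powr (- (p + 2)) = r powr (- p) / (r * r)"
        using that by (simp_all add: powr_diff powr_numeral power2_eq_square)
      then show ?thesis by (simp add: f_def inverse_gamma_kernel_def algebra_simps)
    qed
    finally show ?thesis .
  qed
  have cf: "isCont f r" if "r > 0" for r
    unfolding f_def inverse_gamma_kernel_def using that by (intro continuous_intros) auto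
  have If: "set_integrable lborel {0<..} f"
    unfolding f_def by (intro set_integral_add set_integral_diff set_integrable_mult_right I) (use p in auto)
  \<comment> \<open>near 0 the kernel of order \<open>p\<close> is \<open>r\<close> times the bounded kernel of order \<open>p + 1\<close>\<close>
  have lim0: "(F \<longlongrightarrow> 0) (at_right 0)"
  proof (rule tendsto_sandwich[of "\<lambda>_. 0" _ _ "\<lambda>r. r * (1 + ((p + 1) / a) powr (p + 1))"])
    show "\<forall>\<^sub>F r in at_right 0. F r \<le> r * (1 + ((p + 1) / a) powr (p + 1))"
      using eventually_at_right_less[of 0]
    proof eventually_elim
      case (elim r)
      have "F r \<le> inverse_gamma_kernel a p r"
        using elim q by (auto simp: F_def inverse_gamma_kernel_nonneg intro!: mult_left_le_one_le)
      also have "\<dots> = r * inverse_gamma_kernel a (p + 1) r"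
        using elim by (simp add: inverse_gamma_kernel_def powr_diff)
      also have "\<dots> \<le> r * (1 + ((p + 1) / a) powr (p + 1))"
        using elim inverse_gamma_kernel_le[of a "p + 1" r] a p by (intro mult_left_mono) auto
      finally show ?case .
    qed
  qed (auto intro!: tendsto_eq_intros always_eventually simp: F_def inverse_gamma_kernel_nonneg)
  have lim1: "(F \<longlongrightarrow> 0) at_top"
  proof (rule tendsto_sandwich[of "\<lambda>_. 0" _ _ "\<lambda>r. ((1 + (1 / q) powr 1) * (1 + (p / a) powr p)) / r"])
    show "\<forall>\<^sub>F r in at_top. F r \<le> ((1 + (1 / q) powr 1) * (1 + (p / a) powr p)) / r"
      using eventually_gt_at_top[of 0]
    proof eventually_elim
      case (elim r)
      have "r * exp (- q * r) \<le> 1 + (1 / q) powr 1"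
        using powr_mult_exp_le[of r 1 q] elim q by simp
      then have "(r * exp (- q * r)) * inverse_gamma_kernel a p r \<le> (1 + (1 / q) powr 1) * (1 + (p / a) powr p)"
        using elim a p by (intro mult_mono inverse_gamma_kernel_le inverse_gamma_kernel_nonneg) auto
      then show ?case using elim by (simp add: F_def field_simps)
    qed
    show "((\<lambda>r. ((1 + (1 / q) powr 1) * (1 + (p / a) powr p)) / r) \<longlongrightarrow> 0) at_top"
      by (intro tendsto_divide_0[OF tendsto_const] filterlim_at_top_imp_at_infinity filterlim_ident)
  qed (auto intro!: always_eventually simp: F_def inverse_gamma_kernel_nonneg)
  have "(LBINT r=ereal 0..\<infinity>. f r) = 0 - 0"
  proof (rule interval_integral_FTC_integrable[where F = F])
    show "(F has_vector_derivative f x) (at x)" if "ereal 0 < ereal x" for x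
      using df[of x] that by (simp add: has_real_derivative_iff_has_vector_derivative)
    show "set_integrable lborel (einterval (ereal 0) \<infinity>) f"
      using If by simp
    show "((F \<circ> real_of_ereal) \<longlongrightarrow> 0) (at_right (ereal 0))"
      using lim0 unfolding ereal_tendsto_simps .
    show "((F \<circ> real_of_ereal) \<longlongrightarrow> 0) (at_left \<infinity>)"
      using lim1 unfolding ereal_tendsto_simps .
  qed (use cf in auto)
  then have "(LINT r:{0<..}|lborel. f r) = 0"
    by (simp add: interval_integral_to_infinity_eq)
  also have "(LINT r:{0<..}|lborel. f r) = - q * K p - p * K (p + 1) + a * K (p + 2)"
  proof -
    define e where "e p' r = exp (- q * r) * inverse_gamma_kernel a p' r" for p' r
    have e: "set_integrable lborel {0<..} (e p')" "(LINT t:{0<..}|lborel. e p' t) = K p'" if "p' \<ge> 0" for p'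
      unfolding e_def using I[OF that] by auto
    have c: "set_integrable lborel {0<..} (\<lambda>r. c * e p' r)" "(LINT r:{0<..}|lborel. c * e p' r) = c * K p'" if "p' \<ge> 0" for p' c
      using e[OF that] by auto
    have 1: "set_integrable lborel {0<..} (\<lambda>r. - q * e p r - p * e (p + 1) r)"
      "(LINT r:{0<..}|lborel. - q * e p r - p * e (p + 1) r) = - q * K p - p * K (p + 1)"
      using set_integral_diff[OF c(1)[of p "- q"] c(1)[of "p + 1" p]] p by (simp_all only: c)
    show ?thesis
      unfolding f_def e_def[symmetric]
      using set_integral_add(2)[OF 1(1) c(1)[of "p + 2" a]] p by (simp only: 1 c)
  qed
  finally have "q * K p + p * K (p + 1) = a * K (p + 2)" by simp
  with K K0 show ?thesis using that by blast
qed

text \<open>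
  The law at time 1 of a stable subordinator.  The exponent \<open>\<nu> = 1\<close> is included, where the law is
  the point mass at 1; this treats the ordinary and the fractional equation together.
\<close>

locale stable_law = prob_space P for P :: "real measure" +
  fixes \<nu> :: real
  assumes sets_P [measurable_cong]: "sets P = sets borel"
    and pos: "AE y in P. 0 < y"
    and \<nu>: "0 < \<nu>"
    and Laplace: "\<And>\<theta>. \<theta> > 0 \<Longrightarrow> (\<integral>y. exp (- \<theta> * y) \<partial>P) = exp (- (\<theta> powr \<nu>))"
begin

text \<open>
  This is the Laplace transform differentiated under the integral sign, which is legitimate
  since \<open>\<theta>\<close> is positive, although
  the mean of the law itself is infinite when \<open>\<nu> < 1\<close>.
\<close>

lemma size_biased_Laplace:
  assumes \<theta>: "\<theta> > 0"
  shows "(\<integral>\<^sup>+y. ennreal (y * exp (- \<theta> * y)) \<partial>P) = ennreal (\<nu> * \<theta> powr (\<nu> - 1) * exp (- (\<theta> powr \<nu>)))"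
proof -
  have pos': "AE y in P. 0 \<le> y" using pos by (auto elim: eventually_mono)
  have "((\<lambda>b. \<integral>y. y powr 0 * exp (- b * y) \<partial>P) has_real_derivative
     - (\<integral>y. y powr (0 + 1) * exp (- \<theta> * y) \<partial>P)) (at \<theta>)"
    by (rule has_real_derivative_integral_powr_mult_exp) (use \<theta> pos' finite_measure_axioms in auto)
  then have "((\<lambda>b. exp (- (b powr \<nu>))) has_real_derivative
     - (\<integral>y. y powr (0 + 1) * exp (- \<theta> * y) \<partial>P)) (at \<theta>)"
  proof (rule has_field_derivative_transform_within_open[where S = "{0<..}"])
    fix b :: real assume "b \<in> {0<..}"
    then have "b > 0" by simp
    then show "(\<integral>y. y powr 0 * exp (- b * y) \<partial>P) = exp (- (b powr \<nu>))"
      unfolding Laplace[OF \<open>b > 0\<close>, symmetric] using pos by (intro integral_cong_AE) auto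
  qed (use \<theta> in auto)
  moreover have "((\<lambda>b. exp (- (b powr \<nu>))) has_real_derivative - (\<nu> * \<theta> powr (\<nu> - 1) * exp (- (\<theta> powr \<nu>)))) (at \<theta>)"
    using \<theta> by (auto intro!: derivative_eq_intros)
  ultimately have "(\<integral>y. y powr (0 + 1) * exp (- \<theta> * y) \<partial>P) = \<nu> * \<theta> powr (\<nu> - 1) * exp (- (\<theta> powr \<nu>))"
    using DERIV_unique by fastforce
  moreover have "(\<integral>\<^sup>+y. ennreal (y * exp (- \<theta> * y)) \<partial>P) = (\<integral>\<^sup>+y. ennreal (y powr (0 + 1) * exp (- \<theta> * y)) \<partial>P)"
    using pos by (intro nn_integral_cong_AE) auto
  moreover have "(\<integral>\<^sup>+y. ennreal (y powr (0 + 1) * exp (- \<theta> * y)) \<partial>P) = ennreal (\<integral>y. y powr (0 + 1) * exp (- \<theta> * y) \<partial>P)"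
    by (rule nn_integral_eq_integral[OF integrable_powr_mult_exp])
      (use \<theta> pos' finite_measure_axioms in auto)
  ultimately show ?thesis by simp
qed

text \<open>
  Substituting \<open>t = y * r\<close> removes \<open>y\<close> from the moment, because only \<open>y / t\<close> enters there, and leaves
  the weight \<open>y * exp (- l * r * y)\<close>, whose mean is known.  The resulting factor
  \<open>\<nu> * r powr (\<nu> - 1)\<close> is exactly the Jacobian of \<open>r \<mapsto> r powr \<nu>\<close>.
\<close>

lemma Laplace_nn_tilted_moment:
  assumes a: "a > 0" and p: "p \<ge> 0" and l: "l > 0"
  shows "Laplace_nn (tilted_moment P \<nu> p a) l = ennreal (l powr (\<nu> - 1)) * Laplace_nn (inverse_gamma_kernel a p) (l powr \<nu>)"
proof -
  interpret PL: pair_sigma_finite P lborel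
    by (simp add: pair_sigma_finite_def sigma_finite_measure_axioms lborel.sigma_finite_measure_axioms)
  interpret LP: pair_sigma_finite lborel P
    by (simp add: pair_sigma_finite_def sigma_finite_measure_axioms lborel.sigma_finite_measure_axioms)
  define \<kappa> where "\<kappa> z = z powr p * exp (- a * z)" for z
  have [measurable]: "\<kappa> \<in> borel_measurable borel" unfolding \<kappa>_def by measurable
  have \<kappa>0: "\<kappa> z \<ge> 0" for z by (simp add: \<kappa>_def)
  have etilted_moment: "ennreal (tilted_moment P \<nu> p a t) = (\<integral>\<^sup>+y. ennreal (\<kappa> ((y / t) powr \<nu>)) \<partial>P)" for t
    unfolding tilted_moment_def \<kappa>_def
    by (rule nn_integral_eq_integral[OF integrable_powr_mult_exp, symmetric])
      (use a p finite_measure_axioms in auto)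
  have "Laplace_nn (tilted_moment P \<nu> p a) l = (\<integral>\<^sup>+t. \<integral>\<^sup>+y. indicator {0<..} t * (ennreal (exp (- l * t)) * ennreal (\<kappa> ((y / t) powr \<nu>))) \<partial>P \<partial>lborel)"
    unfolding Laplace_nn_def
  proof (rule nn_integral_cong)
    fix t :: real
    have "indicator {0<..} t * ennreal (exp (- l * t) * tilted_moment P \<nu> p a t) =
      indicator {0<..} t * ennreal (exp (- l * t)) * (\<integral>\<^sup>+y. ennreal (\<kappa> ((y / t) powr \<nu>)) \<partial>P)"
      by (simp add: ennreal_mult' etilted_moment mult.assoc)
    also have "\<dots> = (\<integral>\<^sup>+y. indicator {0<..} t * ennreal (exp (- l * t)) * ennreal (\<kappa> ((y / t) powr \<nu>)) \<partial>P)"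
      by (rule nn_integral_cmult[symmetric]) measurable
    finally show "indicator {0<..} t * ennreal (exp (- l * t) * tilted_moment P \<nu> p a t) =
      (\<integral>\<^sup>+y. indicator {0<..} t * (ennreal (exp (- l * t)) * ennreal (\<kappa> ((y / t) powr \<nu>))) \<partial>P)"
      by (simp only: mult.assoc)
  qed
  also have "\<dots> = (\<integral>\<^sup>+y. \<integral>\<^sup>+t. indicator {0<..} t * (ennreal (exp (- l * t)) * ennreal (\<kappa> ((y / t) powr \<nu>))) \<partial>lborel \<partial>P)"
    by (rule PL.Fubini') measurable
  also have "\<dots> = (\<integral>\<^sup>+y. \<integral>\<^sup>+r. indicator {0<..} r * ennreal (\<kappa> ((1 / r) powr \<nu>)) * ennreal (y * exp (- (l * r) * y)) \<partial>lborel \<partial>P)"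
  proof (rule nn_integral_cong_AE)
    show "AE y in P. (\<integral>\<^sup>+t. indicator {0<..} t * (ennreal (exp (- l * t)) * ennreal (\<kappa> ((y / t) powr \<nu>))) \<partial>lborel) =
      (\<integral>\<^sup>+r. indicator {0<..} r * ennreal (\<kappa> ((1 / r) powr \<nu>)) * ennreal (y * exp (- (l * r) * y)) \<partial>lborel)"
      using pos
    proof eventually_elim
      case (elim y)
      have "(\<integral>\<^sup>+t. indicator {0<..} t * (ennreal (exp (- l * t)) * ennreal (\<kappa> ((y / t) powr \<nu>))) \<partial>lborel) =
        ennreal y * (\<integral>\<^sup>+r. indicator {0<..} r * (ennreal (exp (- l * (y * r))) * ennreal (\<kappa> ((y / (y * r)) powr \<nu>))) \<partial>lborel)"
        by (rule nn_integral_scale) (use elim in auto)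
      also have "\<dots> = (\<integral>\<^sup>+r. ennreal y * (indicator {0<..} r * (ennreal (exp (- l * (y * r))) * ennreal (\<kappa> ((y / (y * r)) powr \<nu>)))) \<partial>lborel)"
        by (rule nn_integral_cmult[symmetric]) measurable
      also have "\<dots> = (\<integral>\<^sup>+r. indicator {0<..} r * ennreal (\<kappa> ((1 / r) powr \<nu>)) * ennreal (y * exp (- (l * r) * y)) \<partial>lborel)"
        using elim by (intro nn_integral_cong) (auto simp: indicator_def ennreal_mult'[symmetric] \<kappa>0 ennreal_mult''[symmetric] mult_ac)
      finally show ?case .
    qed
  qed
  also have "\<dots> = (\<integral>\<^sup>+r. \<integral>\<^sup>+y. indicator {0<..} r * ennreal (\<kappa> ((1 / r) powr \<nu>)) * ennreal (y * exp (- (l * r) * y)) \<partial>P \<partial>lborel)"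
    by (rule LP.Fubini') measurable
  also have "\<dots> = (\<integral>\<^sup>+r. indicator {0<..} r * (ennreal (\<bar>\<nu>\<bar> * r powr (\<nu> - 1)) *
      ennreal (l powr (\<nu> - 1) * (exp (- (l powr \<nu>) * r powr \<nu>) * inverse_gamma_kernel a p (r powr \<nu>)))) \<partial>lborel)"
  proof (rule nn_integral_cong)
    fix r :: real
    show "(\<integral>\<^sup>+y. indicator {0<..} r * ennreal (\<kappa> ((1 / r) powr \<nu>)) * ennreal (y * exp (- (l * r) * y)) \<partial>P) =
      indicator {0<..} r * (ennreal (\<bar>\<nu>\<bar> * r powr (\<nu> - 1)) *
      ennreal (l powr (\<nu> - 1) * (exp (- (l powr \<nu>) * r powr \<nu>) * inverse_gamma_kernel a p (r powr \<nu>))))"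
    proof (cases "r > 0")
      case True
      have "(\<integral>\<^sup>+y. indicator {0<..} r * ennreal (\<kappa> ((1 / r) powr \<nu>)) * ennreal (y * exp (- (l * r) * y)) \<partial>P) =
        indicator {0<..} r * ennreal (\<kappa> ((1 / r) powr \<nu>)) * (\<integral>\<^sup>+y. ennreal (y * exp (- (l * r) * y)) \<partial>P)"
        by (rule nn_integral_cmult) measurable
      also have "(\<integral>\<^sup>+y. ennreal (y * exp (- (l * r) * y)) \<partial>P) = ennreal (\<nu> * (l * r) powr (\<nu> - 1) * exp (- ((l * r) powr \<nu>)))"
        by (rule size_biased_Laplace) (use True l in simp)
      finally have E: "(\<integral>\<^sup>+y. indicator {0<..} r * ennreal (\<kappa> ((1 / r) powr \<nu>)) * ennreal (y * exp (- (l * r) * y)) \<partial>P) =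
        indicator {0<..} r * ennreal (\<kappa> ((1 / r) powr \<nu>)) * ennreal (\<nu> * (l * r) powr (\<nu> - 1) * exp (- ((l * r) powr \<nu>)))" .
      have K: "\<kappa> ((1 / r) powr \<nu>) = inverse_gamma_kernel a p (r powr \<nu>)"
        using True by (simp add: inverse_gamma_kernel_eq \<kappa>_def powr_divide)
      show ?thesis
        unfolding E unfolding K using True \<nu> l by (simp add: ennreal_mult'[symmetric] ennreal_mult''[symmetric] inverse_gamma_kernel_nonneg powr_mult mult_ac)
    qed simp
  qed
  also have "\<dots> = (\<integral>\<^sup>+v. indicator {0<..} v * ennreal (l powr (\<nu> - 1) * (exp (- (l powr \<nu>) * v) * inverse_gamma_kernel a p v)) \<partial>lborel)"
    by (rule nn_integral_powr_substitution) (use \<nu> in auto)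
  also have "\<dots> = (\<integral>\<^sup>+v. ennreal (l powr (\<nu> - 1)) * (indicator {0<..} v * ennreal (exp (- (l powr \<nu>) * v) * inverse_gamma_kernel a p v)) \<partial>lborel)"
    by (intro nn_integral_cong) (auto simp: indicator_def ennreal_mult')
  also have "\<dots> = ennreal (l powr (\<nu> - 1)) * Laplace_nn (inverse_gamma_kernel a p) (l powr \<nu>)"
    unfolding Laplace_nn_def by (rule nn_integral_cmult) measurable
  finally show ?thesis .
qed
end

section \<open>The fractional derivative of a tilted moment\<close>

text \<open>
  Convolution with 1 is integration from 0, so this is the fundamental theorem of calculus for the
  continuous extension of \<open>f\<close> by 0.
\<close>

lemma has_real_derivative_causal_convolution_one:
  assumes cont: "continuous_on UNIV (\<lambda>t. if t > 0 then f t else 0)" and t: "t > 0"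
  shows "(causal_convolution (\<lambda>_. 1) f has_real_derivative f t) (at t)"
proof -
  define g where "g t = (if t > 0 then f t else 0)" for t :: real
  have g: "continuous_on UNIV g" using cont by (simp add: g_def[abs_def])
  have eq: "causal_convolution (\<lambda>_. 1) f \<tau> = integral {0..\<tau>} g" for \<tau>
  proof -
    have "continuous_on {0..\<tau>} g" using g by (rule continuous_on_subset) simp
    then have "set_integrable lborel {0..\<tau>} g" by (rule borel_integrable_atLeastAtMost')
    then have i: "set_integrable lborel {0<..<\<tau>} g"
      by (rule set_integrable_subset) auto
    have "causal_convolution (\<lambda>_. 1) f \<tau> = (LINT s:{0<..<\<tau>}|lborel. g s)"
      unfolding causal_convolution_def by (rule set_lebesgue_integral_cong) (auto simp: g_def)
    also have "\<dots> = integral {0<..<\<tau>} g"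
      by (rule set_borel_integral_eq_integral(2)[OF i])
    also have "\<dots> = integral {0..\<tau>} g"
      using integral_open_interval[of 0 \<tau> g] by simp
    finally show ?thesis .
  qed
  have "((\<lambda>\<tau>. integral {0..\<tau>} g) has_real_derivative g t) (at t within {0..t + 1})"
    by (rule integral_has_real_derivative) (use g t in \<open>auto intro: continuous_on_subset\<close>)
  moreover have "at t within {0..t + 1} = at t"
    by (rule at_within_interior) (use t in simp)
  ultimately show ?thesis
    using t by (simp add: eq[abs_def] g_def)
qed

context stable_law
begin

context
  fixes a \<mu> :: real
  assumes a: "a > 0" and \<mu>: "\<mu> > 0" and \<nu>1: "\<nu> < 1"
begin

text \<open>
  The fractional equation integrated once in time.  On the side of Laplace transforms at \<open>l\<close>, with
  \<open>q = l powr \<nu>\<close>, it reads \<open>q * K \<mu> = a * K (\<mu> + 2) - \<mu> * K (\<mu> + 1)\<close> after a common factor is removed;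
  the power kernel contributes \<open>Gamma (1 - \<nu>) * l powr (\<nu> - 1)\<close> and integration in time contributes
  \<open>1 / l\<close>.
\<close>

lemma causal_convolution_powr_tilted_moment:
  assumes t: "t > 0"
  shows "causal_convolution (\<lambda>s. s powr (- \<nu>)) (tilted_moment P \<nu> \<mu> a) t =
    Gamma (1 - \<nu>) * (a * causal_convolution (\<lambda>_. 1) (tilted_moment P \<nu> (\<mu> + 2) a) t - \<mu> * causal_convolution (\<lambda>_. 1) (tilted_moment P \<nu> (\<mu> + 1) a) t)"
proof -
  define u where "u s = s powr (- \<nu>)" for s :: real
  define one where "one s = (1::real)" for s :: real
  have [measurable]: "u \<in> borel_measurable borel" "one \<in> borel_measurable borel"
    unfolding u_def one_def by measurable
  define G where "G = Gamma (1 - \<nu>)"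
  have G: "G > 0" unfolding G_def using \<nu>1 by (intro Gamma_real_pos) auto
  have u0: "u s \<ge> 0" and one0: "one s \<ge> 0" for s by (auto simp: u_def one_def)
  have LTu: "Laplace_nn u l = ennreal (G / l powr (1 - \<nu>))" if "l > 0" for l
    using Laplace_nn_powr[of "- \<nu>" l] that \<nu>1 by (simp add: u_def[abs_def] G_def)
  have LTone: "Laplace_nn one l = ennreal (1 / l)" if "l > 0" for l
    using Laplace_nn_one[OF that] by (simp add: one_def[abs_def])
  have fin: "Laplace_nn u 1 < \<infinity>" "Laplace_nn one 1 < \<infinity>" "Laplace_nn u (1/2) < \<infinity>" "Laplace_nn one (1/2) < \<infinity>"
    using LTu LTone by auto
  define f where "f p = tilted_moment P \<nu> p a" for p
  have [measurable]: "f p \<in> borel_measurable borel" for p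
    unfolding f_def using tilted_moment_measurable[OF sets_P prob_space_axioms] .
  have f0: "f p t \<ge> 0" for p t by (simp add: f_def tilted_moment_nonneg)
  have fle: "f p t \<le> 1 + (p / a) powr p" if "p \<ge> 0" for p t
    unfolding f_def using that a by (intro tilted_moment_le sets_P prob_space_axioms)
  have cf: "continuous_on UNIV (\<lambda>t. if t > 0 then f p t else 0)" if "p \<ge> 0" for p
    unfolding f_def by (rule continuous_tilted_moment) (use that a \<nu> sets_P prob_space_axioms pos in auto)
  define F1 where "F1 = causal_convolution u (f \<mu>)"
  define F2 where "F2 = causal_convolution one (f (\<mu> + 1))"
  define F3 where "F3 = causal_convolution one (f (\<mu> + 2))"
  define C where "C = (1 + (\<mu> / a) powr \<mu>) + (1 + ((\<mu> + 1) / a) powr (\<mu> + 1)) + (1 + ((\<mu> + 2) / a) powr (\<mu> + 2))"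
  have fC: "f \<mu> t \<le> C" "f (\<mu> + 1) t \<le> C" "f (\<mu> + 2) t \<le> C" for t
    using fle[of \<mu> t] fle[of "\<mu> + 1" t] fle[of "\<mu> + 2" t] \<mu>
      powr_ge_zero[of "\<mu> / a" \<mu>] powr_ge_zero[of "(\<mu> + 1) / a" "\<mu> + 1"] powr_ge_zero[of "(\<mu> + 2) / a" "\<mu> + 2"]
    unfolding C_def by linarith+
  note conv_facts = u0 one0 f0 fC fin
  have nn: "F1 t \<ge> 0" "F2 t \<ge> 0" "F3 t \<ge> 0" for t
    unfolding F1_def F2_def F3_def
    by (rule causal_convolution_nonneg[where C = C and l = 1]; use conv_facts in simp)+
  have cont: "continuous_on UNIV F1" "continuous_on UNIV F2" "continuous_on UNIV F3"
    unfolding F1_def F2_def F3_def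
    by (rule continuous_causal_convolution[where C = C and l = 1]; use conv_facts cf \<mu> in simp)+
  then have [measurable]: "F1 \<in> borel_measurable borel" "F2 \<in> borel_measurable borel" "F3 \<in> borel_measurable borel"
    by (auto intro: borel_measurable_continuous_onI)
  have LTF: "Laplace_nn F1 l = Laplace_nn u l * Laplace_nn (f \<mu>) l" "Laplace_nn F2 l = Laplace_nn one l * Laplace_nn (f (\<mu> + 1)) l" "Laplace_nn F3 l = Laplace_nn one l * Laplace_nn (f (\<mu> + 2)) l" for l
    unfolding F1_def F2_def F3_def
    by (rule Laplace_nn_causal_convolution[where C = C and l = 1]; use conv_facts in simp)+
  \<comment> \<open>the rate \<open>1 / 2\<close> leaves room below the weight \<open>exp (- t)\<close> of the uniqueness theorem\<close>
  have growth: "((\<lambda>t. exp (- t) * F t) \<longlongrightarrow> 0) at_top" if F: "\<And>t. F t \<ge> 0" "\<And>t. F t \<le> C * exp (1/2 * t) * B" for F B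
  proof (rule tendsto_sandwich[of "\<lambda>_. 0" _ _ "\<lambda>t. C * B * exp (- (1/2 * t))"])
    show "\<forall>\<^sub>F t in at_top. exp (- t) * F t \<le> C * B * exp (- (1/2 * t))"
    proof (rule always_eventually, rule allI)
      fix t :: real
      have "exp (- t) * F t \<le> exp (- t) * (C * exp (1/2 * t) * B)"
        using F(2)[of t] by (intro mult_left_mono) auto
      also have "\<dots> = C * B * (exp (- t) * exp (1/2 * t))" by (simp only: mult_ac)
      also have "\<dots> = C * B * exp (- (1/2 * t))" unfolding exp_add[symmetric] by simp
      finally show "exp (- t) * F t \<le> C * B * exp (- (1/2 * t))" .
    qed
    have "((\<lambda>t. exp (- (1/2 * t))) \<longlongrightarrow> (0::real)) at_top"
      by (intro filterlim_compose[OF exp_at_bot] filterlim_compose[OF filterlim_uminus_at_bot_at_top]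
          filterlim_tendsto_pos_mult_at_top[OF tendsto_const] filterlim_ident) auto
    then show "((\<lambda>t. C * B * exp (- (1/2 * t))) \<longlongrightarrow> 0) at_top" by (rule tendsto_mult_right_zero)
  qed (use F in auto)
  have gr: "((\<lambda>t. exp (- t) * F1 t) \<longlongrightarrow> 0) at_top" "((\<lambda>t. exp (- t) * F2 t) \<longlongrightarrow> 0) at_top"
     "((\<lambda>t. exp (- t) * F3 t) \<longlongrightarrow> 0) at_top"
  proof -
    show "((\<lambda>t. exp (- t) * F1 t) \<longlongrightarrow> 0) at_top"
      by (rule growth[OF nn(1)], unfold F1_def, rule causal_convolution_le; use conv_facts in simp)
    show "((\<lambda>t. exp (- t) * F2 t) \<longlongrightarrow> 0) at_top"
      by (rule growth[OF nn(2)], unfold F2_def, rule causal_convolution_le; use conv_facts in simp)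
    show "((\<lambda>t. exp (- t) * F3 t) \<longlongrightarrow> 0) at_top"
      by (rule growth[OF nn(3)], unfold F3_def, rule causal_convolution_le; use conv_facts in simp)
  qed
  \<comment> \<open>the difference of the two sides, to be shown to vanish\<close>
  define D where "D t = F1 t - G * (a * F3 t - \<mu> * F2 t)" for t
  have int: "set_integrable lborel {0<..} (\<lambda>t. exp (- l * t) * D t) \<and>
     (LINT t:{0<..}|lborel. exp (- l * t) * D t) = 0" if l: "l > 0" for l
  proof -
    define q where "q = l powr \<nu>"
    have q: "q > 0" using l by (simp add: q_def)
    obtain K where K: "\<And>p. p \<ge> 0 \<Longrightarrow> Laplace_nn (inverse_gamma_kernel a p) q = ennreal (K p)" "\<And>p. K p \<ge> 0"
      and rec: "q * K \<mu> + \<mu> * K (\<mu> + 1) = a * K (\<mu> + 2)"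
      using Laplace_nn_inverse_gamma_kernel_recurrence[OF a \<mu> q] by blast
    have LTf: "Laplace_nn (f p) l = ennreal (l powr (\<nu> - 1) * K p)" if "p \<ge> 0" for p
      unfolding f_def Laplace_nn_tilted_moment[OF a that l] K(1)[OF that, unfolded q_def] using K(2) by (simp add: ennreal_mult')
    define c1 where "c1 = G / l powr (1 - \<nu>) * (l powr (\<nu> - 1) * K \<mu>)"
    define c2 where "c2 = 1 / l * (l powr (\<nu> - 1) * K (\<mu> + 1))"
    define c3 where "c3 = 1 / l * (l powr (\<nu> - 1) * K (\<mu> + 2))"
    have c0: "c1 \<ge> 0" "c2 \<ge> 0" "c3 \<ge> 0" unfolding c1_def c2_def c3_def using G K(2) l by auto
    have L: "Laplace_nn F1 l = ennreal c1" "Laplace_nn F2 l = ennreal c2" "Laplace_nn F3 l = ennreal c3"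
      unfolding LTF c1_def c2_def c3_def using \<mu> l G K(2)
      by (simp_all add: LTf LTu LTone ennreal_mult[symmetric])
    have I: "set_integrable lborel {0<..} (\<lambda>t. exp (- l * t) * F1 t)" "(LINT t:{0<..}|lborel. exp (- l * t) * F1 t) = c1"
       "set_integrable lborel {0<..} (\<lambda>t. exp (- l * t) * F2 t)" "(LINT t:{0<..}|lborel. exp (- l * t) * F2 t) = c2"
       "set_integrable lborel {0<..} (\<lambda>t. exp (- l * t) * F3 t)" "(LINT t:{0<..}|lborel. exp (- l * t) * F3 t) = c3"
      using set_integral_of_Laplace_nn[OF _ nn(1) L(1) c0(1)] set_integral_of_Laplace_nn[OF _ nn(2) L(2) c0(2)]
        set_integral_of_Laplace_nn[OF _ nn(3) L(3) c0(3)] by auto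
    have D: "exp (- l * t) * D t = exp (- l * t) * F1 t - (G * a * (exp (- l * t) * F3 t) - G * \<mu> * (exp (- l * t) * F2 t))" for t
      by (simp add: D_def algebra_simps)
    have "c1 - (G * a * c3 - G * \<mu> * c2) = 0"
    proof -
      have "l powr (1 - \<nu>) = l / q" using l by (simp add: q_def powr_diff)
      then have "c1 = G * l powr (\<nu> - 1) / l * (q * K \<mu>)" by (simp add: c1_def)
      moreover have "G * a * c3 - G * \<mu> * c2 = G * l powr (\<nu> - 1) / l * (a * K (\<mu> + 2) - \<mu> * K (\<mu> + 1))"
        by (simp add: c2_def c3_def right_diff_distrib mult_ac)
      moreover have "a * K (\<mu> + 2) - \<mu> * K (\<mu> + 1) = q * K \<mu>" using rec by simp
      ultimately show ?thesis by simp
    qed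
    moreover have J: "set_integrable lborel {0<..} (\<lambda>t. G * a * (exp (- l * t) * F3 t) - G * \<mu> * (exp (- l * t) * F2 t))"
      "(LINT t:{0<..}|lborel. G * a * (exp (- l * t) * F3 t) - G * \<mu> * (exp (- l * t) * F2 t)) = G * a * c3 - G * \<mu> * c2"
      using set_integral_diff[OF set_integrable_mult_right[where a = "G * a", OF I(5)] set_integrable_mult_right[where a = "G * \<mu>", OF I(3)]]
      by (simp_all only: set_integral_mult_right I)
    ultimately show ?thesis
      unfolding D using set_integral_diff(1)[OF I(1) J(1)] set_integral_diff(2)[OF I(1) J(1), unfolded I(2) J(2)]
      by simp
  qed
  have "D t = 0"
  proof (rule continuous_eq_0_of_Laplace_eq_0[where D = D])
    show "continuous_on {0..} D"
      unfolding D_def[abs_def] using cont by (intro continuous_intros) (auto intro: continuous_on_subset)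
    have "((\<lambda>t. exp (- t) * F1 t - G * (a * (exp (- t) * F3 t) - \<mu> * (exp (- t) * F2 t))) \<longlongrightarrow> 0 - G * (a * 0 - \<mu> * 0)) at_top"
      by (intro tendsto_intros gr)
    then show "((\<lambda>t. exp (- t) * D t) \<longlongrightarrow> 0) at_top" by (simp add: D_def algebra_simps)
    show "set_integrable lborel {0<..} (\<lambda>t. exp (- t) * D t)" using int[of 1] by simp
  qed (use int t in auto)
  then show ?thesis
    by (simp add: D_def F1_def F2_def F3_def u_def[abs_def] one_def[abs_def] f_def G_def)
qed

lemma has_real_derivative_causal_convolution_powr_tilted_moment:
  assumes t: "t > 0"
  shows "(causal_convolution (\<lambda>s. s powr (- \<nu>)) (tilted_moment P \<nu> \<mu> a) has_real_derivative
    Gamma (1 - \<nu>) * (a * tilted_moment P \<nu> (\<mu> + 2) a t - \<mu> * tilted_moment P \<nu> (\<mu> + 1) a t)) (at t)"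
proof -
  have cf: "continuous_on UNIV (\<lambda>t. if t > 0 then tilted_moment P \<nu> p a t else 0)" if "p \<ge> 0" for p
    by (rule continuous_tilted_moment) (use that a \<nu> sets_P prob_space_axioms pos in auto)
  have "((\<lambda>t. Gamma (1 - \<nu>) * (a * causal_convolution (\<lambda>_. 1) (tilted_moment P \<nu> (\<mu> + 2) a) t - \<mu> * causal_convolution (\<lambda>_. 1) (tilted_moment P \<nu> (\<mu> + 1) a) t))
     has_real_derivative Gamma (1 - \<nu>) * (a * tilted_moment P \<nu> (\<mu> + 2) a t - \<mu> * tilted_moment P \<nu> (\<mu> + 1) a t)) (at t)"
    using has_real_derivative_causal_convolution_one[OF cf t] \<mu> by (intro DERIV_cmult DERIV_diff) auto
  then show ?thesis
    by (rule has_field_derivative_transform_within_open[where S = "{0<..}"]) (use t causal_convolution_powr_tilted_moment in auto)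
qed

lemma set_integrable_causal_convolution_powr_tilted_moment:
  "set_integrable lborel {0<..<t} (\<lambda>s. (t - s) powr (- \<nu>) * tilted_moment P \<nu> \<mu> a s)"
proof (rule set_integrable_causal_convolution)
  show "Laplace_nn (\<lambda>s. s powr (- \<nu>)) 1 < \<infinity>" using Laplace_nn_powr[of "- \<nu>" 1] \<nu>1 by simp
  show "tilted_moment P \<nu> \<mu> a s \<le> 1 + (\<mu> / a) powr \<mu>" for s
    using a \<mu> by (intro tilted_moment_le sets_P prob_space_axioms) auto
qed (use tilted_moment_measurable[OF sets_P prob_space_axioms] tilted_moment_nonneg in auto)

end
end

section \<open>The spatial operator and the kernel\<close>

text \<open>
  Dividing by the weight leaves a function of \<open>y powr \<gamma>\<close> alone.  Its derivative carries the Jacobian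
  \<open>\<gamma> * y powr (\<gamma> - 1)\<close>, and the power \<open>\<gamma> * \<mu> - \<gamma> + 1\<close> in the operator is the one that combines with it
  to \<open>y powr (\<gamma> * \<mu>)\<close>.
\<close>

lemma Gstar_of_profile:
  assumes \<gamma>: "\<gamma> \<noteq> 0" and x: "x > 0"
    and f: "\<And>y. y > 0 \<Longrightarrow> f y = c * y powr (\<gamma> * \<mu> - 1) * \<phi> (y powr \<gamma>)"
    and \<phi>: "\<And>a. a > 0 \<Longrightarrow> (\<phi> has_real_derivative \<phi>' a) (at a)"
    and \<phi>': "\<And>a. a > 0 \<Longrightarrow> (\<phi>' has_real_derivative \<phi>'' a) (at a)"
  shows "Gstar_exists \<gamma> \<mu> f x"
    and "Gstar \<gamma> \<mu> f x = c * x powr (\<gamma> * \<mu> - 1) * (\<mu> * \<phi>' (x powr \<gamma>) + x powr \<gamma> * \<phi>'' (x powr \<gamma>))"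
proof -
  define h where "h z = 1 / weight \<gamma> \<mu> z * f z" for z
  define W where "W y = y powr (\<gamma> * \<mu> - \<gamma> + 1) * deriv h y" for y
  have h: "h z = c * \<phi> (z powr \<gamma>)" if "z > 0" for z
    using that by (simp add: h_def weight_def f)
  have dh: "(h has_real_derivative c * (\<phi>' (y powr \<gamma>) * (\<gamma> * y powr (\<gamma> - 1)))) (at y)" if y: "y > 0" for y
  proof -
    have "((\<lambda>z. z powr \<gamma>) has_real_derivative \<gamma> * y powr (\<gamma> - 1)) (at y)"
      using y by (auto intro!: derivative_eq_intros)
    then have "((\<lambda>z. c * \<phi> (z powr \<gamma>)) has_real_derivative c * (\<phi>' (y powr \<gamma>) * (\<gamma> * y powr (\<gamma> - 1)))) (at y)"
      using y by (intro DERIV_cmult DERIV_chain2[OF \<phi>]) auto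
    then show ?thesis
      by (rule has_field_derivative_transform_within_open[where S = "{0<..}"]) (use y h in auto)
  qed
  have W: "W y = c * \<gamma> * y powr (\<gamma> * \<mu>) * \<phi>' (y powr \<gamma>)" if y: "y > 0" for y
  proof -
    have "y powr (\<gamma> * \<mu> - \<gamma> + 1) * y powr (\<gamma> - 1) = y powr (\<gamma> * \<mu>)"
      using y by (simp add: powr_add[symmetric])
    then show ?thesis
      unfolding W_def DERIV_imp_deriv[OF dh[OF y]] by (simp add: mult_ac)
  qed
  define d where "d = c * \<gamma> * ((\<gamma> * \<mu> * x powr (\<gamma> * \<mu> - 1)) * \<phi>' (x powr \<gamma>) + x powr (\<gamma> * \<mu>) * (\<phi>'' (x powr \<gamma>) * (\<gamma> * x powr (\<gamma> - 1))))"
  have dW: "(W has_real_derivative d) (at x)"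
  proof -
    have 1: "((\<lambda>z. z powr \<gamma>) has_real_derivative \<gamma> * x powr (\<gamma> - 1)) (at x)"
      using x by (auto intro!: derivative_eq_intros)
    have 2: "((\<lambda>z. z powr (\<gamma> * \<mu>)) has_real_derivative \<gamma> * \<mu> * x powr (\<gamma> * \<mu> - 1)) (at x)"
      using x by (auto intro!: derivative_eq_intros)
    have "((\<lambda>y. c * \<gamma> * (y powr (\<gamma> * \<mu>) * \<phi>' (y powr \<gamma>))) has_real_derivative d) (at x)"
      unfolding d_def using DERIV_mult[OF 2 DERIV_chain2[OF \<phi>' 1]] x
      by (intro DERIV_cmult) (simp add: algebra_simps)
    then show ?thesis
      by (rule has_field_derivative_transform_within_open[where S = "{0<..}"]) (use x W in auto)
  qed
  have "\<forall>\<^sub>F y in nhds x. y > 0"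
    using eventually_nhds_in_open[of "{0<..}" x] x by simp
  then have "\<forall>\<^sub>F y in nhds x. h field_differentiable at y"
    by eventually_elim (use dh in \<open>auto simp: field_differentiable_def\<close>)
  moreover have "W field_differentiable at x"
    using dW by (auto simp: field_differentiable_def)
  ultimately show "Gstar_exists \<gamma> \<mu> f x"
    by (simp add: Gstar_exists_def h_def[abs_def] W_def[abs_def])
  have "Gstar \<gamma> \<mu> f x = 1 / \<gamma>^2 * deriv W x"
    by (simp add: Gstar_def h_def[abs_def] W_def[abs_def])
  also have "\<dots> = 1 / \<gamma>^2 * d" using dW by (simp add: DERIV_imp_deriv)
  also have "\<dots> = c * x powr (\<gamma> * \<mu> - 1) * (\<mu> * \<phi>' (x powr \<gamma>) + x powr \<gamma> * \<phi>'' (x powr \<gamma>))"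
  proof -
    have "x powr (\<gamma> * \<mu>) * x powr (\<gamma> - 1) = x powr (\<gamma> * \<mu> - 1) * x powr \<gamma>"
      using x by (simp add: powr_add[symmetric]) (simp add: algebra_simps)
    then have "d = \<gamma>^2 * (c * x powr (\<gamma> * \<mu> - 1) * (\<mu> * \<phi>' (x powr \<gamma>) + x powr \<gamma> * \<phi>'' (x powr \<gamma>)))"
      unfolding d_def power2_eq_square by algebra
    then show ?thesis using \<gamma> by simp
  qed
  finally show "Gstar \<gamma> \<mu> f x = c * x powr (\<gamma> * \<mu> - 1) * (\<mu> * \<phi>' (x powr \<gamma>) + x powr \<gamma> * \<phi>'' (x powr \<gamma>))" .
qed

lemma gtilde_eq:
  assumes \<gamma>: "\<gamma> \<noteq> 0" and x: "x > 0" and s: "s > 0"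
  shows "gtilde \<gamma> \<mu> x s = \<bar>\<gamma>\<bar> / Gamma \<mu> * x powr (\<gamma> * \<mu> - 1) * ((1 / s) powr \<mu> * exp (- (x powr \<gamma>) * (1 / s)))"
proof -
  have e: "(x / s powr (1 / \<gamma>)) powr \<gamma> = x powr \<gamma> * (1 / s)"
    using x s \<gamma> by (simp add: powr_divide powr_powr)
  have "1 / s powr (1 / \<gamma>) * (x / s powr (1 / \<gamma>)) powr (\<gamma> * \<mu> - 1) = x powr (\<gamma> * \<mu> - 1) * (1 / s) powr \<mu>"
  proof -
    have "(s powr (1 / \<gamma>)) powr (\<gamma> * \<mu> - 1) = s powr (\<mu> - 1 / \<gamma>)"
      using \<gamma> by (simp add: powr_powr right_diff_distrib)
    also have "\<dots> = s powr \<mu> / s powr (1 / \<gamma>)" using s by (simp add: powr_diff)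
    finally have "(s powr (1 / \<gamma>)) powr (\<gamma> * \<mu> - 1) = s powr \<mu> / s powr (1 / \<gamma>)" .
    then show ?thesis using x s by (simp add: powr_divide)
  qed
  moreover have "gtilde \<gamma> \<mu> x s = (sgn \<gamma> * \<gamma>) / Gamma \<mu> *
     (1 / s powr (1 / \<gamma>) * (x / s powr (1 / \<gamma>)) powr (\<gamma> * \<mu> - 1)) * exp (- (x powr \<gamma> * (1 / s)))"
    unfolding gtilde_def g_def Q_def e by (simp add: mult_ac)
  moreover have "sgn \<gamma> * \<gamma> = \<bar>\<gamma>\<bar>" by (simp add: abs_sgn mult.commute)
  ultimately show ?thesis by (simp add: mult_ac)
qed

lemma gtilde_nonneg: "\<mu> > 0 \<Longrightarrow> \<gamma> \<noteq> 0 \<Longrightarrow> x > 0 \<Longrightarrow> s > 0 \<Longrightarrow> gtilde \<gamma> \<mu> x s \<ge> 0"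
  using Gamma_real_pos[of \<mu>] by (simp add: gtilde_eq)

text \<open>
  As a measure in \<open>x\<close>, the kernel at time \<open>s\<close> is the law of \<open>(s * G) powr (1 / \<gamma>)\<close> with \<open>G\<close> Gamma
  distributed: the substitution is \<open>v = x powr \<gamma> / s\<close>, for either sign of \<open>\<gamma>\<close>.
\<close>

lemma nn_integral_gtilde:
  assumes \<gamma>: "\<gamma> \<noteq> 0" and \<mu>: "\<mu> > 0" and s: "s > 0" and [measurable]: "F \<in> borel_measurable borel"
  shows "(\<integral>\<^sup>+x. indicator {0<..} x * (ennreal (gtilde \<gamma> \<mu> x s) * F x) \<partial>lborel) =
    (\<integral>\<^sup>+v. indicator {0<..} v * (ennreal (v powr (\<mu> - 1) * exp (- v) / Gamma \<mu>) * F ((s * v) powr (1 / \<gamma>))) \<partial>lborel)"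
proof -
  have G: "Gamma \<mu> > 0" using \<mu> by (rule Gamma_real_pos)
  \<comment> \<open>the density of \<open>s * G\<close>, times the test function in the variable \<open>w = x powr \<gamma>\<close>\<close>
  define f where "f w = ennreal (w powr (\<mu> - 1) * exp (- w / s) / (Gamma \<mu> * s powr \<mu>)) * F (w powr (1 / \<gamma>))" for w
  have [measurable]: "f \<in> borel_measurable borel" unfolding f_def by measurable
  have "(\<integral>\<^sup>+x. indicator {0<..} x * (ennreal (gtilde \<gamma> \<mu> x s) * F x) \<partial>lborel) =
     (\<integral>\<^sup>+x. indicator {0<..} x * (ennreal (\<bar>\<gamma>\<bar> * x powr (\<gamma> - 1)) * f (x powr \<gamma>)) \<partial>lborel)"
  proof (rule nn_integral_cong)
    fix x :: real
    show "indicator {0<..} x * (ennreal (gtilde \<gamma> \<mu> x s) * F x) =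
      indicator {0<..} x * (ennreal (\<bar>\<gamma>\<bar> * x powr (\<gamma> - 1)) * f (x powr \<gamma>))"
    proof (cases "x > 0")
      case True
      have e: "x powr (\<gamma> - 1) * (x powr \<gamma>) powr (\<mu> - 1) = x powr (\<gamma> * \<mu> - 1)"
        using True by (simp add: powr_powr powr_add[symmetric] algebra_simps)
      have "gtilde \<gamma> \<mu> x s = \<bar>\<gamma>\<bar> / Gamma \<mu> * (x powr (\<gamma> - 1) * (x powr \<gamma>) powr (\<mu> - 1)) * ((1 / s) powr \<mu> * exp (- (x powr \<gamma>) * (1 / s)))"
        unfolding e by (rule gtilde_eq[OF \<gamma> True s])
      also have "\<dots> = (\<bar>\<gamma>\<bar> * x powr (\<gamma> - 1)) * ((x powr \<gamma>) powr (\<mu> - 1) * exp (- (x powr \<gamma>) / s) / (Gamma \<mu> * s powr \<mu>))"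
        using s by (simp add: powr_divide field_simps)
      finally have "gtilde \<gamma> \<mu> x s = (\<bar>\<gamma>\<bar> * x powr (\<gamma> - 1)) * ((x powr \<gamma>) powr (\<mu> - 1) * exp (- (x powr \<gamma>) / s) / (Gamma \<mu> * s powr \<mu>))" .
      then have "ennreal (gtilde \<gamma> \<mu> x s) = ennreal (\<bar>\<gamma>\<bar> * x powr (\<gamma> - 1)) *
          ennreal ((x powr \<gamma>) powr (\<mu> - 1) * exp (- (x powr \<gamma>) / s) / (Gamma \<mu> * s powr \<mu>))"
        by (simp only: ennreal_mult' mult_nonneg_nonneg abs_ge_zero powr_ge_zero)
      moreover have "(x powr \<gamma>) powr (1 / \<gamma>) = x" using True \<gamma> by (simp add: powr_powr)
      ultimately show ?thesis
        by (simp only: f_def mult.assoc)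
    qed simp
  qed
  also have "\<dots> = (\<integral>\<^sup>+w. indicator {0<..} w * f w \<partial>lborel)"
    by (rule nn_integral_powr_substitution) (use \<gamma> in auto)
  also have "\<dots> = ennreal s * (\<integral>\<^sup>+v. indicator {0<..} v * f (s * v) \<partial>lborel)"
    by (rule nn_integral_scale) (use s in auto)
  also have "\<dots> = (\<integral>\<^sup>+v. ennreal s * (indicator {0<..} v * f (s * v)) \<partial>lborel)"
    by (rule nn_integral_cmult[symmetric]) measurable
  also have "\<dots> = (\<integral>\<^sup>+v. indicator {0<..} v * (ennreal (v powr (\<mu> - 1) * exp (- v) / Gamma \<mu>) * F ((s * v) powr (1 / \<gamma>))) \<partial>lborel)"
  proof (rule nn_integral_cong)
    fix v :: real
    show "ennreal s * (indicator {0<..} v * f (s * v)) =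
      indicator {0<..} v * (ennreal (v powr (\<mu> - 1) * exp (- v) / Gamma \<mu>) * F ((s * v) powr (1 / \<gamma>)))"
    proof (cases "v > 0")
      case True
      have "s * ((s * v) powr (\<mu> - 1) * exp (- (s * v) / s) / (Gamma \<mu> * s powr \<mu>)) = v powr (\<mu> - 1) * exp (- v) / Gamma \<mu>"
        using s True by (simp add: powr_mult powr_diff field_simps)
      then show ?thesis
        using True s by (simp add: f_def mult.assoc[symmetric] ennreal_mult'[symmetric])
    qed simp
  qed
  finally show ?thesis .
qed

definition Gamma_law :: "real \<Rightarrow> real measure" where
  "Gamma_law \<mu> = density lborel (\<lambda>v. indicator {0<..} v * ennreal (v powr (\<mu> - 1) * exp (- v) / Gamma \<mu>))"

lemma sets_Gamma_law [measurable_cong, simp]: "sets (Gamma_law \<mu>) = sets borel"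
  by (simp add: Gamma_law_def)

lemma prob_space_Gamma_law:
  assumes "\<mu> > 0" shows "prob_space (Gamma_law \<mu>)"
proof
  have G: "Gamma \<mu> > 0" using assms by (rule Gamma_real_pos)
  have "emeasure (Gamma_law \<mu>) (space (Gamma_law \<mu>)) = (\<integral>\<^sup>+v. indicator {0<..} v * ennreal (v powr (\<mu> - 1) * exp (- v) / Gamma \<mu>) \<partial>lborel)"
    by (simp add: Gamma_law_def emeasure_density)
  also have "\<dots> = (\<integral>\<^sup>+v. ennreal (1 / Gamma \<mu>) * (indicator {0<..} v * ennreal (v powr (\<mu> - 1) * exp (- 1 * v))) \<partial>lborel)"
    using G by (intro nn_integral_cong) (auto simp: indicator_def ennreal_mult'[symmetric])
  also have "\<dots> = ennreal (1 / Gamma \<mu>) * (\<integral>\<^sup>+v. (indicator {0<..} v * ennreal (v powr (\<mu> - 1) * exp (- 1 * v))) \<partial>lborel)"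
    by (rule nn_integral_cmult) measurable
  also have "\<dots> = 1"
    using nn_integral_Gamma_scaled[OF assms, of 1] G by (simp add: ennreal_mult'[symmetric])
  finally show "emeasure (Gamma_law \<mu>) (space (Gamma_law \<mu>)) = 1" .
qed

lemma AE_Gamma_law_pos: "AE v in Gamma_law \<mu>. v > 0"
  unfolding Gamma_law_def by (subst AE_density) (auto simp: indicator_def)

section \<open>Mixtures of the kernel over a stable law\<close>

context stable_law
begin

context
  fixes \<gamma> \<mu> :: real and u :: "real \<Rightarrow> real \<Rightarrow> real"
  assumes \<gamma>: "\<gamma> \<noteq> 0" and \<mu>: "\<mu> > 0"
    and u: "\<And>x t. x > 0 \<Longrightarrow> t > 0 \<Longrightarrow> u x t = (\<integral>y. gtilde \<gamma> \<mu> x ((t / y) powr \<nu>) \<partial>P)"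
begin

lemma gtilde_subordinated:
  assumes x: "x > 0" and t: "t > 0" and y: "y > 0"
  shows "gtilde \<gamma> \<mu> x ((t / y) powr \<nu>) = \<bar>\<gamma>\<bar> / Gamma \<mu> * x powr (\<gamma> * \<mu> - 1) *
    (((y / t) powr \<nu>) powr \<mu> * exp (- (x powr \<gamma>) * (y / t) powr \<nu>))"
proof -
  have "1 / (t / y) powr \<nu> = (y / t) powr \<nu>"
    using t y by (simp add: powr_divide)
  then show ?thesis
    using gtilde_eq[OF \<gamma> x, of "(t / y) powr \<nu>"] t y by simp
qed

lemma mixture_eq_tilted_moment:
  assumes x: "x > 0" and t: "t > 0"
  shows "u x t = \<bar>\<gamma>\<bar> / Gamma \<mu> * x powr (\<gamma> * \<mu> - 1) * tilted_moment P \<nu> \<mu> (x powr \<gamma>) t"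
proof -
  have "u x t = (\<integral>y. \<bar>\<gamma>\<bar> / Gamma \<mu> * x powr (\<gamma> * \<mu> - 1) *
    (((y / t) powr \<nu>) powr \<mu> * exp (- (x powr \<gamma>) * (y / t) powr \<nu>)) \<partial>P)"
    unfolding u[OF x t]
  proof (rule integral_cong_AE)
    show "AE y in P. gtilde \<gamma> \<mu> x ((t / y) powr \<nu>) = \<bar>\<gamma>\<bar> / Gamma \<mu> * x powr (\<gamma> * \<mu> - 1) *
        (((y / t) powr \<nu>) powr \<mu> * exp (- (x powr \<gamma>) * (y / t) powr \<nu>))"
      using pos by eventually_elim (rule gtilde_subordinated[OF x t])
    show "(\<lambda>y. gtilde \<gamma> \<mu> x ((t / y) powr \<nu>)) \<in> borel_measurable P"
      unfolding gtilde_def g_def Q_def by measurable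
  qed measurable
  then show ?thesis by (simp add: tilted_moment_def)
qed

text \<open>
  Two derivatives of the tilted moment in \<open>a\<close> raise its order twice and change the sign twice.
\<close>

lemma Gstar_mixture:
  assumes x: "x > 0" and t: "t > 0"
  shows "Gstar_exists \<gamma> \<mu> (\<lambda>y. u y t) x"
    and "Gstar \<gamma> \<mu> (\<lambda>y. u y t) x = \<bar>\<gamma>\<bar> / Gamma \<mu> * x powr (\<gamma> * \<mu> - 1) *
      (x powr \<gamma> * tilted_moment P \<nu> (\<mu> + 2) (x powr \<gamma>) t - \<mu> * tilted_moment P \<nu> (\<mu> + 1) (x powr \<gamma>) t)"
proof -
  note d = has_real_derivative_tilted_moment[OF sets_P prob_space_axioms]
  have d1: "((\<lambda>a. tilted_moment P \<nu> \<mu> a t) has_real_derivative - tilted_moment P \<nu> (\<mu> + 1) a t) (at a)" if "a > 0" for a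
    using that \<mu> by (intro d) auto
  have d2: "((\<lambda>a. - tilted_moment P \<nu> (\<mu> + 1) a t) has_real_derivative tilted_moment P \<nu> (\<mu> + 2) a t) (at a)" if "a > 0" for a
  proof -
    have "\<mu> + 1 + 1 = \<mu> + 2" by simp
    then show ?thesis
      using DERIV_minus[OF d[of a "\<mu> + 1" \<nu> t]] that \<mu> by (simp only: minus_minus)
  qed
  note G = Gstar_of_profile[where f = "\<lambda>y. u y t" and c = "\<bar>\<gamma>\<bar> / Gamma \<mu>" and \<mu> = \<mu>
    and \<phi> = "\<lambda>a. tilted_moment P \<nu> \<mu> a t" and \<phi>' = "\<lambda>a. - tilted_moment P \<nu> (\<mu> + 1) a t" and \<phi>'' = "\<lambda>a. tilted_moment P \<nu> (\<mu> + 2) a t",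
    OF \<gamma> x mixture_eq_tilted_moment[OF _ t] d1 d2]
  show "Gstar_exists \<gamma> \<mu> (\<lambda>y. u y t) x" by (rule G(1))
  have "Gstar \<gamma> \<mu> (\<lambda>y. u y t) x = \<bar>\<gamma>\<bar> / Gamma \<mu> * x powr (\<gamma> * \<mu> - 1) *
      (\<mu> * (- tilted_moment P \<nu> (\<mu> + 1) (x powr \<gamma>) t) + x powr \<gamma> * tilted_moment P \<nu> (\<mu> + 2) (x powr \<gamma>) t)"
    by (rule G(2))
  also have "\<mu> * (- tilted_moment P \<nu> (\<mu> + 1) (x powr \<gamma>) t) + x powr \<gamma> * tilted_moment P \<nu> (\<mu> + 2) (x powr \<gamma>) t =
      x powr \<gamma> * tilted_moment P \<nu> (\<mu> + 2) (x powr \<gamma>) t - \<mu> * tilted_moment P \<nu> (\<mu> + 1) (x powr \<gamma>) t"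
    by simp
  finally show "Gstar \<gamma> \<mu> (\<lambda>y. u y t) x = \<bar>\<gamma>\<bar> / Gamma \<mu> * x powr (\<gamma> * \<mu> - 1) *
      (x powr \<gamma> * tilted_moment P \<nu> (\<mu> + 2) (x powr \<gamma>) t - \<mu> * tilted_moment P \<nu> (\<mu> + 1) (x powr \<gamma>) t)" .
qed

text \<open>
  The explicit factor in front of the tilted moment does not depend on time, so both sides are this
  factor times the derivative of the integrated identity.
\<close>

lemma fractional_equation:
  assumes x: "x > 0" and t: "t > 0" and \<nu>1: "\<nu> < 1"
  shows "RL_deriv_exists \<nu> (\<lambda>\<tau>. u x \<tau>) t"
    and "RL_deriv \<nu> (\<lambda>\<tau>. u x \<tau>) t = Gstar \<gamma> \<mu> (\<lambda>y. u y t) x"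
proof -
  define c where "c = \<bar>\<gamma>\<bar> / Gamma \<mu> * x powr (\<gamma> * \<mu> - 1)"
  define a where "a = x powr \<gamma>"
  have a: "a > 0" using x by (simp add: a_def)
  have u': "u x s = c * tilted_moment P \<nu> \<mu> a s" if "s > 0" for s
    using mixture_eq_tilted_moment[OF x that] by (simp add: c_def a_def)
  have int: "set_integrable lborel {0<..<\<tau>} (\<lambda>s. (\<tau> - s) powr (- \<nu>) * u x s)" for \<tau>
  proof -
    have "set_integrable lborel {0<..<\<tau>} (\<lambda>s. c * ((\<tau> - s) powr (- \<nu>) * tilted_moment P \<nu> \<mu> a s))"
      using set_integrable_causal_convolution_powr_tilted_moment[OF a \<mu> \<nu>1] by (rule set_integrable_mult_right)
    also have "?this \<longleftrightarrow> ?thesis"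
      by (rule set_integrable_cong) (auto simp: u')
    finally show ?thesis .
  qed
  define J where "J \<tau> = (LINT s:{0<..<\<tau>}|lborel. (\<tau> - s) powr (- \<nu>) * u x s)" for \<tau>
  have J: "J \<tau> = c * causal_convolution (\<lambda>s. s powr (- \<nu>)) (tilted_moment P \<nu> \<mu> a) \<tau>" for \<tau>
  proof -
    have "J \<tau> = (LINT s:{0<..<\<tau>}|lborel. c * ((\<tau> - s) powr (- \<nu>) * tilted_moment P \<nu> \<mu> a s))"
      unfolding J_def by (rule set_lebesgue_integral_cong) (auto simp: u')
    then show ?thesis by (simp add: causal_convolution_def)
  qed
  define v where "v = a * tilted_moment P \<nu> (\<mu> + 2) a t - \<mu> * tilted_moment P \<nu> (\<mu> + 1) a t"
  have dJ: "(J has_real_derivative c * (Gamma (1 - \<nu>) * v)) (at t)"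
    unfolding J[abs_def] v_def by (intro DERIV_cmult has_real_derivative_causal_convolution_powr_tilted_moment a \<mu> \<nu>1 t)
  show "RL_deriv_exists \<nu> (\<lambda>\<tau>. u x \<tau>) t"
    using int dJ \<nu>1 unfolding RL_deriv_exists_def J_def[abs_def]
    by (auto simp: field_differentiable_def)
  have "Gamma (1 - \<nu>) > 0" using \<nu>1 by (intro Gamma_real_pos) simp
  then have "1 / Gamma (1 - \<nu>) * deriv J t = c * v"
    unfolding DERIV_imp_deriv[OF dJ] by simp
  then show "RL_deriv \<nu> (\<lambda>\<tau>. u x \<tau>) t = Gstar \<gamma> \<mu> (\<lambda>y. u y t) x"
    unfolding Gstar_mixture(2)[OF x t] using \<nu>1
    by (simp add: RL_deriv_def J_def[abs_def] v_def c_def a_def)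
qed

text \<open>
  On the product of the stable and the Gamma law, the random variable with density \<open>u (\<cdot>, t)\<close>.
\<close>

definition mixed_power :: "real \<Rightarrow> real \<times> real \<Rightarrow> real" where
  "mixed_power t = (\<lambda>(y, v). ((t / y) powr \<nu> * v) powr (1 / \<gamma>))"

lemma mixed_power_measurable [measurable]: "mixed_power t \<in> borel_measurable (P \<Otimes>\<^sub>M Gamma_law \<mu>)"
  unfolding mixed_power_def by measurable

lemma mixture_measurable: "(\<lambda>x. indicator {0<..} x * u x t) \<in> borel_measurable borel" if t: "t > 0"
proof -
  have "(\<lambda>x. indicator {0<..} x * u x t) = (\<lambda>x. indicator {0<..} x * (\<bar>\<gamma>\<bar> / Gamma \<mu> * x powr (\<gamma> * \<mu> - 1) * tilted_moment P \<nu> \<mu> (x powr \<gamma>) t))"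
    using t by (auto simp: indicator_def mixture_eq_tilted_moment)
  also have "\<dots> \<in> borel_measurable borel"
    unfolding tilted_moment_def by measurable
  finally show ?thesis .
qed

lemma mixture_nonneg: "x > 0 \<Longrightarrow> t > 0 \<Longrightarrow> u x t \<ge> 0"
  using Gamma_real_pos[OF \<mu>] by (simp add: mixture_eq_tilted_moment tilted_moment_nonneg)

text \<open>
  Tonelli and, for fixed \<open>y\<close>, the Gamma representation of the kernel at time \<open>(t / y) powr \<nu>\<close>.
\<close>

lemma density_mixture_eq_distr:
  assumes t: "t > 0"
  shows "density lborel (\<lambda>x. ennreal (indicator {0<..} x * u x t)) = distr (P \<Otimes>\<^sub>M Gamma_law \<mu>) borel (mixed_power t)"
proof (rule measure_eqI)
  interpret \<Gamma>: prob_space "Gamma_law \<mu>" using \<mu> by (rule prob_space_Gamma_law)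
  interpret LP: pair_sigma_finite lborel P
    by (simp add: pair_sigma_finite_def sigma_finite_measure_axioms lborel.sigma_finite_measure_axioms)
  have [measurable]: "(\<lambda>x. indicator {0<..} x * u x t) \<in> borel_measurable borel" by (rule mixture_measurable[OF t])
  have [measurable]: "(\<lambda>z. gtilde \<gamma> \<mu> (fst z) ((t / snd z) powr \<nu>)) \<in> borel_measurable (lborel \<Otimes>\<^sub>M P)"
    unfolding gtilde_def g_def Q_def by measurable
  fix A assume "A \<in> sets (density lborel (\<lambda>x. ennreal (indicator {0<..} x * u x t)))"
  then have A[measurable]: "A \<in> sets borel" by simp
  have "emeasure (density lborel (\<lambda>x. ennreal (indicator {0<..} x * u x t))) A =
    (\<integral>\<^sup>+x. ennreal (indicator {0<..} x * u x t) * indicator A x \<partial>lborel)"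
    by (simp add: emeasure_density)
  also have "\<dots> = (\<integral>\<^sup>+x. \<integral>\<^sup>+y. indicator {0<..} x * (ennreal (gtilde \<gamma> \<mu> x ((t / y) powr \<nu>)) * indicator A x) \<partial>P \<partial>lborel)"
  proof (rule nn_integral_cong)
    fix x :: real
    show "ennreal (indicator {0<..} x * u x t) * indicator A x =
      (\<integral>\<^sup>+y. indicator {0<..} x * (ennreal (gtilde \<gamma> \<mu> x ((t / y) powr \<nu>)) * indicator A x) \<partial>P)"
    proof (cases "x > 0")
      case True
      have "(\<integral>\<^sup>+y. ennreal (gtilde \<gamma> \<mu> x ((t / y) powr \<nu>)) \<partial>P) = ennreal (u x t)"
        unfolding u[OF True t]
      proof (rule nn_integral_eq_integral)
        have "integrable P (\<lambda>y. \<bar>\<gamma>\<bar> / Gamma \<mu> * x powr (\<gamma> * \<mu> - 1) *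
            (((y / t) powr \<nu>) powr \<mu> * exp (- (x powr \<gamma>) * (y / t) powr \<nu>)))"
          using True \<mu> by (intro integrable_mult_right integrable_powr_mult_exp finite_measure_axioms) auto
        moreover have "AE y in P. \<bar>\<gamma>\<bar> / Gamma \<mu> * x powr (\<gamma> * \<mu> - 1) *
            (((y / t) powr \<nu>) powr \<mu> * exp (- (x powr \<gamma>) * (y / t) powr \<nu>)) = gtilde \<gamma> \<mu> x ((t / y) powr \<nu>)"
          using pos by eventually_elim (rule gtilde_subordinated[OF True t, symmetric])
        ultimately show "integrable P (\<lambda>y. gtilde \<gamma> \<mu> x ((t / y) powr \<nu>))"
          by (subst integrable_cong_AE[symmetric]) (auto simp: gtilde_def g_def Q_def)
        show "AE y in P. 0 \<le> gtilde \<gamma> \<mu> x ((t / y) powr \<nu>)"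
          using pos by eventually_elim (use gtilde_nonneg[OF \<mu> \<gamma> True] t in auto)
      qed
      moreover have "(\<integral>\<^sup>+y. ennreal (gtilde \<gamma> \<mu> x ((t / y) powr \<nu>)) * indicator A x \<partial>P) =
         (\<integral>\<^sup>+y. ennreal (gtilde \<gamma> \<mu> x ((t / y) powr \<nu>)) \<partial>P) * indicator A x"
        by (rule nn_integral_multc) (simp add: gtilde_def g_def Q_def)
      ultimately show ?thesis using True by simp
    qed simp
  qed
  also have "\<dots> = (\<integral>\<^sup>+y. \<integral>\<^sup>+x. indicator {0<..} x * (ennreal (gtilde \<gamma> \<mu> x ((t / y) powr \<nu>)) * indicator A x) \<partial>lborel \<partial>P)"
    by (rule LP.Fubini'[symmetric]) measurable
  also have "\<dots> = (\<integral>\<^sup>+y. \<integral>\<^sup>+v. indicator A (mixed_power t (y, v)) \<partial>Gamma_law \<mu> \<partial>P)"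
  proof (rule nn_integral_cong_AE)
    show "AE y in P. (\<integral>\<^sup>+x. indicator {0<..} x * (ennreal (gtilde \<gamma> \<mu> x ((t / y) powr \<nu>)) * indicator A x) \<partial>lborel) =
      (\<integral>\<^sup>+v. indicator A (mixed_power t (y, v)) \<partial>Gamma_law \<mu>)"
      using pos
    proof eventually_elim
      case (elim y)
      have "(\<integral>\<^sup>+v. indicator A (mixed_power t (y, v)) \<partial>Gamma_law \<mu>) =
        (\<integral>\<^sup>+v. (indicator {0<..} v * ennreal (v powr (\<mu> - 1) * exp (- v) / Gamma \<mu>)) * indicator A (mixed_power t (y, v)) \<partial>lborel)"
        unfolding Gamma_law_def mixed_power_def by (subst nn_integral_density) auto
      then show ?case
        using nn_integral_gtilde[OF \<gamma> \<mu>, of "(t / y) powr \<nu>" "indicator A"] t elim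
        by (simp add: mixed_power_def mult.assoc)
    qed
  qed
  also have "\<dots> = (\<integral>\<^sup>+z. indicator A (mixed_power t z) \<partial>(P \<Otimes>\<^sub>M Gamma_law \<mu>))"
    by (subst \<Gamma>.nn_integral_fst[symmetric]) auto
  also have "\<dots> = (\<integral>\<^sup>+z. indicator A z \<partial>distr (P \<Otimes>\<^sub>M Gamma_law \<mu>) borel (mixed_power t))"
    by (subst nn_integral_distr) auto
  also have "\<dots> = emeasure (distr (P \<Otimes>\<^sub>M Gamma_law \<mu>) borel (mixed_power t)) A"
    by (rule nn_integral_indicator) simp
  finally show "emeasure (density lborel (\<lambda>x. ennreal (indicator {0<..} x * u x t))) A = emeasure (distr (P \<Otimes>\<^sub>M Gamma_law \<mu>) borel (mixed_power t)) A" .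
qed simp

text \<open>
  In the product representation the measure does not depend on \<open>t\<close>, and the argument of \<open>\<phi>\<close> is
  \<open>w powr (1 / \<gamma>)\<close> with \<open>w\<close> tending to 0 from the right almost surely.  The limit hypothesis is stated
  in this variable to treat both signs of \<open>\<gamma>\<close> at once.
\<close>

lemma weak_limit_mixture:
  assumes \<phi>c: "continuous_on {0<..} \<phi>" and \<phi>B: "bounded (\<phi> ` {0<..})"
    and lim: "((\<lambda>w. \<phi> (w powr (1 / \<gamma>))) \<longlongrightarrow> c) (at_right 0)"
  shows "\<forall>t>0. set_integrable lborel {0<..} (\<lambda>x. \<phi> x * u x t)"
    and "((\<lambda>t. LINT x:{0<..}|lborel. \<phi> x * u x t) \<longlongrightarrow> c) (at_right 0)"
proof -
  interpret \<Gamma>: prob_space "Gamma_law \<mu>" using \<mu> by (rule prob_space_Gamma_law)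
  interpret N: pair_prob_space P "Gamma_law \<mu>" ..
  define N where "N = P \<Otimes>\<^sub>M Gamma_law \<mu>"
  interpret NN: prob_space N unfolding N_def by (rule N.prob_space_axioms)
  define \<psi> where "\<psi> x = indicator {0<..} x * \<phi> x" for x :: real
  have \<psi>[measurable]: "\<psi> \<in> borel_measurable borel"
    unfolding \<psi>_def using borel_measurable_continuous_on_indicator[OF _ \<phi>c] by simp
  obtain B where B: "\<And>x. x > 0 \<Longrightarrow> \<bar>\<phi> x\<bar> \<le> B"
    using \<phi>B unfolding bounded_iff by auto
  have \<psi>B: "\<bar>\<psi> x\<bar> \<le> \<bar>B\<bar>" for x using B[of x] by (auto simp: \<psi>_def indicator_def)
  have [measurable]: "mixed_power t \<in> borel_measurable N" for t unfolding N_def by measurable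
  have int: "integrable N (\<lambda>z. \<psi> (mixed_power t z))" for t
    by (rule NN.integrable_const_bound[where B = "\<bar>B\<bar>"]) (use \<psi>B in auto)
  have eq: "(\<lambda>x. indicator {0<..} x *\<^sub>R (\<phi> x * u x t)) = (\<lambda>x. indicator {0<..} x * u x t * \<psi> x)" for t
    by (auto simp: \<psi>_def indicator_def)
  note D = density_mixture_eq_distr[folded N_def]
  have nn: "AE x in lborel. 0 \<le> indicator {0<..} x * u x t" if "t > 0" for t
    using that by (auto simp: indicator_def mixture_nonneg)
  note um = mixture_measurable
  show "\<forall>t>0. set_integrable lborel {0<..} (\<lambda>x. \<phi> x * u x t)"
  proof (intro allI impI)
    fix t :: real assume t: "t > 0"
    have "integrable (distr N borel (mixed_power t)) \<psi>"
      by (subst integrable_distr_eq) (use int in auto)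
    then have "integrable lborel (\<lambda>x. (indicator {0<..} x * u x t) *\<^sub>R \<psi> x)"
      unfolding D[OF t, symmetric]
      by (subst (asm) integrable_density) (use um[OF t] nn[OF t] in auto)
    then show "set_integrable lborel {0<..} (\<lambda>x. \<phi> x * u x t)"
      unfolding set_integrable_def eq by simp
  qed
  have val: "(LINT x:{0<..}|lborel. \<phi> x * u x t) = (\<integral>z. \<psi> (mixed_power t z) \<partial>N)" if t: "t > 0" for t
  proof -
    have "(LINT x:{0<..}|lborel. \<phi> x * u x t) = (\<integral>x. (indicator {0<..} x * u x t) *\<^sub>R \<psi> x \<partial>lborel)"
      unfolding set_lebesgue_integral_def eq by simp
    also have "\<dots> = (\<integral>x. \<psi> x \<partial>distr N borel (mixed_power t))"
      unfolding D[OF t, symmetric] by (subst integral_density) (use um[OF t] nn[OF t] in auto)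
    also have "\<dots> = (\<integral>z. \<psi> (mixed_power t z) \<partial>N)" by (subst integral_distr) auto
    finally show ?thesis .
  qed
  have "((\<lambda>t. \<integral>z. \<psi> (mixed_power t z) \<partial>N) \<longlongrightarrow> (\<integral>z. c \<partial>N)) (at_right 0)"
  proof (rule tendsto_integral_at_within[where w = "\<lambda>_. \<bar>B\<bar>"])
    have "AE z in N. fst z > 0 \<and> snd z > 0"
      unfolding N_def
    proof (rule N.AE_pair_measure)
      show "AE y in P. AE v in Gamma_law \<mu>. fst (y, v) > 0 \<and> snd (y, v) > 0"
        using pos by eventually_elim (use AE_Gamma_law_pos in \<open>auto elim: eventually_mono\<close>)
    qed measurable
    then show "AE z in N. ((\<lambda>t. \<psi> (mixed_power t z)) \<longlongrightarrow> c) (at_right 0)"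
    proof eventually_elim
      case (elim z)
      then obtain y v where z: "z = (y, v)" "y > 0" "v > 0" by (cases z) auto
      have w: "filterlim (\<lambda>t. (t / y) powr \<nu> * v) (at_right 0) (at_right 0)"
        unfolding filterlim_at
      proof
        show "\<forall>\<^sub>F t in at_right 0. (t / y) powr \<nu> * v \<in> {0<..} \<and> (t / y) powr \<nu> * v \<noteq> 0"
          using eventually_at_right_less[of 0] by eventually_elim (use z in auto)
        have "((\<lambda>t. (t / y) powr \<nu> * v) \<longlongrightarrow> (0 / y) powr \<nu> * v) (at_right 0)"
          by (intro tendsto_intros tendsto_powr') (use z \<nu> in \<open>auto simp: eventually_at_filter\<close>)
        then show "((\<lambda>t. (t / y) powr \<nu> * v) \<longlongrightarrow> 0) (at_right 0)" using \<nu> by simp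
      qed
      have "\<forall>\<^sub>F t in at_right 0. \<phi> (((t / y) powr \<nu> * v) powr (1 / \<gamma>)) = \<psi> (mixed_power t z)"
        using eventually_at_right_less[of 0] by eventually_elim (use z in \<open>auto simp: \<psi>_def mixed_power_def\<close>)
      with filterlim_compose[OF lim w] show ?case by (rule Lim_transform_eventually)
    qed
  qed (use \<psi>B in auto)
  moreover have "(\<integral>z. c \<partial>N) = c" by (simp add: NN.prob_space)
  ultimately have l: "((\<lambda>t. \<integral>z. \<psi> (mixed_power t z) \<partial>N) \<longlongrightarrow> c) (at_right 0)" by (simp only:)
  show "((\<lambda>t. LINT x:{0<..}|lborel. \<phi> x * u x t) \<longlongrightarrow> c) (at_right 0)"
    by (rule Lim_transform_eventually[OF l])
      (use eventually_at_right_less[of 0] in eventually_elim, simp add: val)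
qed

lemma initial_bounded_continuous: "initial_delta bounded_continuous_tests u" if "\<gamma> > 0"
  unfolding initial_delta_def
proof
  fix \<phi> assume "\<phi> \<in> bounded_continuous_tests"
  then have \<phi>: "continuous_on {0..} \<phi>" "bounded (\<phi> ` {0..})" by (auto simp: bounded_continuous_tests_def)
  have "filterlim (\<lambda>w. w powr (1 / \<gamma>)) (at 0 within {0..}) (at_right 0)"
    unfolding filterlim_at
  proof
    show "\<forall>\<^sub>F w in at_right 0. w powr (1 / \<gamma>) \<in> {0..} \<and> w powr (1 / \<gamma>) \<noteq> 0"
      using eventually_at_right_less[of 0] by eventually_elim auto
    have "((\<lambda>w. w powr (1 / \<gamma>)) \<longlongrightarrow> 0 powr (1 / \<gamma>)) (at_right (0::real))"
      by (intro tendsto_intros tendsto_powr') (use that in \<open>auto simp: eventually_at_filter\<close>)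
    then show "((\<lambda>w. w powr (1 / \<gamma>)) \<longlongrightarrow> 0) (at_right (0::real))" by simp
  qed
  moreover have "(\<phi> \<longlongrightarrow> \<phi> 0) (at 0 within {0..})"
    using \<phi>(1) by (simp add: continuous_on_def)
  ultimately have "((\<lambda>w. \<phi> (w powr (1 / \<gamma>))) \<longlongrightarrow> \<phi> 0) (at_right 0)"
    by (rule filterlim_compose[rotated])
  moreover have "continuous_on {0<..} \<phi>" using \<phi>(1) by (rule continuous_on_subset) auto
  moreover have "bounded (\<phi> ` {0<..})" using \<phi>(2) by (rule bounded_subset) auto
  ultimately show "(\<forall>t>0. set_integrable lborel {0<..} (\<lambda>x. \<phi> x * u x t)) \<and>
      ((\<lambda>t. LINT x:{0<..}|lborel. \<phi> x * u x t) \<longlongrightarrow> \<phi> 0) (at_right 0)"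
    using weak_limit_mixture by blast
qed

lemma initial_at_infinity: "initial_delta_at_infinity u" if "\<gamma> < 0"
  unfolding initial_delta_at_infinity_def
proof (intro allI impI)
  fix \<phi> :: "real \<Rightarrow> real" and c :: real assume \<phi>: "continuous_on {0<..} \<phi> \<and> bounded (\<phi> ` {0<..}) \<and> (\<phi> \<longlongrightarrow> c) at_top"
  have "filterlim (\<lambda>w. w powr (1 / \<gamma>)) at_top (at_right (0::real))"
  proof -
    have "filterlim (\<lambda>w. (- 1 / \<gamma>) * (- ln w)) at_top (at_right (0::real))"
      by (intro filterlim_tendsto_pos_mult_at_top[OF tendsto_const])
        (use that in \<open>auto simp: filterlim_uminus_at_top[symmetric] filterlim_uminus_at_bot divide_neg_neg intro!: filterlim_compose[OF filterlim_uminus_at_top_at_bot] ln_at_0\<close>)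
    then have "filterlim (\<lambda>w. exp ((- 1 / \<gamma>) * (- ln w))) at_top (at_right (0::real))"
      by (rule filterlim_compose[OF exp_at_top])
    moreover have "\<forall>\<^sub>F w in at_right (0::real). exp ((- 1 / \<gamma>) * (- ln w)) = w powr (1 / \<gamma>)"
      using eventually_at_right_less[of 0] by eventually_elim (auto simp: powr_def)
    ultimately show ?thesis using filterlim_cong[OF refl refl] by fast
  qed
  then have "((\<lambda>w. \<phi> (w powr (1 / \<gamma>))) \<longlongrightarrow> c) (at_right 0)"
    using \<phi> filterlim_compose[of \<phi> "nhds c" at_top] by blast
  then show "(\<forall>t>0. set_integrable lborel {0<..} (\<lambda>x. \<phi> x * u x t)) \<and>
      ((\<lambda>t. LINT x:{0<..}|lborel. \<phi> x * u x t) \<longlongrightarrow> c) (at_right 0)"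
    using weak_limit_mixture \<phi> by blast
qed

text \<open>
  A test function supported inside the half-line vanishes near both ends, so it falls under the
  limit at 0 or the limit at infinity according to the sign of \<open>\<gamma>\<close>, with value 0 either way.
\<close>

lemma initial_interior: "initial_delta interior_tests u"
  unfolding initial_delta_def
proof
  fix \<phi> assume "\<phi> \<in> interior_tests"
  then have \<phi>: "continuous_on UNIV \<phi>" and cp: "compact (closure {x. \<phi> x \<noteq> 0})"
    and sub: "closure {x. \<phi> x \<noteq> 0} \<subseteq> {0<..}"
    by (auto simp: interior_tests_def)
  have \<phi>0: "\<phi> 0 = 0"
    using sub closure_subset[of "{x. \<phi> x \<noteq> 0}"] by force
  have "bounded (\<phi> ` closure {x. \<phi> x \<noteq> 0})"
    by (intro compact_imp_bounded compact_continuous_image cp continuous_on_subset[OF \<phi>]) auto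
  then have "bounded (insert 0 (\<phi> ` closure {x. \<phi> x \<noteq> 0}))" by simp
  then have b: "bounded (range \<phi>)"
    by (rule bounded_subset) (use closure_subset[of "{x. \<phi> x \<noteq> 0}"] in auto)
  show "(\<forall>t>0. set_integrable lborel {0<..} (\<lambda>x. \<phi> x * u x t)) \<and>
      ((\<lambda>t. LINT x:{0<..}|lborel. \<phi> x * u x t) \<longlongrightarrow> \<phi> 0) (at_right 0)"
  proof (cases "\<gamma> > 0")
    case True
    have "\<phi> \<in> bounded_continuous_tests"
      using \<phi> b by (auto simp: bounded_continuous_tests_def intro: continuous_on_subset bounded_subset)
    then show ?thesis using initial_bounded_continuous[OF True] by (auto simp: initial_delta_def)
  next
    case False
    then have "\<gamma> < 0" using \<gamma> by simp
    obtain R where R: "\<And>x. x \<in> closure {x. \<phi> x \<noteq> 0} \<Longrightarrow> \<bar>x\<bar> \<le> R"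
      using compact_imp_bounded[OF cp] unfolding bounded_iff by auto
    have "\<forall>\<^sub>F x in at_top. 0 = \<phi> x"
      using eventually_gt_at_top[of R]
    proof eventually_elim
      case (elim x)
      show ?case
      proof (rule ccontr)
        assume "0 \<noteq> \<phi> x"
        then have "x \<in> closure {x. \<phi> x \<noteq> 0}" using closure_subset[of "{x. \<phi> x \<noteq> 0}"] by auto
        from R[OF this] elim show False by simp
      qed
    qed
    then have "(\<phi> \<longlongrightarrow> 0) at_top" by (rule Lim_transform_eventually[OF tendsto_const])
    moreover have "continuous_on {0<..} \<phi>" using \<phi> by (rule continuous_on_subset) auto
    moreover have "bounded (\<phi> ` {0<..})" using b by (rule bounded_subset) auto
    ultimately show ?thesis
      using initial_at_infinity[OF \<open>\<gamma> < 0\<close>] unfolding \<phi>0 initial_delta_at_infinity_def by blast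
  qed
qed

end
end

section \<open>The law of the inverse process, and the solution\<close>

lemma stable_law_point_mass: "stable_law (return borel 1) 1"
proof -
  interpret prob_space "return borel (1::real)" by (rule prob_space_return) simp
  show ?thesis
    by unfold_locales (auto simp: AE_return integral_return)
qed

text \<open>
  There is no atom at 0, because the probability of \<open>H 1 \<le> 0\<close> is at most
  \<open>E exp (- \<theta> * H 1) = exp (- \<theta> powr \<nu>)\<close> for every \<open>\<theta>\<close>, which tends to 0.
\<close>

lemma stable_law_of_subordinator:
  assumes H: "stable_subordinator M \<nu> H" and \<nu>: "\<nu> > 0"
  shows "stable_law (distr M borel (H 1)) \<nu>"
proof -
  interpret prob_space M using H by (simp add: stable_subordinator_def)
  have [measurable]: "H 1 \<in> borel_measurable M" using H by (simp add: stable_subordinator_def)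
  have L: "(\<integral>\<omega>. exp (- \<theta> * H 1 \<omega>) \<partial>M) = exp (- (\<theta> powr \<nu>))" if "\<theta> > 0" for \<theta>
    using H that unfolding stable_subordinator_def by (metis mult_minus_left mult_1 zero_le_one)
  have nn: "AE \<omega> in M. 0 \<le> H 1 \<omega>" using H unfolding stable_subordinator_def by simp
  define p where "p = prob {\<omega> \<in> space M. H 1 \<omega> \<le> 0}"
  have p: "p \<le> exp (- (\<theta> powr \<nu>))" if \<theta>: "\<theta> > 0" for \<theta>
  proof -
    have "p = (\<integral>\<omega>. indicator {\<omega> \<in> space M. H 1 \<omega> \<le> 0} \<omega> \<partial>M)"
      by (simp add: p_def)
    also have "\<dots> \<le> (\<integral>\<omega>. exp (- \<theta> * H 1 \<omega>) \<partial>M)"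
    proof (rule integral_mono_AE)
      show "integrable M (\<lambda>\<omega>. exp (- \<theta> * H 1 \<omega>))"
        using nn \<theta> by (intro integrable_const_bound[where B = 1]) (auto elim: eventually_mono)
      show "AE \<omega> in M. indicator {\<omega> \<in> space M. H 1 \<omega> \<le> 0} \<omega> \<le> exp (- \<theta> * H 1 \<omega>)"
        using nn by eventually_elim (auto simp: indicator_def)
    qed (auto simp: less_top[symmetric])
    finally show ?thesis using L[OF \<theta>] by simp
  qed
  have "((\<lambda>\<theta>. exp (- \<theta>)) \<longlongrightarrow> (0::real)) at_top"
    by (rule filterlim_compose[OF exp_at_bot filterlim_uminus_at_bot_at_top])
  then have "p \<le> 0"
  proof (rule tendsto_lowerbound)
    show "\<forall>\<^sub>F \<theta> in at_top. p \<le> exp (- \<theta>)"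
      using eventually_gt_at_top[of 0]
    proof eventually_elim
      case (elim \<theta>)
      then show ?case using p[of "\<theta> powr (1 / \<nu>)"] \<nu> by (simp add: powr_powr)
    qed
  qed simp
  then have "p = 0" by (simp add: p_def measure_le_0_iff)
  then have "AE \<omega> in M. \<not> H 1 \<omega> \<le> 0"
    unfolding p_def by (subst (asm) prob_Collect_eq_0) auto
  then have "AE y in distr M borel (H 1). 0 < y"
    by (subst AE_distr_iff) (auto simp: not_le)
  then show ?thesis
    using L \<nu> prob_space_distr[of "H 1" borel]
    by (auto simp: stable_law_def stable_law_axioms_def integral_distr)
qed

text \<open>
  The event \<open>L t < z\<close> has the probability of \<open>H z > t\<close>, and by the scaling of \<open>H\<close> this is the probability of
  \<open>z powr (1 / \<nu>) * H 1 > t\<close>, that is of \<open>(t / H 1) powr \<nu> < z\<close>.  The statement is about negatives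
  because laws are compared on the rays \<open>{x<..}\<close>, whereas the definition of an inverse process
  gives the probabilities of \<open>L t < z\<close>.
\<close>

lemma distr_inverse_process:
  assumes H: "stable_subordinator M \<nu> H" and \<nu>: "\<nu> > 0" and L: "inverse_process M H L"
    and l: "density_on_half_line M L l" and t: "t > 0"
  shows "distr M borel (\<lambda>\<omega>. - L t \<omega>) = distr M borel (\<lambda>\<omega>. - ((t / H 1 \<omega>) powr \<nu>))"
proof -
  interpret prob_space M using H by (simp add: stable_subordinator_def)
  interpret S: stable_law "distr M borel (H 1)" \<nu> by (rule stable_law_of_subordinator[OF H \<nu>])
  have Hm: "H z \<in> borel_measurable M" if "z \<ge> 0" for z using H that by (simp add: stable_subordinator_def)
  have H1[measurable]: "H 1 \<in> borel_measurable M" by (rule Hm) simp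
  have Lm[measurable]: "L t \<in> borel_measurable M" using L t by (simp add: inverse_process_def)
  have S: "AE \<omega> in M. 0 < H 1 \<omega>" using S.pos by (simp add: AE_distr_iff)
  have Lpos: "AE \<omega> in M. 0 < L t \<omega>"
  proof -
    have d: "distributed M lborel (L t) (\<lambda>x. ennreal (indicator {0<..} x * l x t))"
      using l t by (simp add: density_on_half_line_def)
    have "AE x in density lborel (\<lambda>x. ennreal (indicator {0<..} x * l x t)). x > 0"
      using distributed_borel_measurable[OF d]
      by (subst AE_density) (auto simp: indicator_def)
    then have "AE x in distr M lborel (L t). x > 0"
      using distributed_distr_eq_density[OF d] by (simp only:)
    then show ?thesis by (subst (asm) AE_distr_iff) auto
  qed
  \<comment> \<open>self-similarity of the subordinator, from the uniqueness of Laplace transforms\<close>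
  have scaling: "distr M borel (H z) = distr M borel (\<lambda>\<omega>. z powr (1 / \<nu>) * H 1 \<omega>)" if z: "z > 0" for z
  proof (rule distr_eq_of_Laplace_eq)
    show "H z \<in> borel_measurable M" by (rule Hm) (use z in simp)
    show "AE \<omega> in M. 0 \<le> H z \<omega>" using H z unfolding stable_subordinator_def by simp
    show "AE \<omega> in M. 0 \<le> z powr (1 / \<nu>) * H 1 \<omega>" using S by (auto elim: eventually_mono)
    fix \<theta> :: real assume \<theta>: "\<theta> > 0"
    have E: "expectation (\<lambda>\<omega>. exp (- \<theta> * H z \<omega>)) = exp (- z * \<theta> powr \<nu>)" if "z > 0" "\<theta> > 0" for z \<theta>
      using H that unfolding stable_subordinator_def by simp
    have "expectation (\<lambda>\<omega>. exp (- (\<theta> * z powr (1 / \<nu>)) * H 1 \<omega>)) = exp (- 1 * (\<theta> * z powr (1 / \<nu>)) powr \<nu>)"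
      by (rule E) (use \<theta> z in auto)
    also have "(\<theta> * z powr (1 / \<nu>)) powr \<nu> = z * \<theta> powr \<nu>"
      using \<theta> z \<nu> by (simp add: powr_mult powr_powr)
    finally show "expectation (\<lambda>\<omega>. exp (- \<theta> * H z \<omega>)) = expectation (\<lambda>\<omega>. exp (- \<theta> * (z powr (1 / \<nu>) * H 1 \<omega>)))"
      using E[OF z \<theta>] by (simp add: mult_ac)
  qed (use prob_space_axioms in auto)
  show ?thesis
  proof (rule measure_eqI_lessThan)
    fix x :: real
    have e1: "emeasure (distr M borel (\<lambda>\<omega>. - L t \<omega>)) {x<..} = emeasure M {\<omega> \<in> space M. L t \<omega> < - x}"
      by (subst emeasure_distr) (auto intro!: arg_cong[where f = "emeasure M"])
    have e2: "emeasure (distr M borel (\<lambda>\<omega>. - ((t / H 1 \<omega>) powr \<nu>))) {x<..} = emeasure M {\<omega> \<in> space M. (t / H 1 \<omega>) powr \<nu> < - x}"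
      by (subst emeasure_distr) (auto intro!: arg_cong[where f = "emeasure M"])
    show "emeasure (distr M borel (\<lambda>\<omega>. - L t \<omega>)) {x<..} < \<infinity>"
      unfolding e1 by (simp add: less_top[symmetric])
    show "emeasure (distr M borel (\<lambda>\<omega>. - L t \<omega>)) {x<..} = emeasure (distr M borel (\<lambda>\<omega>. - ((t / H 1 \<omega>) powr \<nu>))) {x<..}"
    proof (cases "x < 0")
      case True
      define z where "z = - x"
      have z: "z > 0" using True by (simp add: z_def)
      have [measurable]: "H z \<in> borel_measurable M" by (rule Hm) (use z in simp)
      have "emeasure M {\<omega> \<in> space M. L t \<omega> < z} = emeasure M {\<omega> \<in> space M. H z \<omega> > t}"
        using L z t by (simp add: emeasure_eq_measure inverse_process_def)
      also have "\<dots> = emeasure (distr M borel (H z)) {t<..}"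
        by (subst emeasure_distr) (auto intro!: arg_cong[where f = "emeasure M"])
      also have "\<dots> = emeasure M {\<omega> \<in> space M. z powr (1 / \<nu>) * H 1 \<omega> > t}"
        unfolding scaling[OF z]
        by (subst emeasure_distr) (auto intro!: arg_cong[where f = "emeasure M"])
      also have "\<dots> = emeasure M {\<omega> \<in> space M. (t / H 1 \<omega>) powr \<nu> < z}"
      proof (rule emeasure_eq_AE)
        show "AE \<omega> in M. \<omega> \<in> {\<omega> \<in> space M. z powr (1 / \<nu>) * H 1 \<omega> > t} \<longleftrightarrow> \<omega> \<in> {\<omega> \<in> space M. (t / H 1 \<omega>) powr \<nu> < z}"
          using S
        proof eventually_elim
          case (elim \<omega>)
          have "z = (z powr (1 / \<nu>)) powr \<nu>" using z \<nu> by (simp add: powr_powr)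
          then have "(t / H 1 \<omega>) powr \<nu> < z \<longleftrightarrow> (t / H 1 \<omega>) powr \<nu> < (z powr (1 / \<nu>)) powr \<nu>" by simp
          also have "\<dots> \<longleftrightarrow> t / H 1 \<omega> < z powr (1 / \<nu>)"
          proof
            assume "(t / H 1 \<omega>) powr \<nu> < (z powr (1 / \<nu>)) powr \<nu>"
            then show "t / H 1 \<omega> < z powr (1 / \<nu>)"
              by (rule powr_less_cancel2[rotated 3]) (use \<nu> t elim z in auto)
          next
            assume "t / H 1 \<omega> < z powr (1 / \<nu>)"
            then show "(t / H 1 \<omega>) powr \<nu> < (z powr (1 / \<nu>)) powr \<nu>"
              by (rule powr_less_mono2[rotated 2]) (use \<nu> t elim in auto)
          qed
          also have "\<dots> \<longleftrightarrow> z powr (1 / \<nu>) * H 1 \<omega> > t"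
            using elim by (simp add: pos_divide_less_eq)
          finally show ?case by auto
        qed
      qed auto
      finally show ?thesis unfolding e1 e2 z_def .
    next
      case False
      have "emeasure M {\<omega> \<in> space M. L t \<omega> < - x} = emeasure M {}"
        by (rule emeasure_eq_AE) (use Lpos False in \<open>auto elim!: eventually_mono\<close>)
      moreover have "emeasure M {\<omega> \<in> space M. (t / H 1 \<omega>) powr \<nu> < - x} = emeasure M {}"
      proof (rule emeasure_eq_AE)
        show "AE \<omega> in M. \<omega> \<in> {\<omega> \<in> space M. (t / H 1 \<omega>) powr \<nu> < - x} \<longleftrightarrow> \<omega> \<in> {}"
        proof (rule AE_I2)
          fix \<omega>
          have "- x \<le> 0" using False by simp
          also have "0 \<le> (t / H 1 \<omega>) powr \<nu>" by (rule powr_ge_zero)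
          finally show "\<omega> \<in> {\<omega> \<in> space M. (t / H 1 \<omega>) powr \<nu> < - x} \<longleftrightarrow> \<omega> \<in> {}" by simp
        qed
      qed auto
      ultimately show ?thesis unfolding e1 e2 by simp
    qed
  qed auto
qed

text \<open>
  The density is determined only almost everywhere for each \<open>t\<close>, but the integral depends on it only through
  the law of \<open>L t\<close>, which is explicit.  Integrability holds because the kernel is bounded in its last
  argument.
\<close>

lemma utilde_integrable_and_eq:
  assumes H: "stable_subordinator M \<nu> H" and \<nu>: "\<nu> > 0" and L: "inverse_process M H L"
    and l: "density_on_half_line M L l" and t: "t > 0"
    and \<gamma>: "\<gamma> \<noteq> 0" and \<mu>: "\<mu> > 0" and x: "x > 0"
  shows "set_integrable lborel {0<..} (\<lambda>s. gtilde \<gamma> \<mu> x s * l s t)"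
    and "(LINT s:{0<..}|lborel. gtilde \<gamma> \<mu> x s * l s t) = (\<integral>y. gtilde \<gamma> \<mu> x ((t / y) powr \<nu>) \<partial>distr M borel (H 1))"
proof -
  interpret prob_space M using H by (simp add: stable_subordinator_def)
  have H1[measurable]: "H 1 \<in> borel_measurable M" using H by (simp add: stable_subordinator_def)
  have Lm[measurable]: "L t \<in> borel_measurable M" using L t by (simp add: inverse_process_def)
  have d: "distributed M lborel (L t) (\<lambda>x. ennreal (indicator {0<..} x * l x t))"
    using l t by (simp add: density_on_half_line_def)
  have l0: "0 \<le> indicator {0<..} s * l s t" for s
    using l t by (simp add: density_on_half_line_def indicator_def)
  have [measurable]: "gtilde \<gamma> \<mu> x \<in> borel_measurable borel"
    unfolding gtilde_def g_def Q_def by measurable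
  define G where "G s = indicator {0<..} s * gtilde \<gamma> \<mu> x s" for s
  have [measurable]: "G \<in> borel_measurable borel" unfolding G_def by measurable
  define C where "C = \<bar>\<gamma>\<bar> / Gamma \<mu> * x powr (\<gamma> * \<mu> - 1) * (1 + (\<mu> / x powr \<gamma>) powr \<mu>)"
  have G: "\<bar>G s\<bar> \<le> \<bar>C\<bar>" for s
  proof (cases "s > 0")
    case True
    have "G s = \<bar>\<gamma>\<bar> / Gamma \<mu> * x powr (\<gamma> * \<mu> - 1) * ((1 / s) powr \<mu> * exp (- (x powr \<gamma>) * (1 / s)))"
      using True gtilde_eq[OF \<gamma> x True] by (simp add: G_def)
    also have "\<dots> \<le> C"
      unfolding C_def using \<mu> x True Gamma_real_pos[OF \<mu>] by (intro mult_left_mono powr_mult_exp_le) auto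
    finally have "G s \<le> C" .
    moreover have "G s \<ge> 0" using gtilde_nonneg[OF \<mu> \<gamma> x True] by (simp add: G_def)
    ultimately show ?thesis by simp
  qed (simp add: G_def)
  have eq: "(\<lambda>s. indicator {0<..} s *\<^sub>R (gtilde \<gamma> \<mu> x s * l s t)) = (\<lambda>s. indicator {0<..} s * l s t * G s)"
    by (auto simp: G_def indicator_def)
  have "integrable M (\<lambda>\<omega>. G (L t \<omega>))"
    by (rule integrable_const_bound[where B = "\<bar>C\<bar>"]) (use G in auto)
  then have "integrable lborel (\<lambda>s. indicator {0<..} s * l s t * G s)"
    by (subst distributed_integrable[OF d]) (use l0 in auto)
  then show "set_integrable lborel {0<..} (\<lambda>s. gtilde \<gamma> \<mu> x s * l s t)"
    unfolding set_integrable_def eq .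
  have "(LINT s:{0<..}|lborel. gtilde \<gamma> \<mu> x s * l s t) = (\<integral>\<omega>. G (L t \<omega>) \<partial>M)"
    unfolding set_lebesgue_integral_def eq by (rule distributed_integral[OF d]) (use l0 in auto)
  also have "\<dots> = (\<integral>z. G (- z) \<partial>distr M borel (\<lambda>\<omega>. - L t \<omega>))"
    by (subst integral_distr) auto
  also have "\<dots> = (\<integral>z. G (- z) \<partial>distr M borel (\<lambda>\<omega>. - ((t / H 1 \<omega>) powr \<nu>)))"
    by (simp only: distr_inverse_process[OF H \<nu> L l t])
  also have "\<dots> = (\<integral>\<omega>. G ((t / H 1 \<omega>) powr \<nu>) \<partial>M)"
    by (subst integral_distr) auto
  also have "\<dots> = (\<integral>y. G ((t / y) powr \<nu>) \<partial>distr M borel (H 1))"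
    by (subst integral_distr) auto
  also have "\<dots> = (\<integral>y. gtilde \<gamma> \<mu> x ((t / y) powr \<nu>) \<partial>distr M borel (H 1))"
  proof (rule integral_cong_AE)
    show "AE y in distr M borel (H 1). G ((t / y) powr \<nu>) = gtilde \<gamma> \<mu> x ((t / y) powr \<nu>)"
      using stable_law.pos[OF stable_law_of_subordinator[OF H \<nu>]]
      by eventually_elim (use t in \<open>simp add: G_def\<close>)
  qed measurable
  finally show "(LINT s:{0<..}|lborel. gtilde \<gamma> \<mu> x s * l s t) = (\<integral>y. gtilde \<gamma> \<mu> x ((t / y) powr \<nu>) \<partial>distr M borel (H 1))" .
qed

lemma has_real_derivative_gtilde:
  assumes \<gamma>: "\<gamma> \<noteq> 0" and x: "x > 0" and t: "t > 0"
  shows "(gtilde \<gamma> \<mu> x has_real_derivative \<bar>\<gamma>\<bar> / Gamma \<mu> * x powr (\<gamma> * \<mu> - 1) *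
      (x powr \<gamma> * ((1 / t) powr (\<mu> + 2) * exp (- (x powr \<gamma>) * (1 / t))) - \<mu> * ((1 / t) powr (\<mu> + 1) * exp (- (x powr \<gamma>) * (1 / t))))) (at t)"
proof -
  define a where "a = x powr \<gamma>"
  have "((\<lambda>s. s powr (- \<mu>) * exp (- a / s)) has_real_derivative
    (- \<mu> * t powr (- \<mu> - 1)) * exp (- a / t) + t powr (- \<mu>) * ((a / (t * t)) * exp (- a / t))) (at t)"
    using t by (auto intro!: derivative_eq_intros simp: field_simps)
  moreover have "(- \<mu> * t powr (- \<mu> - 1)) * exp (- a / t) + t powr (- \<mu>) * ((a / (t * t)) * exp (- a / t)) =
     a * ((1 / t) powr (\<mu> + 2) * exp (- a * (1 / t))) - \<mu> * ((1 / t) powr (\<mu> + 1) * exp (- a * (1 / t)))"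
  proof -
    have "(1 / t) powr (\<mu> + 2) = t powr (- \<mu>) / (t * t)" "(1 / t) powr (\<mu> + 1) = t powr (- \<mu> - 1)"
      using t by (simp_all add: powr_divide powr_minus powr_diff powr_add powr_numeral power2_eq_square field_simps)
    then show ?thesis by (simp add: algebra_simps)
  qed
  ultimately have "((\<lambda>s. s powr (- \<mu>) * exp (- a / s)) has_real_derivative
     a * ((1 / t) powr (\<mu> + 2) * exp (- a * (1 / t))) - \<mu> * ((1 / t) powr (\<mu> + 1) * exp (- a * (1 / t)))) (at t)"
    by simp
  then have "((\<lambda>s. \<bar>\<gamma>\<bar> / Gamma \<mu> * x powr (\<gamma> * \<mu> - 1) * (s powr (- \<mu>) * exp (- a / s))) has_real_derivative
     \<bar>\<gamma>\<bar> / Gamma \<mu> * x powr (\<gamma> * \<mu> - 1) * (a * ((1 / t) powr (\<mu> + 2) * exp (- a * (1 / t))) - \<mu> * ((1 / t) powr (\<mu> + 1) * exp (- a * (1 / t))))) (at t)"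
    by (rule DERIV_cmult)
  then show ?thesis
    unfolding a_def
  proof (rule has_field_derivative_transform_within_open[where S = "{0<..}"])
    fix s :: real assume "s \<in> {0<..}"
    then have s: "s > 0" by simp
    have "(1 / s) powr \<mu> = s powr (- \<mu>)" using s by (simp add: powr_divide powr_minus field_simps)
    then show "\<bar>\<gamma>\<bar> / Gamma \<mu> * x powr (\<gamma> * \<mu> - 1) * (s powr (- \<mu>) * exp (- (x powr \<gamma>) / s)) = gtilde \<gamma> \<mu> x s"
      using gtilde_eq[OF \<gamma> x s] by simp
  qed (use t in auto)
qed

theorem theorem1:
  fixes \<gamma> \<mu> \<nu> :: real
    and M :: "'a measure"
    and H L :: "real \<Rightarrow> 'a \<Rightarrow> real"
    and l :: "real \<Rightarrow> real \<Rightarrow> real"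
  assumes "\<gamma> \<noteq> 0" and "\<mu> > 0" and "0 < \<nu>" and "\<nu> \<le> 1"
    and "\<nu> < 1 \<Longrightarrow> stable_subordinator M \<nu> H"
    and "\<nu> < 1 \<Longrightarrow> inverse_process M H L"
    and "\<nu> < 1 \<Longrightarrow> density_on_half_line M L l"
  shows "(\<nu> < 1 \<longrightarrow> (\<forall>x>0. \<forall>t>0. set_integrable lborel {0<..} (\<lambda>s. gtilde \<gamma> \<mu> x s * l s t))) \<and>
    (\<forall>x>0. \<forall>t>0.
      RL_deriv_exists \<nu> (\<lambda>\<tau>. utilde l \<gamma> \<mu> \<nu> x \<tau>) t \<and>
      Gstar_exists \<gamma> \<mu> (\<lambda>y. utilde l \<gamma> \<mu> \<nu> y t) x \<and>
      RL_deriv \<nu> (\<lambda>\<tau>. utilde l \<gamma> \<mu> \<nu> x \<tau>) t = Gstar \<gamma> \<mu> (\<lambda>y. utilde l \<gamma> \<mu> \<nu> y t) x) \<and>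
    initial_delta interior_tests (utilde l \<gamma> \<mu> \<nu>) \<and>
    (\<gamma> > 0 \<longrightarrow> initial_delta bounded_continuous_tests (utilde l \<gamma> \<mu> \<nu>)) \<and>
    (\<gamma> < 0 \<longrightarrow> initial_delta_at_infinity (utilde l \<gamma> \<mu> \<nu>))"
proof (cases "\<nu> = 1")
  case True
  interpret stable_law "return borel 1" 1 by (rule stable_law_point_mass)
  have rep: "utilde l \<gamma> \<mu> \<nu> x t = (\<integral>y. gtilde \<gamma> \<mu> x ((t / y) powr 1) \<partial>return borel 1)" if "x > 0" "t > 0" for x t
  proof -
    have "(\<lambda>y. gtilde \<gamma> \<mu> x ((t / y) powr 1)) \<in> borel_measurable borel"
      unfolding gtilde_def g_def Q_def by measurable
    then show ?thesis using True that by (simp add: utilde_def integral_return)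
  qed
  note sol = \<open>\<gamma> \<noteq> 0\<close> \<open>\<mu> > 0\<close> rep
  have tilted_moment: "tilted_moment (return borel 1) 1 p a t = (1 / t) powr p * exp (- a * (1 / t))" if "t > 0" for p a t :: real
    unfolding tilted_moment_def using that by (subst integral_return) auto
  have eqn: "RL_deriv_exists \<nu> (\<lambda>\<tau>. utilde l \<gamma> \<mu> \<nu> x \<tau>) t \<and>
      Gstar_exists \<gamma> \<mu> (\<lambda>y. utilde l \<gamma> \<mu> \<nu> y t) x \<and>
      RL_deriv \<nu> (\<lambda>\<tau>. utilde l \<gamma> \<mu> \<nu> x \<tau>) t = Gstar \<gamma> \<mu> (\<lambda>y. utilde l \<gamma> \<mu> \<nu> y t) x"
    if x: "x > 0" and t: "t > 0" for x t
  proof -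
    have u: "(\<lambda>\<tau>. utilde l \<gamma> \<mu> \<nu> x \<tau>) = gtilde \<gamma> \<mu> x"
      using True by (simp add: utilde_def)
    have G: "Gstar \<gamma> \<mu> (\<lambda>y. utilde l \<gamma> \<mu> \<nu> y t) x = \<bar>\<gamma>\<bar> / Gamma \<mu> * x powr (\<gamma> * \<mu> - 1) *
      (x powr \<gamma> * ((1 / t) powr (\<mu> + 2) * exp (- (x powr \<gamma>) * (1 / t))) - \<mu> * ((1 / t) powr (\<mu> + 1) * exp (- (x powr \<gamma>) * (1 / t))))"
      using Gstar_mixture(2)[OF sol x t] unfolding tilted_moment[OF t] .
    have d: "((\<lambda>\<tau>. utilde l \<gamma> \<mu> \<nu> x \<tau>) has_real_derivative Gstar \<gamma> \<mu> (\<lambda>y. utilde l \<gamma> \<mu> \<nu> y t) x) (at t)"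
      unfolding u G by (rule has_real_derivative_gtilde[OF \<open>\<gamma> \<noteq> 0\<close> x t])
    then have "RL_deriv_exists \<nu> (\<lambda>\<tau>. utilde l \<gamma> \<mu> \<nu> x \<tau>) t"
      using True by (auto simp: RL_deriv_exists_def field_differentiable_def)
    moreover have "RL_deriv \<nu> (\<lambda>\<tau>. utilde l \<gamma> \<mu> \<nu> x \<tau>) t = Gstar \<gamma> \<mu> (\<lambda>y. utilde l \<gamma> \<mu> \<nu> y t) x"
      unfolding RL_deriv_def using True DERIV_imp_deriv[OF d] by simp
    ultimately show ?thesis using Gstar_mixture(1)[OF sol x t] by blast
  qed
  have int: "set_integrable lborel {0<..} (\<lambda>s. gtilde \<gamma> \<mu> x s * l s t)" if "\<nu> < 1" for x t
    using True that by simp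
  show ?thesis
    by (intro conjI allI impI int eqn initial_interior[OF sol] initial_bounded_continuous[OF sol]
        initial_at_infinity[OF sol])
next
  case False
  then have \<nu>1: "\<nu> < 1" using assms by simp
  note H = assms(5)[OF \<nu>1] and L = assms(6)[OF \<nu>1] and l = assms(7)[OF \<nu>1]
  interpret stable_law "distr M borel (H 1)" \<nu>
    by (rule stable_law_of_subordinator[OF H \<open>0 < \<nu>\<close>])
  note U = utilde_integrable_and_eq[OF H \<open>0 < \<nu>\<close> L l _ \<open>\<gamma> \<noteq> 0\<close> \<open>\<mu> > 0\<close>]
  have rep: "utilde l \<gamma> \<mu> \<nu> x t = (\<integral>y. gtilde \<gamma> \<mu> x ((t / y) powr \<nu>) \<partial>distr M borel (H 1))" if "x > 0" "t > 0" for x t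
    using U(2)[OF that(2) that(1)] False by (simp add: utilde_def)
  note sol = \<open>\<gamma> \<noteq> 0\<close> \<open>\<mu> > 0\<close> rep
  show ?thesis
    by (intro conjI allI impI U(1) fractional_equation[OF sol _ _ \<nu>1] Gstar_mixture(1)[OF sol]
        initial_interior[OF sol] initial_bounded_continuous[OF sol] initial_at_infinity[OF sol])
qed

end
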